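(* Let $f,g\in\mathbb{K}[x]$ be monic polynomials of degrees $m$ and $n$, with multisets of roots $A,B\subset\mathbb{K}$ respectively (so $f=\prod_{a\in A}(x-a)$, $g=\prod_{b\in B}(x-b)$, products with multiplicity). Let $\overline A$ and $\overline B$ be subsets of the sets of distinct roots of $f$ and $g$, respectively, with $\overline m=|\overline A|$ and $\overline n=|\overline B|$, and set $m':=m-\overline m$ and $n':=n-\overline n$. For any $d$ such that $0\le d<\min\{m,n\}$, we have $$F_d(f,g)(x)=(-1)^{m-d+(n-d-1)(m-n')}\sum_{(R_1,R_2,R_3)\in\mathcal P_F}(-1)^{\overline\sigma_R}\sum_{\substack{A'\subset\overline A\\|A'|=r_3+\min\{n',d-m'\}}}\ \sum_{\substack{B'\subset\overline B\\|B'|=r_2-(n'-d-1)}}\frac{\mathcal{R}(B\backslash\overline B,\overline A\backslash A')\,\mathcal{R}(\overline B\backslash B',A\backslash A')\,\mathcal{R}(x,\overline B\backslash B')}{\mathcal{R}(A',\overline A\backslash A')\,\mathcal{R}(B',\overline B\backslash B')}\cdot S_{d+1}^{(\widetilde R_1)}(A'\cup B')\,S_{m+n-d}^{(R_2)}(A\cup(\overline B\backslash B')\cup\{x\})\,S_{m+n-d}^{(R_3)}((\overline A\backslash A')\cup B),$$ $$G_d(f,g)(x)=(-1)^{(m-d-1)(d-m')}\sum_{(R_1,R_2,R_3)\in\mathcal P_G}(-1)^{\widetilde\sigma_R}\sum_{\substack{A'\subset\overline A\\|A'|=r_2-(m'-d-1)}}\ \sum_{\substack{B'\subset\overline B\\|B'|=r_3+\min\{m',d-n'\}}}\frac{\mathcal{R}(A\backslash\overline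 A,\overline B\backslash B')\,\mathcal{R}(\overline A\backslash A',B\backslash B')\,\mathcal{R}(x,\overline A\backslash A')}{\mathcal{R}(A',\overline A\backslash A')\,\mathcal{R}(B',\overline B\backslash B')}\cdot S_{d+1}^{(\widetilde R_1)}(A'\cup B')\,S_{m+n-d}^{(R_2)}((\overline A\backslash A')\cup B\cup\{x\})\,S_{m+n-d}^{(R_3)}(A\cup(\overline B\backslash B')).$$ Here $r_i=|R_i|$; $\mathcal P_F$ is the set of triples with $R_1\sqcup R_2\sqcup R_3=\{1,\dots,m'+n'-d\}$, $R_1\subset\{m+n-2d,\dots,m'+n'-d\}$, $r_1\le\max\{0,d+2-(\overline m+\overline n)\}$, $n'-d-1\le r_2\le n-d-1$, $m'-d\le r_3\le m-d$; $\mathcal P_G$ is the set of triples with $R_1\sqcup R_2\sqcup R_3=\{1,\dots,m'+n'-d\}$, $R_1\subset\{m+n-2d,\dots,m'+n'-d\}$, $r_1\le\max\{0,d+2-(\overline m+\overline n)\}$, $m'-d-1\le r_2\le m-d-1$, $n'-d\le r_3\le n-d$; and, with $R=(R_1,R_2,R_3)$, $$(-1)^{\overline\sigma_R}:=(-1)^{r_1(m-d+r_2+r_3)+r_2\overline n+r_3(m'+n'-d-1)+r_2r_3}\operatorname{sg}(R),$$ $$(-1)^{\widetilde\sigma_R}:=(-1)^{r_1(n-d+r_2+r_3)+r_2\overline m+r_3(m'+n'-d-1)+r_2r_3}\operatorname{sg}(R),$$ $$\widetilde R_1:=\{i-(m+n-2d-2): i\in R_1\}.$$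
   Context: $\mathbb{K}$ is a field. For a multiset $X$, $|X|$ is the number of elements counted with multiplicity; for multisets $X'\subset X$, $X\backslash X'$ is the multiset difference; unions of multisets appearing as arguments of $S_k^{(R)}$ add multiplicities. For multisets $X,Y$, $\mathcal{R}(X,Y):=\prod_{x\in X,\,y\in Y}(x-y)$ (with multiplicities), equal to $1$ if $X$ or $Y$ is empty; $\mathcal{R}(x,Y):=\mathcal{R}(\{x\},Y)$. Integer intervals $\{p,\dots,q\}$ with $p>q$ are empty. For $f=f_mx^m+\cdots+f_0$, $g=g_nx^n+\cdots+g_0$ and $0\le d<\min\{m,n\}$, $F_d(f,g)(x)$ and $G_d(f,g)(x)$ are determinants of square matrices of size $m+n-2d$ (coefficients with index outside the range are $0$). In both matrices, for $1\le j\le m+n-2d-1$, column $j$ has entry $f_{m+i-j}$ in row $i$ for $1\le i\le n-d$, and entry $g_{n+i-j}$ in row $n-d+i$ for $1\le i\le m-d$. The last column is, for $F_d$: entry $x^{n-d-i}$ in row $i$ for $1\le i\le n-d$, and $0$ in the remaining $m-d$ rows; for $G_d$: entry $0$ in the first $n-d$ rows, and $x^{m-d-i}$ in row $n-d+i$ for $1\le i\le m-d$. Confluent Schur polynomials: for a multiset $X$ with distinct elements $x_1,\dots,x_{\overline r}$ of multiplicities $j_1,\dots,j_{\overline r}$, $r=j_1+\cdots+j_{\overline r}\le k$, let $V_k(X)=\big(V_k(x_1,j_1)\ \cdots\ V_k(x_{\overline r},j_{\overline r})\big)$ be the $k\times r$ confluent Vandermonde matrix, where $V_k(x_i,j)$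 is the $k\times j$ matrix whose first column is $(x_i^{k-1},x_i^{k-2},\dots,x_i,1)^T$ and whose $(l+1)$-th column is the $l$-th derivative with respect to $x_i$ of the first one. Write $V(X):=V_r(X)$. For $R\subset\{1,\dots,k\}$ with $|R|=k-r$, $V_k^{(R)}(X)$ is the square matrix obtained from $V_k(X)$ by deleting the rows indexed by $R$, and $S_k^{(R)}(X):=\det(V_k^{(R)}(X))/\det(V(X))$. When $X$ consists of $r$ distinct indeterminates this is a symmetric polynomial with integer coefficients (a Schur polynomial), and for an arbitrary multiset $S_k^{(R)}(X)$ is the value of that polynomial at the elements of $X$ listed with multiplicity; this defines $S_k^{(R)}(X)$ over any field. ($S_k^{(R)}(X)=1$ for $X=\emptyset$.) $\operatorname{sg}(R)$ for $R=(R_1,R_2,R_3)$ is the sign of the permutation of $\{1,\dots,m'+n'-d\}$ obtained by listing the elements of $R_1$ in increasing order, then those of $R_2$ in increasing order, then those of $R_3$ in increasing order. When $d\ge m'+n'$ one has $R_1=R_2=R_3=\emptyset$, $\operatorname{sg}(R)=1$, and the three factors $S$ are taken equal to $1$.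
   Formalization: The set R̃_1 is taken as {i-(m+n-2d-1) : i∈R_1} instead of {i-(m+n-2d-2) : i∈R_1}; the printed offset fails, e.g. for A={0,2}, B={0,0}, Ā={2}, B̄=∅, d=1, where F_1=-1 but the printed right-hand side is -2. *)

theory Defs
  imports
    "HOL-Library.Poly_Mapping"
    "HOL-Combinatorics.Permutations"
    "Jordan_Normal_Form.Determinant"
    "Subresultants.Coeff_Int"
begin

(* All sizes, degrees and indices are integers, because many of the index expressions
   (such as m - n' or d - m') can be negative; row and column indices start at 1. *)

definition Rprod :: "'a::comm_ring_1 multiset \<Rightarrow> 'a multiset \<Rightarrow> 'a" where
  "Rprod X Y = (\<Prod>x\<in>#X. \<Prod>y\<in>#Y. (x - y))"

definition subres_matrix ::
    "int \<Rightarrow> 'a::comm_ring_1 poly \<Rightarrow> 'a poly \<Rightarrow> (int \<Rightarrow> 'a poly) \<Rightarrow> 'a poly mat" where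
  "subres_matrix d f g last_col =
    (let m = int (degree f); n = int (degree g); N = m + n - 2 * d
     in mat (nat N) (nat N) (\<lambda>(i0, j0).
          let i = int i0 + 1; j = int j0 + 1
          in if j = N then last_col i
             else if i \<le> n - d then [: coeff_int f (m + i - j) :]
             else [: coeff_int g (n + (i - (n - d)) - j) :]))"

definition subres_F :: "int \<Rightarrow> 'a::comm_ring_1 poly \<Rightarrow> 'a poly \<Rightarrow> 'a poly" where
  "subres_F d f g =
    (let n = int (degree g)
     in det (subres_matrix d f g
          (\<lambda>i. if i \<le> n - d then monom 1 (nat (n - d - i)) else 0)))"

definition subres_G :: "int \<Rightarrow> 'a::comm_ring_1 poly \<Rightarrow> 'a poly \<Rightarrow> 'a poly" where
  "subres_G d f g =
    (let m = int (degree f); n = int (degree g)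
     in det (subres_matrix d f g
          (\<lambda>i. if i \<le> n - d then 0 else monom 1 (nat (m - d - (i - (n - d)))))))"

(* Integer polynomials in the indeterminates X_0, X_1, ...: a monomial is its finitely
   supported exponent function. *)
type_synonym int_mpoly = "(nat \<Rightarrow>\<^sub>0 nat) \<Rightarrow>\<^sub>0 int"

definition indet :: "nat \<Rightarrow> int_mpoly" where
  "indet j = Poly_Mapping.single (Poly_Mapping.single j 1) 1"

definition mpoly_value :: "(nat \<Rightarrow> 'b::comm_ring_1) \<Rightarrow> int_mpoly \<Rightarrow> 'b" where
  "mpoly_value x P =
    (\<Sum>e\<in>Poly_Mapping.keys P. of_int (Poly_Mapping.lookup P e) *
       (\<Prod>j\<in>Poly_Mapping.keys e. x j ^ Poly_Mapping.lookup e j))"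

(* V_k^(R)(X) for X = {X_0, ..., X_(r-1)}: row number l of V_k consists of the powers
   X_j ^ (k - l), and the rows in R are deleted. *)
definition vandermonde_minor :: "int \<Rightarrow> int set \<Rightarrow> nat \<Rightarrow> int_mpoly mat" where
  "vandermonde_minor k R r =
    mat r r (\<lambda>(i, j). indet j ^ nat (k - sorted_list_of_set ({1..k} - R) ! i))"

(* The quotient det V_k^(R) / det V, with V = V_r, as an integer polynomial. *)
definition schur_poly :: "int \<Rightarrow> int set \<Rightarrow> nat \<Rightarrow> int_mpoly" where
  "schur_poly k R r =
    (THE P. P * det (vandermonde_minor (int r) {} r) = det (vandermonde_minor k R r))"

(* S_k^(R)(X) for an arbitrary multiset X, used only for |R| = k - |X| (or X empty).
   The choice of the enumeration of X is immaterial since schur_poly is symmetric in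
   X_0, ..., X_(r-1). *)
definition schur :: "int \<Rightarrow> int set \<Rightarrow> 'b::comm_ring_1 multiset \<Rightarrow> 'b" where
  "schur k R X = mpoly_value (nth (SOME xs. mset xs = X)) (schur_poly k R (size X))"

definition index_triples :: "int \<Rightarrow> int \<Rightarrow> int \<Rightarrow> int \<Rightarrow> int \<Rightarrow> (int set \<times> int set \<times> int set) set" where
  "index_triples m n mbar nbar d =
    (let m' = m - mbar; n' = n - nbar
     in {(R1, R2, R3).
          R1 \<union> R2 \<union> R3 = {1..m' + n' - d} \<and>
          R1 \<inter> R2 = {} \<and> R1 \<inter> R3 = {} \<and> R2 \<inter> R3 = {} \<and>
          R1 \<subseteq> {m + n - 2 * d..m' + n' - d} \<and>
          int (card R1) \<le> max 0 (d + 2 - (mbar + nbar))})"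

definition triples_F :: "int \<Rightarrow> int \<Rightarrow> int \<Rightarrow> int \<Rightarrow> int \<Rightarrow> (int set \<times> int set \<times> int set) set" where
  "triples_F m n mbar nbar d =
    (let m' = m - mbar; n' = n - nbar
     in {(R1, R2, R3) \<in> index_triples m n mbar nbar d.
          n' - d - 1 \<le> int (card R2) \<and> int (card R2) \<le> n - d - 1 \<and>
          m' - d \<le> int (card R3) \<and> int (card R3) \<le> m - d})"

definition triples_G :: "int \<Rightarrow> int \<Rightarrow> int \<Rightarrow> int \<Rightarrow> int \<Rightarrow> (int set \<times> int set \<times> int set) set" where
  "triples_G m n mbar nbar d =
    (let m' = m - mbar; n' = n - nbar
     in {(R1, R2, R3) \<in> index_triples m n mbar nbar d.
          m' - d - 1 \<le> int (card R2) \<and> int (card R2) \<le> m - d - 1 \<and>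
          n' - d \<le> int (card R3) \<and> int (card R3) \<le> n - d})"

definition sg :: "int set \<Rightarrow> int set \<Rightarrow> int set \<Rightarrow> int" where
  "sg R1 R2 R3 =
    (let L = sorted_list_of_set R1 @ sorted_list_of_set R2 @ sorted_list_of_set R3
     in sign (permutation_of_list (zip [1..int (length L)] L)))"

definition sign_F ::
    "int \<Rightarrow> int \<Rightarrow> int \<Rightarrow> int \<Rightarrow> int \<Rightarrow> int set \<Rightarrow> int set \<Rightarrow> int set \<Rightarrow> 'a::field" where
  "sign_F m n mbar nbar d R1 R2 R3 =
    (let m' = m - mbar; n' = n - nbar;
         r1 = int (card R1); r2 = int (card R2); r3 = int (card R3)
     in (-1) powi (r1 * (m - d + r2 + r3) + r2 * nbar + r3 * (m' + n' - d - 1) + r2 * r3)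
        * of_int (sg R1 R2 R3))"

definition sign_G ::
    "int \<Rightarrow> int \<Rightarrow> int \<Rightarrow> int \<Rightarrow> int \<Rightarrow> int set \<Rightarrow> int set \<Rightarrow> int set \<Rightarrow> 'a::field" where
  "sign_G m n mbar nbar d R1 R2 R3 =
    (let m' = m - mbar; n' = n - nbar;
         r1 = int (card R1); r2 = int (card R2); r3 = int (card R3)
     in (-1) powi (r1 * (n - d + r2 + r3) + r2 * mbar + r3 * (m' + n' - d - 1) + r2 * r3)
        * of_int (sg R1 R2 R3))"

(* The published formula subtracts m + n - 2 * d - 2 here, which is off by one:
   since R1 lies in {m + n - 2 * d..m' + n' - d}, subtracting m + n - 2 * d - 1 makes the shifted
   set start at row 1 (and lie in {1..d + 1}, as S_(d+1) requires), whereas with the published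
   offset the identities fail, e.g. for A = {0, 2}, B = {0, 0}, Abar = {2}, Bbar = {}, d = 1,
   where F_1 = -1 but the right-hand side is -2. *)
definition shifted :: "int \<Rightarrow> int \<Rightarrow> int \<Rightarrow> int set \<Rightarrow> int set" where
  "shifted m n d R1 = (\<lambda>i. i - (m + n - 2 * d - 1)) ` R1"

(* Embedding of multisets of scalars into K[x]. *)
abbreviation const_mset :: "'a::comm_ring_1 multiset \<Rightarrow> 'a poly multiset" where
  "const_mset X \<equiv> image_mset (\<lambda>a. [:a:]) X"

abbreviation polyX :: "'a::comm_ring_1 poly" where
  "polyX \<equiv> [:0, 1:]"

end

theory Submission
  imports Defs
begin

text \<open>Put \<open>N = m + n - d\<close> and let \<open>v\<^sub>a\<close> be the vector of powers of \<open>a\<close>. The formula compares two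
evaluations of one determinant. Its matrix has three blocks of rows, of sizes \<open>N\<close>, \<open>d + 1\<close>
and \<open>M \<ge> N\<close> (called blocks 2, 1 and 3). The columns \<open>v\<^sub>a\<close> for the roots of \<open>f\<close> and \<open>v\<^sub>x\<close> for the
indeterminate are put into block 2, the columns \<open>v\<^sub>b\<close> for the roots of \<open>g\<close> into block 3.
The remaining columns are repeated in all three blocks (truncated to their sizes); they
come from the nodes in \<open>Abar\<close> and \<open>Bbar\<close>, completed by \<open>k\<close> unit vectors for the highest
powers to a square matrix \<open>W\<close>.

On the one hand, the repeated columns are the image of \<open>W\<close> under the diagonal embedding, so
\<open>det W\<close>, a Vandermonde determinant, splits off. The rest is, by row operations with \<open>f\<close> and
\<open>g\<close>, the product of \<open>f(x)\<close>, the Vandermonde determinants of \<open>A\<close> and \<open>B\<close>, and \<open>F\<^sub>d\<close>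
(lemmas \<open>eval_cofactor_det\<close>, \<open>block_det_factor\<close> and \<open>two_block_eval\<close>).

On the other hand, the determinant is multilinear: every repeated column can be assigned to one of
the blocks. A node in \<open>Abar\<close> already has a column in block 2, so it goes to block 1 (these
nodes form \<open>A'\<close>) or to block 3; a node in \<open>Bbar\<close> goes to block 1 (forming \<open>B'\<close>) or to block 2; and
the unit vectors are distributed by a triple \<open>(R1, R2, R3)\<close>. A unit vector deletes a row, so each
resulting term is a product of three Vandermonde minors, that is, of three Schur
polynomials and three Vandermonde determinants (lemmas \<open>block_det_expand\<close> and
\<open>raw_term_eval\<close>). Cancelling the common factor and dividing by the Vandermonde determinants of
\<open>Abar\<close> and \<open>Bbar\<close> gives the formula. If \<open>d > m' + n'\<close>, then \<open>W\<close> has more than \<open>N\<close>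
columns without any unit vectors; the third block then has \<open>M > N\<close> rows, and the only
triple is the empty one.

The common factor vanishes if, for instance, two roots of \<open>f\<close> coincide. But before the last
division both sides are polynomials in the roots. Hence the roots are first replaced by
\<open>a + t\<^sup>i\<close> with different exponents, where cancellation is possible, and then \<open>t = 0\<close>
(lemma \<open>double_sum_eq\<close>). The same perturbation shows that the values of Schur polynomials
depend on the multiset of arguments only. The formula for \<open>G\<^sub>d\<close> is the one for \<open>F\<^sub>d\<close> with \<open>f\<close> and \<open>g\<close>
exchanged (lemma \<open>subres_G_eq_swapped_F\<close>).\<close>

section \<open>Determinants of lists of columns\<close>

text \<open>Columns are functions of the row index. Thus restricting, shifting or combining rows is
composition of functions, without any bookkeeping of dimensions.\<close>

definition cdet :: "(nat \<Rightarrow> 'a::comm_ring_1) list \<Rightarrow> 'a" where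
  "cdet vs = det (mat (length vs) (length vs) (\<lambda>(i, j). (vs ! j) i))"

lemma cdet_leibniz:
  "cdet vs = (\<Sum>p | p permutes {0..<length vs}. of_int (sign p) * (\<Prod>j<length vs. (vs ! j) (p j)))"
proof -
  have "cdet vs = (\<Sum>p | p permutes {0..<length vs}. of_int (sign p) *
      (\<Prod>j<length vs. mat (length vs) (length vs) (\<lambda>(i, j). (vs ! j) i) $$ (p j, j)))"
    unfolding cdet_def by (rule det_col) simp
  also have "\<dots> = (\<Sum>p | p permutes {0..<length vs}. of_int (sign p) *
      (\<Prod>j<length vs. (vs ! j) (p j)))"
    by (intro sum.cong refl arg_cong2[where f="(*)"] prod.cong)
       (auto dest: permutes_in_image)
  finally show ?thesis .
qed

lemma cdet_cong:
  assumes "length us = length vs"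
    and "\<And>i j. i < length vs \<Longrightarrow> j < length vs \<Longrightarrow> (us ! j) i = (vs ! j) i"
  shows "cdet us = cdet vs"
  unfolding cdet_def assms(1) by (intro arg_cong[where f=det] cong_mat) (auto simp: assms(2))

lemma cdet_Nil [simp]: "cdet [] = 1"
  by (simp add: cdet_def)

lemma prod_nth_middle:
  fixes g :: "'b \<Rightarrow> nat \<Rightarrow> 'c::comm_monoid_mult"
  shows "(\<Prod>j<length (us @ u # vs). g ((us @ u # vs) ! j) j) =
    g u (length us) * (\<Prod>j\<in>{..<length (us @ u # vs)} - {length us}. g ((us @ x # vs) ! j) j)"
proof -
  have "(\<Prod>j<length (us @ u # vs). g ((us @ u # vs) ! j) j) =
    g u (length us) * (\<Prod>j\<in>{..<length (us @ u # vs)} - {length us}. g ((us @ u # vs) ! j) j)"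
    by (subst prod.remove[of _ "length us"]) auto
  also have "(\<Prod>j\<in>{..<length (us @ u # vs)} - {length us}. g ((us @ u # vs) ! j) j) =
      (\<Prod>j\<in>{..<length (us @ u # vs)} - {length us}. g ((us @ x # vs) ! j) j)"
    by (intro prod.cong refl) (auto simp: nth_append nth_Cons split: nat.splits)
  finally show ?thesis .
qed

lemma cdet_add:
  "cdet (us @ (\<lambda>i. u i + w i) # vs) = cdet (us @ u # vs) + cdet (us @ w # vs)"
  unfolding cdet_leibniz prod_nth_middle[where x=u and g="\<lambda>f j. f (_ j)"]
  by (simp add: algebra_simps sum.distrib)

lemma cdet_scale:
  "cdet (us @ (\<lambda>i. c * u i) # vs) = c * cdet (us @ u # vs)"
  unfolding cdet_leibniz prod_nth_middle[where x=u and g="\<lambda>f j. f (_ j)"]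
  by (simp add: algebra_simps sum_distrib_left)

lemma cdet_zero_column: "cdet (us @ (\<lambda>i. 0) # vs) = 0"
  using cdet_scale[of us 0 "\<lambda>i. 0" vs] by simp

lemma cdet_sum:
  "cdet (us @ (\<lambda>i. \<Sum>x\<in>X. c x * t x i) # vs) = (\<Sum>x\<in>X. c x * cdet (us @ t x # vs))"
proof (induction X rule: infinite_finite_induct)
  case (insert x F)
  have eq: "(\<lambda>i. \<Sum>x\<in>insert x F. c x * t x i) = (\<lambda>i. c x * t x i + (\<Sum>x\<in>F. c x * t x i))"
    using insert.hyps by auto
  show ?case
    unfolding eq cdet_add cdet_scale insert.IH using insert.hyps by simp
qed (auto simp: cdet_zero_column)

lemma cdet_repeat:
  assumes "j < length vs" "k < length vs" "j \<noteq> k" "vs ! j = vs ! k"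
  shows "cdet vs = 0"
  unfolding cdet_def
  by (rule det_identical_columns[OF _ assms(3,1,2)]) (use assms in \<open>auto intro!: eq_vecI\<close>)

lemma cdet_swap_adjacent: "cdet (us @ x # y # vs) = - cdet (us @ y # x # vs)"
proof -
  define s where "s = (\<lambda>i. x i + y i)"
  have rep: "cdet (us @ z # z # vs) = 0" for z :: "nat \<Rightarrow> 'a"
    by (rule cdet_repeat[of "length us" _ "Suc (length us)"]) (auto simp: nth_append)
  have "0 = cdet (us @ s # s # vs)" by (simp add: rep)
  also have "\<dots> = cdet (us @ x # s # vs) + cdet (us @ y # s # vs)"
    by (simp add: s_def cdet_add)
  also have "cdet (us @ x # s # vs) = cdet (us @ x # y # vs)"
    using cdet_add[of "us @ [x]" x y vs] by (simp add: s_def rep)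
  also have "cdet (us @ y # s # vs) = cdet (us @ y # x # vs)"
    using cdet_add[of "us @ [y]" x y vs] by (simp add: s_def rep)
  finally show ?thesis by (simp add: eq_neg_iff_add_eq_0)
qed

lemma cdet_move: "cdet (us @ x # ys @ vs) = (-1) ^ length ys * cdet (us @ ys @ x # vs)"
proof (induction ys arbitrary: us)
  case (Cons y ys)
  have "cdet (us @ x # (y # ys) @ vs) = - cdet ((us @ [y]) @ x # ys @ vs)"
    using cdet_swap_adjacent[of us x y "ys @ vs"] by simp
  also have "\<dots> = - ((-1) ^ length ys * cdet ((us @ [y]) @ ys @ x # vs))"
    by (simp only: Cons.IH)
  finally show ?case by simp
qed simp

lemma cdet_exchange:
  "cdet (us @ xs @ ys @ vs) = (-1) ^ (length xs * length ys) * cdet (us @ ys @ xs @ vs)"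
proof (induction xs arbitrary: us)
  case (Cons x xs)
  have "cdet (us @ (x # xs) @ ys @ vs) = cdet ((us @ [x]) @ xs @ ys @ vs)" by simp
  also have "\<dots> = (-1) ^ (length xs * length ys) * cdet (us @ x # ys @ xs @ vs)"
    by (simp only: Cons.IH) simp
  also have "cdet (us @ x # ys @ xs @ vs) = (-1) ^ length ys * cdet (us @ ys @ x # xs @ vs)"
    by (rule cdet_move)
  finally show ?case by (simp add: power_add mult_ac)
qed simp

lemma cdet_swap: "cdet (us @ x # ws @ y # vs) = - cdet (us @ y # ws @ x # vs)"
proof -
  have "cdet (us @ x # ws @ y # vs) = (-1) ^ length ws * cdet ((us @ ws) @ x # y # vs)"
    using cdet_move[of us x ws "y # vs"] by simp
  also have "cdet ((us @ ws) @ x # y # vs) = - cdet ((us @ ws) @ y # x # vs)"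
    by (rule cdet_swap_adjacent)
  also have "cdet ((us @ ws) @ y # x # vs) = (-1) ^ length ws * cdet (us @ y # ws @ x # vs)"
    using cdet_move[of us y ws "x # vs"]
    by (simp flip: power_add power_mult_distrib mult.assoc)
  finally show ?thesis by (simp flip: power_add power_mult_distrib mult.assoc)
qed

lemma cdet_map_transpose:
  assumes "distinct xs" "a \<in> set xs" "b \<in> set xs" "a \<noteq> b"
  shows "cdet (us @ map (h \<circ> transpose a b) xs @ vs) = - cdet (us @ map h xs @ vs)"
proof -
  have *: "cdet (us @ map (h \<circ> transpose a b) xs @ vs) = - cdet (us @ map h xs @ vs)"
    if xs: "xs = ps @ a # qs @ b # rs" and d: "distinct xs" for a b ps qs rs
  proof -
    have id: "map (h \<circ> transpose a b) l = map h l" if "set l \<subseteq> set ps \<union> set qs \<union> set rs" for l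
      using that d unfolding xs by (auto simp: transpose_def)
    have sub: "set ps \<subseteq> set ps \<union> set qs \<union> set rs" "set qs \<subseteq> set ps \<union> set qs \<union> set rs"
      "set rs \<subseteq> set ps \<union> set qs \<union> set rs" by blast+
    have "us @ map (h \<circ> transpose a b) xs @ vs =
        (us @ map h ps) @ h b # map h qs @ h a # (map h rs @ vs)"
      unfolding xs using id[of ps, OF sub(1)] id[of qs, OF sub(2)] id[of rs, OF sub(3)] by simp
    also have "cdet \<dots> = - cdet ((us @ map h ps) @ h a # map h qs @ h b # (map h rs @ vs))"
      by (rule cdet_swap)
    finally show ?thesis by (simp add: xs)
  qed
  obtain ps ts where 1: "xs = ps @ a # ts" using assms(2) by (meson split_list)
  show ?thesis
  proof (cases "b \<in> set ts")
    case True
    then obtain qs rs where "ts = qs @ b # rs" by (meson split_list)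
    with 1 assms(1) show ?thesis by (intro *) auto
  next
    case False
    with assms 1 have "b \<in> set ps" by auto
    then obtain qs rs where "ps = qs @ b # rs" by (meson split_list)
    with 1 assms(1) show ?thesis
      by (subst transpose_commute, intro *[of qs b rs a ts]) auto
  qed
qed

lemma cdet_map_permutes:
  assumes "distinct xs" "p permutes set xs"
  shows "cdet (us @ map (h \<circ> p) xs @ vs) = of_int (sign p) * cdet (us @ map h xs @ vs)"
  using assms(2) finite_set[of xs]
proof (induction arbitrary: h rule: permutes_induct)
  case id
  show ?case by (simp add: sign_id)
next
  case (swap a b p)
  have perm: "permutation p" using swap.hyps finite_set[of xs] permutation_permutes by blast
  show ?case
  proof (cases "a = b")
    case True then show ?thesis using swap.IH by simp
  next
    case False
    have "cdet (us @ map (h \<circ> (transpose a b \<circ> p)) xs @ vs) =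
      of_int (sign p) * cdet (us @ map (h \<circ> transpose a b) xs @ vs)"
      using swap.IH[of "h \<circ> transpose a b"] by (simp add: o_def)
    also have "\<dots> = of_int (sign (transpose a b \<circ> p)) * cdet (us @ map h xs @ vs)"
      using False swap.hyps perm
      by (simp add: cdet_map_transpose[OF assms(1)] sign_compose permutation_swap_id sign_swap_id)
    finally show ?thesis .
  qed
qed

text \<open>The list of \<open>R1\<close>, \<open>R2\<close>, \<open>R3\<close> is the image of
\<open>[1..k]\<close> under the permutation whose sign is \<open>sg R1 R2 R3\<close>.\<close>

lemma cdet_sg:
  assumes "R1 \<union> R2 \<union> R3 = {1..k}" "R1 \<inter> R2 = {}" "R1 \<inter> R3 = {}" "R2 \<inter> R3 = {}"
  shows "cdet (us @ map h (sorted_list_of_set R1 @ sorted_list_of_set R2 @ sorted_list_of_set R3) @ vs)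
    = of_int (sg R1 R2 R3) * cdet (us @ map h [1..k] @ vs)"
proof -
  define L where "L = sorted_list_of_set R1 @ sorted_list_of_set R2 @ sorted_list_of_set R3"
  have "finite (R1 \<union> R2 \<union> R3)" unfolding assms(1) by simp
  then have fin: "finite R1" "finite R2" "finite R3" by auto
  have setL: "set L = {1..k}" and dL: "distinct L"
    using fin assms by (auto simp: L_def)
  have len: "length L = nat k"
    using distinct_card[OF dL] setL by simp
  then have up: "[1..int (length L)] = [1..k]" by (cases "k \<ge> 0") auto
  define p where "p = permutation_of_list (zip [1..k] L)"
  have len': "length [1..k] = length L" by (simp add: len)
  have m12: "map fst (zip [1..k] L) = [1..k]" "map snd (zip [1..k] L) = L"
    using len' by simp_all
  have p: "p permutes set [1..k]"
    unfolding p_def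
    by (rule permutation_of_list_permutes) (simp only: list_permutes_def m12 setL dL, simp)
  have "map p [1..k] = L"
  proof (rule nth_equalityI)
    fix i assume i: "i < length (map p [1..k])"
    have "p ([1..k] ! i) = L ! i"
      unfolding p_def
    proof (rule permutation_of_list_unique')
      have "zip [1..k] L ! i \<in> set (zip [1..k] L)" using i len' by (intro nth_mem) simp
      then show "([1..k] ! i, L ! i) \<in> set (zip [1..k] L)"
        using i len' by simp
    qed (simp add: m12 len)
    then show "map p [1..k] ! i = L ! i" using i by simp
  qed (simp add: len)
  then have "map h L = map (h \<circ> p) [1..k]" by (metis map_map)
  then show ?thesis
    using cdet_map_permutes[OF _ p, of us h vs]
    unfolding sg_def L_def[symmetric] Let_def up p_def[symmetric] by simp
qed

lemma sg_square: "of_int (sg R1 R2 R3) * of_int (sg R1 R2 R3) = (1 :: 'a::ring_1)"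
proof -
  have "sg R1 R2 R3 * sg R1 R2 R3 = 1" by (simp add: sg_def Let_def sign_def)
  then show ?thesis by (metis of_int_1 of_int_mult)
qed

lemma cdet_sort:
  assumes "R1 \<union> R2 \<union> R3 = {1..k}" "R1 \<inter> R2 = {}" "R1 \<inter> R3 = {}" "R2 \<inter> R3 = {}"
  shows "cdet (us @ map h [1..k] @ vs) = of_int (sg R1 R2 R3) *
    cdet (us @ map h (sorted_list_of_set R1 @ sorted_list_of_set R2 @ sorted_list_of_set R3) @ vs)"
  unfolding cdet_sg[OF assms] by (simp add: sg_square flip: mult.assoc)

section \<open>Blocks and unit columns\<close>

lemma cdet_block_first:
  fixes us vs :: "(nat \<Rightarrow> 'a::idom) list"
  assumes "\<And>u i. u \<in> set us \<Longrightarrow> length us \<le> i \<Longrightarrow> i < length us + length vs \<Longrightarrow> u i = 0"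
  shows "cdet (us @ vs) = cdet us * cdet (map (\<lambda>v i. v (i + length us)) vs)"
proof -
  let ?a = "length us" and ?b = "length vs"
  have "mat (?a + ?b) (?a + ?b) (\<lambda>(i, j). ((us @ vs) ! j) i) =
    four_block_mat (mat ?a ?a (\<lambda>(i, j). (us ! j) i)) (mat ?a ?b (\<lambda>(i, j). (vs ! j) i))
      (0\<^sub>m ?b ?a) (mat ?b ?b (\<lambda>(i, j). (vs ! j) (i + ?a)))"
    by (rule eq_matI) (auto simp: nth_append assms)
  then show ?thesis
    unfolding cdet_def
    by (simp, subst det_four_block_mat_lower_left_zero[where n = ?a and m = ?b])
       (auto intro!: arg_cong[where f=det] cong_mat)
qed

lemma cdet_block_last:
  fixes us vs :: "(nat \<Rightarrow> 'a::idom) list"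
  assumes "\<And>v i. v \<in> set vs \<Longrightarrow> i < length us \<Longrightarrow> v i = 0"
  shows "cdet (us @ vs) = cdet us * cdet (map (\<lambda>v i. v (i + length us)) vs)"
proof -
  let ?a = "length us" and ?b = "length vs"
  have "mat (?a + ?b) (?a + ?b) (\<lambda>(i, j). ((us @ vs) ! j) i) =
    four_block_mat (mat ?a ?a (\<lambda>(i, j). (us ! j) i)) (0\<^sub>m ?a ?b)
      (mat ?b ?a (\<lambda>(i, j). (us ! j) (i + ?a))) (mat ?b ?b (\<lambda>(i, j). (vs ! j) (i + ?a)))"
    by (rule eq_matI) (auto simp: nth_append assms)
  then show ?thesis
    unfolding cdet_def
    by (simp, subst det_four_block_mat_upper_right_zero[where n = ?a and m = ?b])
       (auto intro!: arg_cong[where f=det] cong_mat)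
qed

text \<open>By the pigeonhole principle every permutation sends one of the columns \<open>us\<close> to a row
outside \<open>I\<close>, so every Leibniz term vanishes.\<close>

lemma cdet_too_many_columns:
  assumes "finite I" "card I < length us"
    and "\<And>u i. u \<in> set us \<Longrightarrow> i < length (ws @ us @ vs) \<Longrightarrow> i \<notin> I \<Longrightarrow> u i = 0"
  shows "cdet (ws @ us @ vs) = 0"
  unfolding cdet_leibniz
proof (intro sum.neutral ballI)
  let ?n = "length (ws @ us @ vs)" and ?J = "{length ws..<length ws + length us}"
  fix p assume "p \<in> {p. p permutes {0..<?n}}"
  then have p: "p permutes {0..<?n}" by simp
  have "\<not> p ` ?J \<subseteq> I"
  proof
    assume "p ` ?J \<subseteq> I"
    then have "card (p ` ?J) \<le> card I" by (rule card_mono[OF assms(1)])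
    also have "card (p ` ?J) = length us"
      using permutes_inj_on[OF p] by (simp add: card_image)
    finally show False using assms(2) by simp
  qed
  then obtain j where j: "j \<in> ?J" "p j \<notin> I" by blast
  have "(ws @ us @ vs) ! j \<in> set us"
    using j by (auto simp: nth_append)
  moreover have "p j < ?n" using permutes_in_image[OF p, of j] j by auto
  ultimately have "((ws @ us @ vs) ! j) (p j) = 0" using j assms(3) by blast
  moreover have "j < ?n" using j by simp
  ultimately have "(\<Prod>j<?n. ((ws @ us @ vs) ! j) (p j)) = 0"
    by (intro prod_zero) auto
  then show "of_int (sign p) * (\<Prod>j<?n. ((ws @ us @ vs) ! j) (p j)) = 0" by simp
qed

lemma cdet_row_operation:
  "cdet (map (\<lambda>v i. \<Sum>k<length vs. Q i k * v k) vs) =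
    det (mat (length vs) (length vs) (\<lambda>(i, k). Q i k)) * cdet vs"
proof -
  let ?n = "length vs"
  have "mat ?n ?n (\<lambda>(i, j). (map (\<lambda>v i. \<Sum>k<?n. Q i k * v k) vs ! j) i) =
    mat ?n ?n (\<lambda>(i, k). Q i k) * mat ?n ?n (\<lambda>(i, j). (vs ! j) i)"
    by (rule eq_matI) (auto simp: scalar_prod_def lessThan_atLeast0)
  then show ?thesis
    unfolding cdet_def by (simp add: det_mult[of _ ?n])
qed

lemma cdet_mult:
  assumes "length ts = length ws"
  shows "cdet (map (\<lambda>w i. \<Sum>q<length ws. w q * (ts ! q) i) ws) = cdet ts * cdet ws"
proof -
  let ?n = "length ws"
  have "mat ?n ?n (\<lambda>(i, j). (map (\<lambda>w i. \<Sum>q<?n. w q * (ts ! q) i) ws ! j) i) =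
    mat ?n ?n (\<lambda>(i, j). (ts ! j) i) * mat ?n ?n (\<lambda>(i, j). (ws ! j) i)"
    by (rule eq_matI) (auto simp: scalar_prod_def lessThan_atLeast0 mult.commute)
  then show ?thesis
    unfolding cdet_def assms by (simp add: det_mult[of _ ?n])
qed

definition unit_col :: "nat \<Rightarrow> nat \<Rightarrow> 'a::comm_ring_1" where
  "unit_col p = (\<lambda>i. if i = p then 1 else 0)"

lemma cdet_unit_cols [simp]: "cdet (map unit_col [0..<n]) = 1"
proof -
  have "mat n n (\<lambda>(i, j). (map unit_col [0..<n] ! j) i) = (1\<^sub>m n :: 'a mat)"
    by (rule eq_matI) (auto simp: unit_col_def)
  then show ?thesis by (simp add: cdet_def)
qed

text \<open>The matrix is the product of the one with columns \<open>us\<close>, \<open>T\<close> and the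
block diagonal matrix of an identity matrix and \<open>ws\<close>.\<close>

lemma cdet_factor_block:
  fixes us ws :: "(nat \<Rightarrow> 'a::idom) list"
  assumes "length ws = M"
  shows "cdet (us @ map (\<lambda>w i. \<Sum>q<M. w q * T q i) ws) = cdet (us @ map T [0..<M]) * cdet ws"
proof -
  let ?a = "length us"
  define ws' where "ws' = map unit_col [0..<?a] @ map (\<lambda>w q. if q < ?a then 0 else w (q - ?a)) ws"
  let ?ts = "us @ map T [0..<M]"
  have len: "length ws' = ?a + M" using assms by (simp add: ws'_def)
  have "cdet ws' = cdet (map unit_col [0..<?a] :: (nat \<Rightarrow> 'a) list) *
      cdet (map (\<lambda>v i. v (i + ?a)) (map (\<lambda>w q. if q < ?a then 0 else w (q - ?a)) ws))"
    unfolding ws'_def by (subst cdet_block_first) (auto simp: unit_col_def)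
  also have "\<dots> = cdet ws"
    by (simp add: o_def)
  finally have 1: "cdet ws' = cdet ws" .
  have "cdet (us @ map (\<lambda>w i. \<Sum>q<M. w q * T q i) ws) =
      cdet (map (\<lambda>w i. \<Sum>q<length ws'. w q * (?ts ! q) i) ws')"
  proof (rule cdet_cong)
    fix i j assume j: "j < length (map (\<lambda>w i. \<Sum>q<length ws'. w q * (?ts ! q) i) ws')"
    have split: "(\<Sum>q<?a + M. g q) = (\<Sum>q<?a. g q) + (\<Sum>q<M. g (?a + q))" for g :: "nat \<Rightarrow> 'a"
      by (induction M) (simp_all add: add.assoc)
    show "((us @ map (\<lambda>w i. \<Sum>q<M. w q * T q i) ws) ! j) i =
      (map (\<lambda>w i. \<Sum>q<length ws'. w q * (?ts ! q) i) ws' ! j) i"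
    proof (cases "j < ?a")
      case True
      have "(\<Sum>q<?a. unit_col j q * ((us @ map T [0..<M]) ! q) i) = (us ! j) i"
        using True by (subst sum.remove[of _ j]) (auto simp: unit_col_def nth_append intro!: sum.neutral)
      moreover have "(\<Sum>q<M. unit_col j (?a + q) * ((us @ map T [0..<M]) ! (?a + q)) i) = 0"
        using True by (intro sum.neutral) (auto simp: unit_col_def)
      ultimately show ?thesis using True assms
        by (simp add: nth_append split len) (simp add: ws'_def nth_append)
    next
      case False
      have "j < ?a + M" using j len by simp
      then show ?thesis using False assms
        by (simp add: nth_append split len) (simp add: ws'_def nth_append)
    qed
  qed (simp add: len assms)
  also have "\<dots> = cdet ?ts * cdet ws'"
    by (rule cdet_mult) (simp add: len)
  finally show ?thesis by (simp add: 1)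
qed

lemma cdet_unit_last:
  assumes "p \<le> length us"
  shows "cdet (us @ [unit_col p]) = (-1) ^ (length us + p) * cdet (map (\<lambda>u i. u (insert_index p i)) us)"
proof -
  let ?n = "length us"
  define A where "A = mat (Suc ?n) (Suc ?n) (\<lambda>(i, j). ((us @ [unit_col p]) ! j) i)"
  have A: "A \<in> carrier_mat (Suc ?n) (Suc ?n)" by (simp add: A_def)
  have "cdet (us @ [unit_col p]) = det A" by (simp add: cdet_def A_def)
  also have "\<dots> = (\<Sum>i<Suc ?n. A $$ (i, ?n) * cofactor A i ?n)"
    by (rule laplace_expansion_column[OF A]) simp
  also have "\<dots> = A $$ (p, ?n) * cofactor A p ?n"
    using assms by (subst sum.remove[of _ p]) (auto simp: A_def unit_col_def intro!: sum.neutral)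
  also have "A $$ (p, ?n) = 1" using assms by (simp add: A_def unit_col_def)
  also have "mat_delete A p ?n = mat ?n ?n (\<lambda>(i, j). (map (\<lambda>u i. u (insert_index p i)) us ! j) i)"
    unfolding mat_delete_def A_def
    by (rule eq_matI) (auto simp: insert_index_def nth_append)
  then have "cofactor A p ?n = (-1) ^ (?n + p) * cdet (map (\<lambda>u i. u (insert_index p i)) us)"
    by (simp add: cofactor_def cdet_def add.commute)
  finally show ?thesis by simp
qed

lemma decreasing_distinct: "sorted_wrt (>) (xs :: 'b::order list) \<Longrightarrow> distinct xs"
  by (induction xs) auto

text \<open>Expanding along the unit columns, starting with the last one, deletes their rows one by one. As
\<open>ps\<close> decreases, the row of each later step lies below the deleted ones; its index and the size of
the matrix both drop by one in every step, so the parity of the sign exponent can be computed from the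
original \<open>k\<close> and \<open>p\<close>.\<close>

lemma cdet_unit_cols_minor:
  assumes "sorted_wrt (>) ps" "sorted_wrt (<) rws" "set rws \<union> set ps = {..<k}"
    and "set rws \<inter> set ps = {}" "length us + length ps = k"
  shows "cdet (us @ map unit_col ps) =
    (\<Prod>p\<leftarrow>ps. (-1) ^ (Suc k + p)) * cdet (map (\<lambda>u i. u (rws ! i)) us)"
  using assms
proof (induction "length ps" arbitrary: ps us rws k)
  case 0
  note Nil = 0
  have "rws = [0..<k]"
    by (rule strict_sorted_equal) (use Nil in \<open>auto simp: atLeast_upt\<close>)
  then have "cdet us = cdet (map (\<lambda>u i. u (rws ! i)) us)"
    using Nil by (intro cdet_cong) simp_all
  then show ?case using Nil by simp
next
  case (Suc n ps')
  obtain ps p where ps': "ps' = ps @ [p]"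
    using Suc.hyps(2) by (cases ps' rule: rev_exhaust) auto
  note snoc = Suc.prems[unfolded ps']
  let ?us = "map (\<lambda>u i. u (insert_index p i)) us"
  have big: "p < p'" if "p' \<in> set ps" for p'
    using snoc(1) that by (auto simp: sorted_wrt_append)
  have pk: "p < k" using snoc(3) by auto
  have prow: "p \<notin> set rws" using snoc(4) by auto
  have del_mono: "delete_index p x < delete_index p y" if "x < y" "x \<noteq> p" "y \<noteq> p" for x y
    using that by (auto simp: delete_index_def)
  have len1: "length (us @ map unit_col ps) = k - 1"
    using snoc(5) by simp
  have "cdet (us @ map unit_col (ps @ [p])) = cdet ((us @ map unit_col ps) @ [unit_col p])"
    by simp
  also have "\<dots> =
    (-1) ^ (k - 1 + p) * cdet (map (\<lambda>u i. u (insert_index p i)) (us @ map unit_col ps))"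
    by (rule cdet_unit_last[of p "us @ map unit_col ps", unfolded len1]) (use pk in simp)
  also have "map (\<lambda>u i. u (insert_index p i)) (us @ map unit_col ps) =
      ?us @ map unit_col (map (delete_index p) ps)"
    by (auto simp: unit_col_def insert_index_def delete_index_def fun_eq_iff dest!: big)
  also have "cdet \<dots> = (\<Prod>q\<leftarrow>map (delete_index p) ps. (-1) ^ (Suc (k - 1) + q)) *
      cdet (map (\<lambda>u i. u (map (delete_index p) rws ! i)) ?us)"
  proof (rule Suc.hyps(1))
    show "n = length (map (delete_index p) ps)" using Suc.hyps(2) by (simp add: ps')
    show "sorted_wrt (>) (map (delete_index p) ps)"
      unfolding sorted_wrt_map
      by (rule sorted_wrt_mono_rel[of _ "(>)"]) (use snoc(1) big del_mono in \<open>auto simp: sorted_wrt_append\<close>)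
    show "sorted_wrt (<) (map (delete_index p) rws)"
      unfolding sorted_wrt_map
      by (rule sorted_wrt_mono_rel[of _ "(<)"]) (use snoc(2) prow in \<open>auto intro!: del_mono\<close>)
    have "set (map (delete_index p) rws) \<union> set (map (delete_index p) ps) =
        delete_index p ` ({..<k} - {p})"
      using snoc(3) prow big by (auto simp flip: image_Un)
    also have "\<dots> = {..<k - 1}"
    proof
      show "delete_index p ` ({..<k} - {p}) \<subseteq> {..<k - 1}"
        using pk by (auto simp: delete_index_def)
      show "{..<k - 1} \<subseteq> delete_index p ` ({..<k} - {p})"
      proof
        fix x assume "x \<in> {..<k - 1}"
        then show "x \<in> delete_index p ` ({..<k} - {p})"
          by (intro image_eqI[of _ _ "insert_index p x"]) (auto simp: insert_index_def delete_index_def)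
      qed
    qed
    finally show "set (map (delete_index p) rws) \<union> set (map (delete_index p) ps) = {..<k - 1}" .
    show "set (map (delete_index p) rws) \<inter> set (map (delete_index p) ps) = {}"
    proof (rule ccontr)
      assume "\<not> ?thesis"
      then obtain x y where xy: "x \<in> set rws" "y \<in> set ps" "delete_index p x = delete_index p y"
        by auto
      then have "x \<noteq> p" "y \<noteq> p" using prow big by auto
      with xy(3) have "x = y" by (metis insert_delete_index)
      with xy snoc(4) show False by auto
    qed
    show "length ?us + length (map (delete_index p) ps) = k - 1"
      using snoc(5) by simp
  qed
  also have "map (\<lambda>u i. u (map (delete_index p) rws ! i)) ?us =
      map (\<lambda>u i. u (insert_index p (map (delete_index p) rws ! i))) us"
    by simp
  also have "cdet \<dots> = cdet (map (\<lambda>u i. u (rws ! i)) us)"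
  proof (rule cdet_cong)
    fix i j assume "i < length (map (\<lambda>u i. u (rws ! i)) us)"
      and j: "j < length (map (\<lambda>u i. u (rws ! i)) us)"
    have "length rws + length (ps @ [p]) = k"
    proof -
      have "distinct rws" "distinct (ps @ [p])"
        using snoc(1,2) strict_sorted_iff decreasing_distinct by blast+
      then show ?thesis
        using snoc(3,4) card_Un_disjoint[of "set rws" "set (ps @ [p])"]
        by (simp only: distinct_card finite_set card_lessThan)
    qed
    with snoc(5) have "length rws = length us" by simp
    then have i: "i < length rws" using \<open>i < length _\<close> by simp
    then have "rws ! i \<noteq> p" using prow nth_mem by blast
    then show "(map (\<lambda>u i. u (insert_index p (map (delete_index p) rws ! i))) us ! j) i =
      (map (\<lambda>u i. u (rws ! i)) us ! j) i"
      using i j by (simp add: insert_delete_index)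
  qed simp
  also have "(\<Prod>q\<leftarrow>map (delete_index p) ps. (-1) ^ (Suc (k - 1) + q)) = (\<Prod>q\<leftarrow>ps. (-1::'a) ^ (Suc k + q))"
    unfolding map_map o_def
  proof (intro arg_cong[where f=prod_list] map_cong refl)
    fix q assume "q \<in> set ps"
    then have "p < q" by (rule big)
    then have "Suc k + q = Suc (k - 1) + delete_index p q + 2"
      using pk by (simp add: delete_index_def)
    then show "(-1::'a) ^ (Suc (k - 1) + delete_index p q) = (-1) ^ (Suc k + q)"
      by (simp add: power_add)
  qed
  also have "(-1::'a) ^ (k - 1 + p) = (-1) ^ (Suc k + p)"
    using pk by (cases k) auto
  finally show ?case by (simp add: ps' mult_ac)
qed

section \<open>Vandermonde determinants\<close>

definition pw :: "'a::comm_ring_1 \<Rightarrow> nat \<Rightarrow> 'a" where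
  "pw a = (\<lambda>i. a ^ i)"

text \<open>The product of \<open>x\<^sub>j - x\<^sub>i\<close> over all positions
\<open>i < j\<close>.\<close>

fun vand :: "'a::comm_ring_1 list \<Rightarrow> 'a" where
  "vand [] = 1"
| "vand (x # xs) = vand xs * (\<Prod>y\<leftarrow>xs. y - x)"

text \<open>The new row \<open>i\<close> is the combination of rows given by the coefficients of
\<open>T\<^sup>i\<^sup>-\<^sup>m f\<close>; as \<open>f\<close> is monic, this is a unitriangular row
operation. On the column of powers of \<open>u\<close> the new entry is
\<open>u\<^sup>i\<^sup>-\<^sup>m f(u)\<close>, which vanishes at the roots of \<open>f\<close>.\<close>

lemma cdet_multiply_rows_by_monic:
  assumes f: "lead_coeff f = 1" "degree f = m" and n: "N \<le> length vs"
  shows "cdet (map (\<lambda>v i. if m \<le> i \<and> i < N then \<Sum>j\<le>m. coeff f j * v (i - m + j) else v i) vs)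
    = cdet vs"
proof -
  let ?n = "length vs"
  define Q where "Q = (\<lambda>i k. if m \<le> i \<and> i < N then (if i - m \<le> k then coeff f (k - (i - m)) else 0)
    else if i = k then 1 else 0)"
  have "cdet (map (\<lambda>v i. if m \<le> i \<and> i < N then \<Sum>j\<le>m. coeff f j * v (i - m + j) else v i) vs) =
    cdet (map (\<lambda>v i. \<Sum>k<?n. Q i k * v k) vs)"
  proof (rule cdet_cong)
    fix i j assume "i < length (map (\<lambda>v i. \<Sum>k<?n. Q i k * v k) vs)"
      and "j < length (map (\<lambda>v i. \<Sum>k<?n. Q i k * v k) vs)"
    then have i: "i < ?n" and j: "j < ?n" by simp_all
    have "(if m \<le> i \<and> i < N then \<Sum>j\<le>m. coeff f j * v (i - m + j) else v i) =
      (\<Sum>k<?n. Q i k * v k)" for v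
    proof (cases "m \<le> i \<and> i < N")
      case True
      have "(\<Sum>k<?n. Q i k * v k) = (\<Sum>k\<in>(\<lambda>j. i - m + j) ` {..m}. Q i k * v k)"
      proof (rule sum.mono_neutral_right)
        show "(\<lambda>j. i - m + j) ` {..m} \<subseteq> {..<?n}" using True i by auto
        show "\<forall>k\<in>{..<?n} - (\<lambda>j. i - m + j) ` {..m}. Q i k * v k = 0"
        proof
          fix k assume k: "k \<in> {..<?n} - (\<lambda>j. i - m + j) ` {..m}"
          have "Q i k = 0"
          proof (cases "i - m \<le> k")
            case le: True
            have "k - (i - m) > m"
            proof (rule ccontr)
              assume "\<not> k - (i - m) > m"
              then have "i - m + (k - (i - m)) \<in> (\<lambda>j. i - m + j) ` {..m}" by simp
              with k le show False by simp
            qed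
            then show ?thesis using f True by (simp add: Q_def coeff_eq_0)
          qed (use True in \<open>simp add: Q_def\<close>)
          then show "Q i k * v k = 0" by simp
        qed
      qed simp
      also have "\<dots> = (\<Sum>j\<le>m. coeff f j * v (i - m + j))"
        using True by (subst sum.reindex) (auto simp: Q_def inj_on_def intro!: sum.cong)
      finally show ?thesis using True by simp
    next
      case False
      then have "(\<Sum>k<?n. Q i k * v k) = (\<Sum>k<?n. if i = k then v k else 0)"
        by (intro sum.cong) (auto simp: Q_def)
      with i False show ?thesis by auto
    qed
    then show "(map (\<lambda>v i. if m \<le> i \<and> i < N then \<Sum>j\<le>m. coeff f j * v (i - m + j) else v i) vs ! j) i =
      (map (\<lambda>v i. \<Sum>k<?n. Q i k * v k) vs ! j) i"
      using j by simp
  qed simp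
  also have "\<dots> = det (mat ?n ?n (\<lambda>(i, k). Q i k)) * cdet vs"
    by (rule cdet_row_operation)
  also have "det (mat ?n ?n (\<lambda>(i, k). Q i k)) = prod_list (diag_mat (mat ?n ?n (\<lambda>(i, k). Q i k)))"
    by (rule det_lower_triangular[of ?n]) (use f in \<open>auto simp: Q_def coeff_eq_0\<close>)
  also have "diag_mat (mat ?n ?n (\<lambda>(i, k). Q i k)) = replicate ?n 1"
    using f by (auto simp: diag_mat_def Q_def intro!: nth_equalityI)
  finally show ?thesis by simp
qed

lemma prod_list_map_mult_const:
  "(\<Prod>x\<leftarrow>xs. f x) * (\<Prod>x\<leftarrow>xs. g x) = (\<Prod>x\<leftarrow>xs. f x * (g x :: 'a::comm_monoid_mult))"
  by (induction xs) (auto simp: mult_ac)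

lemma cdet_scale_map:
  "cdet (us @ map (\<lambda>x i. c x * p x i) xs @ vs) = (\<Prod>x\<leftarrow>xs. c x) * cdet (us @ map p xs @ vs)"
proof (induction xs arbitrary: us)
  case (Cons x xs)
  show ?case
    using Cons.IH[of "us @ [p x]"]
    by (simp add: cdet_scale mult_ac)
qed simp

text \<open>Row operations with the polynomial \<open>T - x\<close>, where \<open>x\<close> is the first node,
leave only the top entry of the first column.\<close>

lemma vandermonde:
  fixes xs :: "'a::idom list"
  shows "cdet (map pw xs) = vand xs"
proof (induction xs)
  case (Cons x xs)
  let ?f = "[:-x, 1:]"
  let ?t = "\<lambda>v i. if 1 \<le> i \<and> i < Suc (length xs) then \<Sum>j\<le>1. coeff ?f j * v (i - 1 + j) else v i"
  have t: "?t (pw a) i = (if i = 0 then 1 else a ^ (i - 1) * (a - x))" if "i < Suc (length xs)" for a i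
    using that by (cases i) (auto simp: pw_def algebra_simps)
  have "cdet (map pw (x # xs)) = cdet (map ?t (map pw (x # xs)))"
    by (rule cdet_multiply_rows_by_monic[symmetric]) auto
  also have "\<dots> = cdet ([unit_col 0] @ map (\<lambda>a i. if i = 0 then 1 else a ^ (i - 1) * (a - x)) xs)"
  proof (rule cdet_cong)
    fix i j
    assume "i < length ([unit_col 0] @ map (\<lambda>a i. if i = 0 then 1 else a ^ (i - 1) * (a - x)) xs)"
      and "j < length ([unit_col 0] @ map (\<lambda>a i. if i = 0 then 1 else a ^ (i - 1) * (a - x)) xs)"
    then show "(map ?t (map pw (x # xs)) ! j) i =
      (([unit_col 0] @ map (\<lambda>a i. if i = 0 then 1 else a ^ (i - 1) * (a - x)) xs) ! j) i"
      using t[of i x] t[of i "xs ! (j - 1)"] by (cases j) (auto simp: unit_col_def)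
  qed simp
  also have "\<dots> = cdet [unit_col 0] *
      cdet (map (\<lambda>v i. v (i + 1)) (map (\<lambda>a i. if i = 0 then 1 else a ^ (i - 1) * (a - x)) xs))"
    by (subst cdet_block_first) (auto simp: unit_col_def)
  also have "cdet [unit_col 0 :: nat \<Rightarrow> 'a] = 1" using cdet_unit_cols[of 1] by simp
  also have "map (\<lambda>v i. v (i + 1)) (map (\<lambda>a i. if i = 0 then 1 else a ^ (i - 1) * (a - x)) xs) =
      map (\<lambda>a i. (a - x) * pw a i) xs"
    by (simp add: pw_def mult.commute)
  also have "cdet \<dots> = (\<Prod>a\<leftarrow>xs. a - x) * cdet (map pw xs)"
    using cdet_scale_map[of "[]" "\<lambda>a. a - x" pw xs "[]"] by simp
  finally show ?case by (simp add: Cons.IH mult.commute)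
qed simp

lemma vand_append: "vand (xs @ ys) = vand xs * vand ys * (\<Prod>x\<leftarrow>xs. \<Prod>y\<leftarrow>ys. y - x)"
  by (induction xs) (auto simp: mult_ac)

lemma vand_nonzero:
  fixes xs :: "'a::idom list"
  assumes "distinct xs"
  shows "vand xs \<noteq> 0"
  using assms by (induction xs) (auto simp: prod_list_zero_iff)

section \<open>Evaluation of integer polynomials\<close>

definition monom_value :: "(nat \<Rightarrow> 'b::comm_ring_1) \<Rightarrow> (nat \<Rightarrow>\<^sub>0 nat) \<Rightarrow> 'b" where
  "monom_value x e = (\<Prod>j\<in>Poly_Mapping.keys e. x j ^ Poly_Mapping.lookup e j)"

lemma monom_value_superset:
  assumes "finite S" "Poly_Mapping.keys e \<subseteq> S"
  shows "monom_value x e = (\<Prod>j\<in>S. x j ^ Poly_Mapping.lookup e j)"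
  unfolding monom_value_def
  by (rule prod.mono_neutral_left) (use assms in \<open>auto simp: in_keys_iff\<close>)

lemma monom_value_add: "monom_value x (e + e') = monom_value x e * monom_value x e'"
proof -
  let ?S = "Poly_Mapping.keys e \<union> Poly_Mapping.keys e'"
  have "monom_value x (e + e') = (\<Prod>j\<in>?S. x j ^ Poly_Mapping.lookup (e + e') j)"
    by (rule monom_value_superset) (simp_all add: Poly_Mapping.keys_add)
  moreover have "monom_value x e = (\<Prod>j\<in>?S. x j ^ Poly_Mapping.lookup e j)"
    "monom_value x e' = (\<Prod>j\<in>?S. x j ^ Poly_Mapping.lookup e' j)"
    by (rule monom_value_superset; auto)+
  ultimately show ?thesis by (simp add: lookup_add power_add prod.distrib)
qed

lemma mpoly_value_superset:
  assumes "finite S" "Poly_Mapping.keys P \<subseteq> S"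
  shows "mpoly_value x P = (\<Sum>e\<in>S. of_int (Poly_Mapping.lookup P e) * monom_value x e)"
  unfolding mpoly_value_def monom_value_def
  by (rule sum.mono_neutral_left) (use assms in \<open>auto simp: in_keys_iff\<close>)

lemma mpoly_value_add: "mpoly_value x (P + Q) = mpoly_value x P + mpoly_value x Q"
proof -
  let ?S = "Poly_Mapping.keys P \<union> Poly_Mapping.keys Q"
  have "mpoly_value x (P + Q) = (\<Sum>e\<in>?S. of_int (Poly_Mapping.lookup (P + Q) e) * monom_value x e)"
    by (rule mpoly_value_superset) (simp_all add: Poly_Mapping.keys_add)
  moreover have "mpoly_value x P = (\<Sum>e\<in>?S. of_int (Poly_Mapping.lookup P e) * monom_value x e)"
    "mpoly_value x Q = (\<Sum>e\<in>?S. of_int (Poly_Mapping.lookup Q e) * monom_value x e)"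
    by (rule mpoly_value_superset; auto)+
  ultimately show ?thesis by (simp add: lookup_add ring_distribs sum.distrib)
qed

lemma mpoly_value_0: "mpoly_value x 0 = 0"
  by (simp add: mpoly_value_def)

lemma mpoly_value_sum: "mpoly_value x (sum F S) = (\<Sum>s\<in>S. mpoly_value x (F s))"
  by (induction S rule: infinite_finite_induct) (simp_all add: mpoly_value_add mpoly_value_0)

lemma mpoly_value_single: "mpoly_value x (Poly_Mapping.single e c) = of_int c * monom_value x e"
  by (subst mpoly_value_superset[of "{e}"]) auto

lemma mpoly_as_sum: "P = (\<Sum>e\<in>Poly_Mapping.keys P. Poly_Mapping.single e (Poly_Mapping.lookup P e))"
proof (rule poly_mapping_eqI)
  fix k
  show "Poly_Mapping.lookup P k =
    Poly_Mapping.lookup (\<Sum>e\<in>Poly_Mapping.keys P. Poly_Mapping.single e (Poly_Mapping.lookup P e)) k"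
    by (auto simp: lookup_sum lookup_single when_def in_keys_iff)
qed

lemma mpoly_value_mult: "mpoly_value x (P * Q) = mpoly_value x P * mpoly_value x Q"
proof -
  let ?s = "\<lambda>P e. Poly_Mapping.single e (Poly_Mapping.lookup P e)"
  let ?K = "Poly_Mapping.keys"
  have "P * Q = (\<Sum>e\<in>?K P. ?s P e) * (\<Sum>e\<in>?K Q. ?s Q e)"
    using mpoly_as_sum[of P] mpoly_as_sum[of Q] by simp
  also have "\<dots> = (\<Sum>e\<in>?K P. \<Sum>e'\<in>?K Q.
      Poly_Mapping.single (e + e') (Poly_Mapping.lookup P e * Poly_Mapping.lookup Q e'))"
    by (simp add: sum_product mult_single)
  also have "mpoly_value x \<dots> = (\<Sum>e\<in>?K P. \<Sum>e'\<in>?K Q.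
      (of_int (Poly_Mapping.lookup P e) * monom_value x e) *
      (of_int (Poly_Mapping.lookup Q e') * monom_value x e'))"
    by (simp add: mpoly_value_sum mpoly_value_single monom_value_add mult_ac)
  also have "\<dots> = mpoly_value x P * mpoly_value x Q"
    by (simp add: sum_product mpoly_value_superset[of "?K P" P] mpoly_value_superset[of "?K Q" Q])
  finally show ?thesis .
qed

lemma mpoly_value_1: "mpoly_value x 1 = 1"
  using mpoly_value_single[of x 0 1] by (simp add: monom_value_def)

lemma mpoly_value_hom: "comm_ring_hom (mpoly_value x)"
  by unfold_locales (auto simp: mpoly_value_0 mpoly_value_1 mpoly_value_add mpoly_value_mult)

lemma mpoly_value_indet: "mpoly_value x (indet j) = x j"
  by (simp add: indet_def mpoly_value_single monom_value_def)

lemma hom_mpoly_value: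
  assumes "comm_ring_hom \<phi>"
  shows "\<phi> (mpoly_value x P) = mpoly_value (\<lambda>j. \<phi> (x j)) P"
proof -
  interpret comm_ring_hom \<phi> by fact
  show ?thesis unfolding mpoly_value_def by (simp add: hom_distribs)
qed

lemma indet_inject: "indet i = indet j \<longleftrightarrow> i = j"
proof
  assume eq: "indet i = indet j"
  show "i = j"
  proof (rule ccontr)
    assume ij: "i \<noteq> j"
    have "mpoly_value (\<lambda>k. if k = i then 1 else 0 :: int) (indet i) =
      mpoly_value (\<lambda>k. if k = i then 1 else 0 :: int) (indet j)" by (simp only: eq)
    with ij show False by (simp add: mpoly_value_indet)
  qed
qed simp

lemma hom_cdet:
  assumes "comm_ring_hom \<phi>"
  shows "\<phi> (cdet vs) = cdet (map (\<lambda>v i. \<phi> (v i)) vs)"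
proof -
  interpret comm_ring_hom \<phi> by fact
  show ?thesis
    unfolding cdet_def hom_det[symmetric]
    by (rule arg_cong[where f=det]) (rule eq_matI; simp)
qed

section \<open>Schur polynomials at arbitrary nodes\<close>

definition root_poly :: "'a::comm_ring_1 list \<Rightarrow> 'a poly" where
  "root_poly xs = (\<Prod>x\<leftarrow>xs. [:- x, 1:])"

lemma poly_root_poly: "poly (root_poly xs) u = (\<Prod>x\<leftarrow>xs. u - x)"
  unfolding root_poly_def by (induction xs) (auto simp: algebra_simps)

lemma root_poly_monic: "degree (root_poly xs) = length xs \<and> coeff (root_poly xs) (length xs) = 1"
proof (induction xs)
  case (Cons x xs)
  let ?g = "root_poly xs"
  have eq: "root_poly (x # xs) = [:-x, 1:] * ?g" by (simp add: root_poly_def)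
  have c: "coeff (root_poly (x # xs)) (Suc (length xs)) = 1"
    using Cons unfolding eq by (simp add: coeff_eq_0)
  moreover have "degree (root_poly (x # xs)) \<le> Suc (length xs)"
    using degree_mult_le[of "[:-x, 1:]" ?g] Cons unfolding eq by simp
  ultimately have "degree (root_poly (x # xs)) = Suc (length xs)"
    by (intro antisym le_degree) auto
  with c show ?case by simp
qed (simp add: root_poly_def)

lemmas degree_root_poly [simp] = root_poly_monic[THEN conjunct1]
lemmas lead_coeff_root_poly = root_poly_monic[THEN conjunct2]

lemma prod_list_zero_map: "x \<in> set xs \<Longrightarrow> h x = 0 \<Longrightarrow> (\<Prod>y\<leftarrow>xs. h y) = (0::'a::comm_ring_1)"
  by (induction xs) auto

text \<open>Division by the monic polynomial with roots \<open>xs\<close> reduces \<open>T\<^sup>p\<close> to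
a remainder of degree below \<open>length xs\<close>, which has the same values on \<open>xs\<close>.\<close>

lemma power_as_low_powers:
  fixes xs :: "'a::comm_ring_1 list"
  shows "\<exists>c. \<forall>x\<in>set xs. x ^ p = (\<Sum>q<length xs. c q * x ^ q)"
proof (induction p rule: less_induct)
  case (less p)
  let ?r = "length xs"
  show ?case
  proof (cases "p < ?r")
    case True
    then have "x ^ p = (\<Sum>q<?r. unit_col p q * x ^ q)" for x :: 'a
      by (subst sum.remove[of _ p]) (auto simp: unit_col_def intro!: sum.neutral)
    then show ?thesis by blast
  next
    case False
    define f where "f = root_poly xs"
    have fd: "degree f = ?r" and fl: "coeff f ?r = 1"
      using lead_coeff_root_poly[of xs] by (simp_all add: f_def)
    have root: "poly f x = 0" if "x \<in> set xs" for x
      using that by (auto simp: f_def poly_root_poly intro: prod_list_zero_map)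
    have red: "x ^ p = (\<Sum>j<?r. - coeff f j * x ^ (p - ?r + j))" if "x \<in> set xs" for x
    proof -
      have "0 = x ^ (p - ?r) * poly f x" using root[OF that] by simp
      also have "poly f x = (\<Sum>j<?r. coeff f j * x ^ j) + x ^ ?r"
        using fd fl by (simp add: poly_altdef lessThan_Suc_atMost[symmetric])
      also have "x ^ (p - ?r) * \<dots> = (\<Sum>j<?r. coeff f j * x ^ (p - ?r + j)) + x ^ p"
        using False by (simp add: algebra_simps sum_distrib_left power_add flip: power_add)
      finally show ?thesis by (simp add: sum_negf eq_neg_iff_add_eq_0 add.commute)
    qed
    have "\<exists>c. \<forall>x\<in>set xs. x ^ (p - ?r + j) = (\<Sum>q<?r. c q * x ^ q)" if "j < ?r" for j
      using that False by (intro less.IH) simp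
    then obtain C where C: "\<And>j x. j < ?r \<Longrightarrow> x \<in> set xs \<Longrightarrow>
        x ^ (p - ?r + j) = (\<Sum>q<?r. C j q * x ^ q)" by metis
    have "x ^ p = (\<Sum>q<?r. (\<Sum>j<?r. - coeff f j * C j q) * x ^ q)" if "x \<in> set xs" for x
      unfolding red[OF that] sum_distrib_right
      by (subst sum.swap) (auto simp: C that sum_distrib_left mult.assoc intro!: sum.cong)
    then show ?thesis by (intro exI[of _ "\<lambda>q. \<Sum>j<?r. - coeff f j * C j q"]) blast
  qed
qed

text \<open>Reducing every power as in the previous lemma writes the matrix as a product of a matrix of
coefficients and the Vandermonde matrix. This is why Schur quotients are polynomials.\<close>

lemma minor_dvd_vandermonde:
  fixes xs :: "'a::idom list"
  shows "\<exists>c. cdet (map (\<lambda>x i. x ^ es i) xs) = c * vand xs"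
proof -
  let ?r = "length xs"
  obtain C where C: "\<And>p x. x \<in> set xs \<Longrightarrow> x ^ p = (\<Sum>q<?r. C p q * x ^ q)"
    using power_as_low_powers[of xs] by metis
  have "cdet (map (\<lambda>x i. x ^ es i) xs) =
    cdet (map (\<lambda>v i. \<Sum>q<length (map pw xs). C (es i) q * v q) (map pw xs))"
    by (rule cdet_cong) (auto simp: pw_def C[symmetric])
  also have "\<dots> = det (mat ?r ?r (\<lambda>(i, q). C (es i) q)) * vand xs"
    unfolding cdet_row_operation vandermonde by simp
  finally show ?thesis by blast
qed

text \<open>The determinant of the antidiagonal permutation matrix. It translates between descending powers,
as in the rows of \<open>V\<^sub>k\<close>, and the ascending powers of \<open>pw\<close>; in a Schur quotient
it cancels.\<close>

definition reversal_sign :: "nat \<Rightarrow> 'a::comm_ring_1" where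
  "reversal_sign n = det (mat n n (\<lambda>(i, k). if k = n - 1 - i then 1 else 0))"

lemma cdet_reverse_rows:
  "cdet (map (\<lambda>v i. v (length vs - 1 - i)) vs) = reversal_sign (length vs) * cdet vs"
proof -
  let ?n = "length vs"
  have "cdet (map (\<lambda>v i. v (?n - 1 - i)) vs) =
    cdet (map (\<lambda>v i. \<Sum>k<?n. (if k = ?n - 1 - i then 1 else 0) * v k) vs)"
  proof (rule cdet_cong)
    fix i j assume ij: "i < length (map (\<lambda>v i. \<Sum>k<?n. (if k = ?n - 1 - i then 1 else 0) * v k) vs)"
      "j < length (map (\<lambda>v i. \<Sum>k<?n. (if k = ?n - 1 - i then 1 else 0) * v k) vs)"
    have "(\<Sum>k<?n. (if k = ?n - 1 - i then 1 else 0) * (vs ! j) k) =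
      (\<Sum>k<?n. if k = ?n - 1 - i then (vs ! j) k else 0)"
      by (intro sum.cong) auto
    also have "\<dots> = (vs ! j) (?n - 1 - i)" using ij by auto
    finally show "(map (\<lambda>v i. v (?n - 1 - i)) vs ! j) i =
      (map (\<lambda>v i. \<Sum>k<?n. (if k = ?n - 1 - i then 1 else 0) * v k) vs ! j) i"
      using ij by simp
  qed simp
  then show ?thesis by (simp add: cdet_row_operation reversal_sign_def)
qed

lemma reversal_sign_square: "reversal_sign n * reversal_sign n = (1::'a::comm_ring_1)"
proof -
  let ?u = "map unit_col [0..<n] :: (nat \<Rightarrow> 'a) list"
  let ?v = "map (\<lambda>v i. v (length ?u - 1 - i)) ?u"
  have "cdet ?u = cdet (map (\<lambda>v i. v (length ?v - 1 - i)) ?v)"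
    by (rule cdet_cong) auto
  also have "\<dots> = reversal_sign n * (reversal_sign n * cdet ?u)"
    unfolding cdet_reverse_rows by simp
  finally show ?thesis by simp
qed

lemma reversal_sign_nonzero: "reversal_sign n \<noteq> (0::'a::comm_ring_1)"
proof
  assume "reversal_sign n = (0::'a)"
  then have "0 * 0 = (1::'a)" using reversal_sign_square[of n, where ?'a = 'a] by metis
  then show False by simp
qed

text \<open>Row \<open>l\<close> of \<open>V\<^sub>k\<close> carries the exponent \<open>k - l\<close>; these
are the exponents of the rows outside \<open>R\<close> in increasing order.\<close>

definition kept_rows :: "int \<Rightarrow> int set \<Rightarrow> nat list" where
  "kept_rows k R = map (\<lambda>l. nat (k - l)) (rev (sorted_list_of_set ({1..k} - R)))"

text \<open>The homomorphism is arbitrary because the lemma is used twice: with the identity in order to prove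
divisibility among integer polynomials, and with an evaluation.\<close>

lemma det_vandermonde_minor:
  assumes "comm_ring_hom \<phi>" and "card ({1..k} - R) = r"
  shows "\<phi> (det (vandermonde_minor k R r)) =
    reversal_sign r * cdet (map (\<lambda>j i. \<phi> (indet j) ^ (kept_rows k R ! i)) [0..<r])"
proof -
  interpret comm_ring_hom \<phi> by fact
  let ?es = "kept_rows k R" and ?x = "\<lambda>j. \<phi> (indet j)"
  have len: "length ?es = r" using assms by (simp add: kept_rows_def)
  have "\<phi> (det (vandermonde_minor k R r)) =
      cdet (map (\<lambda>v i. v (length (map (\<lambda>j i. ?x j ^ (?es ! i)) [0..<r]) - 1 - i))
        (map (\<lambda>j i. ?x j ^ (?es ! i)) [0..<r]))"
    unfolding hom_det[symmetric] vandermonde_minor_def cdet_def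
    by (rule arg_cong[where f=det])
       (rule eq_matI; use assms in \<open>simp add: hom_power kept_rows_def rev_nth\<close>)
  also have "\<dots> = reversal_sign r * cdet (map (\<lambda>j i. ?x j ^ (?es ! i)) [0..<r])"
    unfolding cdet_reverse_rows by simp
  finally show ?thesis .
qed

lemma sorted_list_of_set_int: "sorted_list_of_set {a..b::int} = [a..b]"
  by (rule sorted_distinct_set_unique) auto

lemma kept_rows_all: "kept_rows (int r) {} = [0..<r]"
proof -
  have "rev (kept_rows (int r) {}) = rev [0..<r]"
  proof (rule nth_equalityI)
    fix i assume "i < length (rev (kept_rows (int r) {}))"
    then have "i < r" by (simp add: kept_rows_def)
    then show "rev (kept_rows (int r) {}) ! i = rev [0..<r] ! i"
      by (simp add: kept_rows_def sorted_list_of_set_int rev_nth rev_map)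
  qed (simp add: kept_rows_def)
  then show ?thesis by simp
qed

lemma det_vandermonde_full:
  fixes \<phi> :: "int_mpoly \<Rightarrow> 'a::idom"
  assumes "comm_ring_hom \<phi>"
  shows "\<phi> (det (vandermonde_minor (int r) {} r)) =
    reversal_sign r * vand (map (\<lambda>j. \<phi> (indet j)) [0..<r])"
proof -
  have c: "card ({1..int r} - {}) = r" by simp
  have eq: "cdet (map (\<lambda>j i. \<phi> (indet j) ^ (kept_rows (int r) {} ! i)) [0..<r]) =
      cdet (map pw (map (\<lambda>j. \<phi> (indet j)) [0..<r]))"
    by (rule cdet_cong) (auto simp: kept_rows_all pw_def)
  show ?thesis unfolding det_vandermonde_minor[OF assms c] eq vandermonde ..
qed

text \<open>The quotient exists by \<open>minor_dvd_vandermonde\<close> for the indeterminates, and it is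
unique because their Vandermonde determinant is nonzero in an integral domain. So the definite description in
\<open>schur_poly\<close> denotes it.\<close>

lemma schur_poly_quotient:
  assumes "card ({1..k} - R) = r"
  shows "schur_poly k R r * det (vandermonde_minor (int r) {} r) = det (vandermonde_minor k R r)"
proof -
  have id: "comm_ring_hom (\<lambda>P::int_mpoly. P)" by unfold_locales auto
  let ?X = "map indet [0..<r]"
  have "distinct ?X" by (auto simp: distinct_map inj_on_def indet_inject)
  then have nz: "vand ?X \<noteq> 0" by (rule vand_nonzero)
  have rs: "reversal_sign r \<noteq> (0 :: int_mpoly)"
    by (rule reversal_sign_nonzero)
  have full: "det (vandermonde_minor (int r) {} r) = reversal_sign r * vand ?X"
    using det_vandermonde_full[OF id] .
  obtain c where "cdet (map (\<lambda>x i. x ^ (kept_rows k R ! i)) ?X) = c * vand ?X"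
    using minor_dvd_vandermonde[of "\<lambda>i. kept_rows k R ! i" ?X] by auto
  then have "det (vandermonde_minor k R r) = c * det (vandermonde_minor (int r) {} r)"
    using det_vandermonde_minor[OF id assms] by (simp add: full o_def mult_ac)
  moreover have "P = Q" if "P * det (vandermonde_minor (int r) {} r) =
      Q * det (vandermonde_minor (int r) {} r)" for P Q
    using that nz rs by (simp add: full)
  ultimately have "\<exists>!P. P * det (vandermonde_minor (int r) {} r) = det (vandermonde_minor k R r)"
    by metis
  then show ?thesis unfolding schur_poly_def by (rule theI')
qed

lemma schur_poly_value:
  fixes x :: "nat \<Rightarrow> 'a::idom"
  assumes "card ({1..k} - R) = r"
  shows "mpoly_value x (schur_poly k R r) * vand (map x [0..<r]) =
    cdet (map (\<lambda>x i. x ^ (kept_rows k R ! i)) (map x [0..<r]))"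
proof -
  note hom = mpoly_value_hom[of x]
  have rs: "reversal_sign r \<noteq> (0 :: 'a)"
    by (rule reversal_sign_nonzero)
  have "mpoly_value x (schur_poly k R r) * mpoly_value x (det (vandermonde_minor (int r) {} r)) =
      mpoly_value x (det (vandermonde_minor k R r))"
    using schur_poly_quotient[OF assms] by (simp flip: mpoly_value_mult)
  then have "reversal_sign r * (mpoly_value x (schur_poly k R r) * vand (map x [0..<r])) =
      reversal_sign r * cdet (map (\<lambda>x i. x ^ (kept_rows k R ! i)) (map x [0..<r]))"
    unfolding det_vandermonde_full[OF hom] det_vandermonde_minor[OF hom assms] mpoly_value_indet
    by (simp add: o_def mult_ac)
  with rs show ?thesis by simp
qed

text \<open>Adding different powers of a new variable makes arbitrary nodes distinct, and evaluation at 0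
recovers them. The exponent \<open>Suc j\<close> is positive, so that perturbed nodes also differ from
constants.\<close>

definition perturb :: "nat \<Rightarrow> 'a::idom \<Rightarrow> 'a poly" where
  "perturb j a = [:a:] + monom 1 (Suc j)"

lemma poly_perturb_0 [simp]: "poly (perturb j a) 0 = a"
  by (simp add: perturb_def poly_monom)

lemma perturb_neq: "i \<noteq> j \<Longrightarrow> perturb i a \<noteq> perturb j b"
proof
  assume "i \<noteq> j" "perturb i a = perturb j b"
  then have "coeff (perturb i a) (Suc i) = coeff (perturb j b) (Suc i)" by simp
  with \<open>i \<noteq> j\<close> show False by (simp add: perturb_def)
qed

lemma perturb_neq_const: "perturb i a \<noteq> [:b:]"
proof
  assume "perturb i a = [:b:]"
  then have "coeff (perturb i a) (Suc i) = coeff [:b:] (Suc i)" by simp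
  then show False by (simp add: perturb_def)
qed

lemma poly_0_hom: "comm_ring_hom (\<lambda>p :: 'a::comm_ring_1 poly. poly p 0)"
  by unfold_locales auto

text \<open>For distinct nodes both determinants of the quotient change by \<open>sign p\<close> and the
Vandermonde determinant can be cancelled. Perturbing the nodes reduces the general case to this one. The nodes
with index at least \<open>r\<close> are arbitrary on both sides, so the value depends on the first
\<open>r\<close> nodes only.\<close>

lemma schur_poly_symmetric:
  fixes x y :: "nat \<Rightarrow> 'a::idom"
  assumes "card ({1..k} - R) = r" and p: "p permutes {..<r}"
    and xy: "\<And>j. j < r \<Longrightarrow> y j = x (p j)"
  shows "mpoly_value y (schur_poly k R r) = mpoly_value x (schur_poly k R r)"
proof -
  define X where "X = (\<lambda>j. perturb j (x j))"
  define Y where "Y = (\<lambda>j. if j < r then X (p j) else [:y j:])"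
  let ?P = "schur_poly k R r"
  have YX: "map Y [0..<r] = map (X \<circ> p) [0..<r]" by (simp add: Y_def)
  have set: "p permutes set [0..<r]" using p by (simp add: lessThan_atLeast0)
  have perm: "cdet (map (\<lambda>j. h (X j)) (map p [0..<r])) =
      of_int (sign p) * cdet (map (\<lambda>j. h (X j)) [0..<r])" for h
    using cdet_map_permutes[OF _ set, of "[]" "\<lambda>j. h (X j)" "[]"] by (simp add: o_def)
  have "mpoly_value Y ?P * vand (map Y [0..<r]) =
      cdet (map (\<lambda>x i. x ^ (kept_rows k R ! i)) (map Y [0..<r]))"
    by (rule schur_poly_value[OF assms(1)])
  also have "\<dots> = of_int (sign p) * cdet (map (\<lambda>x i. x ^ (kept_rows k R ! i)) (map X [0..<r]))"
    unfolding YX using perm[of "\<lambda>x i. x ^ (kept_rows k R ! i)"] by (simp add: o_def)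
  also have "\<dots> = of_int (sign p) * (mpoly_value X ?P * vand (map X [0..<r]))"
    by (simp add: schur_poly_value[OF assms(1)])
  also have "\<dots> = mpoly_value X ?P * vand (map Y [0..<r])"
    unfolding YX vandermonde[symmetric] using perm[of pw] by (simp add: o_def mult_ac)
  finally have "(mpoly_value Y ?P - mpoly_value X ?P) * vand (map Y [0..<r]) = 0"
    by (simp add: algebra_simps)
  moreover have "distinct (map Y [0..<r])"
    unfolding YX using permutes_inj_on[OF p, of "{0..<r}"]
    by (auto simp: distinct_map inj_on_def X_def dest: perturb_neq)
  ultimately have "mpoly_value Y ?P = mpoly_value X ?P" using vand_nonzero by force
  then have "poly (mpoly_value Y ?P) 0 = poly (mpoly_value X ?P) 0" by simp
  moreover have "(\<lambda>j. poly (X j) 0) = x" "(\<lambda>j. poly (Y j) 0) = y"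
    by (auto simp: X_def Y_def xy)
  ultimately show ?thesis by (simp add: hom_mpoly_value[OF poly_0_hom])
qed

lemma schur_mset:
  fixes x :: "nat \<Rightarrow> 'a::idom"
  assumes "card ({1..k} - R) = length xs" and x: "\<And>j. j < length xs \<Longrightarrow> x j = xs ! j"
  shows "schur k R (mset xs) = mpoly_value x (schur_poly k R (length xs))"
proof -
  define ys where "ys = (SOME ys. mset ys = mset xs)"
  have ys: "mset ys = mset xs" unfolding ys_def by (rule someI) simp
  then have len: "length ys = length xs" by (metis size_mset)
  obtain p where p: "p permutes {..<length xs}" "permute_list p xs = ys"
    using mset_eq_permutation[OF ys] by blast
  have "mpoly_value (nth ys) (schur_poly k R (length xs)) = mpoly_value x (schur_poly k R (length xs))"
  proof (rule schur_poly_symmetric[OF assms(1) p(1)])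
    fix j assume "j < length xs"
    moreover from this have "p j < length xs" using permutes_in_image[OF p(1), of j] by auto
    ultimately show "ys ! j = x (p j)"
      using permute_list_nth[OF p(1), of j] p(2) x by simp
  qed
  then show ?thesis by (simp add: schur_def ys_def[symmetric] len)
qed

text \<open>By symmetry the enumeration chosen in the definition of \<open>schur\<close> can be replaced by
\<open>xs\<close>.\<close>

lemma schur_times_vand:
  fixes xs :: "'a::idom list"
  assumes "card ({1..k} - R) = length xs"
  shows "schur k R (mset xs) * vand xs = cdet (map (\<lambda>x i. x ^ (kept_rows k R ! i)) xs)"
  using schur_poly_value[OF assms, of "nth xs"] schur_mset[OF assms, of "nth xs"]
  by (simp add: map_nth)

lemma hom_schur:
  fixes \<phi> :: "'a::idom \<Rightarrow> 'b::idom"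
  assumes "comm_ring_hom \<phi>" "card ({1..k} - R) = size X"
  shows "schur k R (image_mset \<phi> X) = \<phi> (schur k R X)"
proof -
  interpret comm_ring_hom \<phi> by fact
  obtain xs where X: "X = mset xs" by (metis ex_mset)
  have c: "card ({1..k} - R) = length xs" using assms(2) by (simp add: X)
  have "schur k R (mset (map \<phi> xs)) =
      mpoly_value (\<lambda>j. if j < length xs then \<phi> (xs ! j) else 0) (schur_poly k R (length xs))"
    using schur_mset[of k R "map \<phi> xs" "\<lambda>j. if j < length xs then \<phi> (xs ! j) else 0"] c by simp
  also have "(\<lambda>j. if j < length xs then \<phi> (xs ! j) else 0) =
      (\<lambda>j. \<phi> (if j < length xs then xs ! j else 0))" by auto
  also have "mpoly_value \<dots> (schur_poly k R (length xs)) = \<phi> (schur k R X)"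
    unfolding hom_mpoly_value[OF assms(1), symmetric] X
    by (subst schur_mset[OF c]) auto
  finally show ?thesis by (simp add: X)
qed

section \<open>The cofactor and the roots of the second polynomial\<close>

lemma cdet_transpose: "cdet (map (\<lambda>j i. F i j) [0..<n]) = cdet (map (\<lambda>i j. F i j) [0..<n])"
proof -
  have "mat n n (\<lambda>(i, j). (map (\<lambda>j i. F i j) [0..<n] ! j) i) =
      transpose_mat (mat n n (\<lambda>(i, j). (map (\<lambda>i j. F i j) [0..<n] ! j) i))"
    by (rule eq_matI) auto
  then show ?thesis
    unfolding cdet_def by (simp add: det_transpose[of _ n])
qed

text \<open>Row 0 holds the entry \<open>c\<close> of the special column of the subresultant matrix; the rows
after it hold the coefficients of \<open>T\<^sup>i h\<close> in the degrees above \<open>d\<close>.\<close>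

definition sylvester_col :: "nat \<Rightarrow> 'a::comm_ring_1 poly \<Rightarrow> 'a \<Rightarrow> nat \<Rightarrow> nat \<Rightarrow> 'a" where
  "sylvester_col d h c i = (\<lambda>k. if k = 0 then c else coeff (monom 1 i * h) (d + k))"

text \<open>Up to sign the determinant \<open>F\<^sub>d\<close>, transposed and with degrees in ascending
order, where \<open>\<xi>\<close> stands for the indeterminate.\<close>

definition cofactor_det :: "nat \<Rightarrow> 'a::comm_ring_1 poly \<Rightarrow> 'a poly \<Rightarrow> 'a \<Rightarrow> 'a" where
  "cofactor_det d f g \<xi> =
    cdet (map (\<lambda>i. sylvester_col d f (\<xi> ^ i) i) [0..<degree g - d] @
      map (\<lambda>i. sylvester_col d g 0 i) [0..<degree f - d])"

lemma coeff_monom_mult_1: "coeff (monom 1 i * h) j = (if i \<le> j then coeff h (j - i) else (0::'a::comm_ring_1))"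
  using coeff_monom_mult[of 1 i h j] by simp

lemma poly_monom_mult_sum:
  fixes h :: "'a::idom poly"
  assumes "degree h + i < N"
  shows "(\<Sum>p<N. b ^ p * coeff (monom 1 i * h) p) = b ^ i * poly h b"
proof -
  have "degree (monom 1 i * h) < N"
    using degree_mult_le[of "monom 1 i" h] degree_monom_le[of "1::'a" i] assms by linarith
  then have "poly (monom 1 i * h) b = (\<Sum>p<N. coeff (monom 1 i * h) p * b ^ p)"
    unfolding poly_altdef
    by (intro sum.mono_neutral_left) (auto simp: coeff_eq_0)
  then show ?thesis by (simp add: poly_monom mult.commute)
qed

lemma sum_skip:
  assumes "e \<le> N"
  shows "(\<Sum>r<Suc N. if r = e then c else h (delete_index e r)) = c + (\<Sum>p<N. h p :: 'a::comm_monoid_add)"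
proof -
  have "(\<Sum>r<Suc N. if r = e then c else h (delete_index e r)) =
      c + (\<Sum>r\<in>{..<Suc N} - {e}. h (delete_index e r))"
    using assms by (subst sum.remove[of _ e]) (auto intro!: sum.cong)
  also have "(\<Sum>r\<in>{..<Suc N} - {e}. h (delete_index e r)) = (\<Sum>p<N. h p)"
    by (rule sum.reindex_bij_witness[of _ "insert_index e" "delete_index e"])
      (use assms in \<open>auto simp: insert_index_def delete_index_def\<close>)
  finally show ?thesis .
qed

lemma upt_split: "i \<le> j \<Longrightarrow> j \<le> k \<Longrightarrow> [i..<k] = [i..<j] @ [j..<k]"
  using upt_add_eq_append[of i j "k - j"] by simp

text \<open>Unit columns for the degrees \<open>0..d\<close> enlarge the coefficient matrix to one with rows
for all degrees below \<open>N\<close>. Multiplying it by the matrix \<open>Q\<close> of evaluations at the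
roots of \<open>g\<close>, whose determinant is \<open>vand bs\<close> up to sign, turns
\<open>T\<^sup>i f\<close> into the values \<open>b\<^sup>i f(b)\<close>, while the multiples of
\<open>g\<close> vanish except for a unitriangular block of leading coefficients.\<close>

lemma eval_cofactor_det:
  fixes f :: "'a::idom poly" and bs :: "'a list"
  defines "n \<equiv> length bs" and "g \<equiv> root_poly bs"
  assumes d: "d < degree f" "d < n"
  shows "cdet (map (\<lambda>b i. if i \<le> d then b ^ i else poly f b * b ^ (i - d - 1)) bs @
      [\<lambda>i. if i \<le> d then 0 else \<xi> ^ (i - d - 1)]) =
    (-1) ^ (n - d - 1) * vand bs * cofactor_det d f g \<xi>"
proof -
  define m where "m = degree f"
  define N where "N = m + n - d"
  let ?t = "Suc N"
  have dg: "degree g = n" by (simp add: g_def n_def)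
  have dm: "d < m" using d by (simp add: m_def)
  have nN: "n < N" using dm by (simp add: N_def)
  \<comment> \<open>The rows of the matrix \<open>?Cs\<close> stand for the degrees \<open>0..d\<close>, the extra row \<open>Suc d\<close>, and the degrees \<open>d + 1..<N\<close>.\<close>
  define del where "del = delete_index (Suc d)"
  define C :: "'a poly \<Rightarrow> 'a \<Rightarrow> nat \<Rightarrow> nat \<Rightarrow> 'a" where "C = (\<lambda>h c i r. if r = Suc d then c else coeff (monom 1 i * h) (del r))"
  define CF where "CF = (\<lambda>i. C f (\<xi> ^ i) i)"
  define CG where "CG = (\<lambda>i. C g 0 i)"
  let ?Cs = "map unit_col [0..<Suc d] @ map CF [0..<n - d] @ map CG [0..<m - d]"
  have lenC: "length ?Cs = ?t" using d dm by (simp add: N_def)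
  \<comment> \<open>The unit columns split off the rows of the degrees \<open>0..d\<close>.\<close>
  have "cdet ?Cs = cdet (map unit_col [0..<Suc d] :: (nat \<Rightarrow> 'a) list) *
      cdet (map (\<lambda>v i. v (i + length (map unit_col [0..<Suc d] :: (nat \<Rightarrow> 'a) list)))
        (map CF [0..<n - d] @ map CG [0..<m - d]))"
    by (rule cdet_block_first) (auto simp: unit_col_def)
  also have "\<dots> = cofactor_det d f g \<xi>"
    unfolding cdet_unit_cols cofactor_det_def dg m_def[symmetric]
    by (auto intro!: cdet_cong simp: nth_append CF_def CG_def C_def del_def delete_index_def
        sylvester_col_def add.commute)
  finally have C1: "cdet ?Cs = cofactor_det d f g \<xi>" .
  \<comment> \<open>The rows of \<open>Q\<close>: evaluation at \<open>bs\<close>, the extra row, and the coefficients of the degrees \<open>n..<N\<close>.\<close>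
  define Q where "Q = (\<lambda>i r. if i < n then (if r = Suc d then 0 else (bs ! i) ^ del r)
    else if i = n then (if r = Suc d then 1 else 0) else (if r = i then 1 else (0::'a)))"
  let ?wcol = "\<lambda>q i. if i < n then (bs ! i) ^ q else 0"
  have cols: "map (\<lambda>r i. Q i r) [0..<?t] = map (\<lambda>r i. Q i r) [0..<Suc d] @
      (\<lambda>i. Q i (Suc d)) # map (\<lambda>r i. Q i r) [Suc (Suc d)..<Suc n] @ map (\<lambda>r i. Q i r) [Suc n..<?t]"
  proof -
    have "[0..<?t] = [0..<Suc d] @ [Suc d..<?t]"
      using nN d by (intro upt_split) simp_all
    also have "[Suc d..<?t] = Suc d # [Suc (Suc d)..<?t]"
      using nN d by (intro upt_conv_Cons) simp
    also have "[Suc (Suc d)..<?t] = [Suc (Suc d)..<Suc n] @ [Suc n..<?t]"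
      using nN d by (intro upt_split) simp_all
    finally show ?thesis by simp
  qed
  have "det (mat ?t ?t (\<lambda>(i, r). Q i r)) = cdet (map (\<lambda>r i. Q i r) [0..<?t])"
    unfolding cdet_def by (rule arg_cong[where f=det]) (rule eq_matI; simp del: upt_Suc)
  also have "\<dots> = (-1) ^ (n - d - 1) * cdet (map (\<lambda>r i. Q i r) [0..<Suc d] @
      map (\<lambda>r i. Q i r) [Suc (Suc d)..<Suc n] @ (\<lambda>i. Q i (Suc d)) # map (\<lambda>r i. Q i r) [Suc n..<?t])"
    unfolding cols cdet_move by (simp del: upt_Suc)
  also have "cdet (map (\<lambda>r i. Q i r) [0..<Suc d] @
      map (\<lambda>r i. Q i r) [Suc (Suc d)..<Suc n] @ (\<lambda>i. Q i (Suc d)) # map (\<lambda>r i. Q i r) [Suc n..<?t]) =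
      cdet (map ?wcol [0..<n] @ (\<lambda>i. Q i (Suc d)) # map (\<lambda>r i. Q i r) [Suc n..<?t])"
  proof (rule cdet_cong)
    show "length (map (\<lambda>r i. Q i r) [0..<Suc d] @
      map (\<lambda>r i. Q i r) [Suc (Suc d)..<Suc n] @ (\<lambda>i. Q i (Suc d)) # map (\<lambda>r i. Q i r) [Suc n..<?t]) =
      length (map ?wcol [0..<n] @ (\<lambda>i. Q i (Suc d)) # map (\<lambda>r i. Q i r) [Suc n..<?t])"
      using d by (simp del: upt_Suc)
    fix i j assume "j < length (map ?wcol [0..<n] @ (\<lambda>i. Q i (Suc d)) # map (\<lambda>r i. Q i r) [Suc n..<?t])"
    then have j: "j < ?t" using nN by (simp del: upt_Suc)
    consider "j < Suc d" | "Suc d \<le> j" "j < n" | "n \<le> j" by linarith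
    then show "((map (\<lambda>r i. Q i r) [0..<Suc d] @ map (\<lambda>r i. Q i r) [Suc (Suc d)..<Suc n] @
        (\<lambda>i. Q i (Suc d)) # map (\<lambda>r i. Q i r) [Suc n..<?t]) ! j) i =
      ((map ?wcol [0..<n] @ (\<lambda>i. Q i (Suc d)) # map (\<lambda>r i. Q i r) [Suc n..<?t]) ! j) i"
    proof cases
      case 1
      then show ?thesis using d
        by (simp add: nth_append Q_def del_def delete_index_def del: upt_Suc)
    next
      case 2
      then have "((map (\<lambda>r i. Q i r) [Suc (Suc d)..<Suc n]) ! (j - Suc d)) i = Q i (Suc j)"
        by (simp del: upt_Suc)
      with 2 show ?thesis using d
        by (simp add: nth_append Q_def del_def delete_index_def del: upt_Suc)
    next
      case 3
      then have "\<not> j - Suc d < n - Suc d" "j - Suc d - (n - Suc d) = j - n"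
        "\<not> j < Suc d" using d by simp_all
      with 3 show ?thesis by (simp add: nth_append del: upt_Suc)
    qed
  qed
  also have "\<dots> = cdet (map ?wcol [0..<n]) * cdet (map (\<lambda>v i. v (i + length (map ?wcol [0..<n])))
      ((\<lambda>i. Q i (Suc d)) # map (\<lambda>r i. Q i r) [Suc n..<?t]))"
    by (rule cdet_block_first) auto
  also have "cdet (map (\<lambda>v i. v (i + length (map ?wcol [0..<n])))
      ((\<lambda>i. Q i (Suc d)) # map (\<lambda>r i. Q i r) [Suc n..<?t])) =
      cdet (map unit_col [0..<?t - n] :: (nat \<Rightarrow> 'a) list)"
  proof (rule cdet_cong)
    fix i j assume "j < length (map unit_col [0..<?t - n] :: (nat \<Rightarrow> 'a) list)"
    then show "(map (\<lambda>v i. v (i + length (map ?wcol [0..<n])))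
        ((\<lambda>i. Q i (Suc d)) # map (\<lambda>r i. Q i r) [Suc n..<?t]) ! j) i = (map unit_col [0..<?t - n] ! j) i"
      using d by (cases j) (auto simp: Q_def unit_col_def simp del: upt_Suc)
  qed (use nN in \<open>simp del: upt_Suc\<close>)
  also have "\<dots> = 1" by (rule cdet_unit_cols)
  also have "cdet (map ?wcol [0..<n]) = cdet (map (\<lambda>i q. (bs ! i) ^ q) [0..<n])"
    unfolding cdet_transpose[of "\<lambda>i q. (bs ! i) ^ q" n, symmetric]
    by (rule cdet_cong) auto
  also have "map (\<lambda>i q. (bs ! i) ^ q) [0..<n] = map pw bs"
    by (rule nth_equalityI) (auto simp: n_def pw_def)
  also have "cdet (map pw bs) = vand bs" by (rule vandermonde)
  finally have E: "det (mat ?t ?t (\<lambda>(i, r). Q i r)) = (-1) ^ (n - d - 1) * vand bs" by simp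
  \<comment> \<open>The columns of the product: \<open>?us\<close> from the unit columns and the multiples of \<open>f\<close>, \<open>?vs\<close> from those of \<open>g\<close>.\<close>
  let ?us = "map ?wcol [0..<Suc d] @
    map (\<lambda>i' i. if i < n then (bs ! i) ^ i' * poly f (bs ! i) else if i = n then \<xi> ^ i' else
      coeff (monom 1 i' * f) (i - 1)) [0..<n - d]"
  let ?vs = "map (\<lambda>i' i. if i < Suc n then 0 else coeff (monom 1 i' * g) (i - 1)) [0..<m - d]"
  have QC: "(\<Sum>r<?t. Q i r * C h c i' r) =
      (if i < n then (bs ! i) ^ i' * poly h (bs ! i) else if i = n then c else coeff (monom 1 i' * h) (i - 1))"
    if i: "i < ?t" and deg: "degree h + i' < N" for h c i' i
  proof -
    consider "i < n" | "i = n" | "n < i" by linarith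
    then show ?thesis
    proof cases
      case 1
      then have "(\<Sum>r<?t. Q i r * C h c i' r) = (\<Sum>r<?t. if r = Suc d then 0 else
          (bs ! i) ^ delete_index (Suc d) r * coeff (monom 1 i' * h) (delete_index (Suc d) r))"
        by (intro sum.cong) (auto simp: Q_def C_def del_def)
      also have "\<dots> = (\<Sum>p<N. (bs ! i) ^ p * coeff (monom 1 i' * h) p)"
        using nN d by (subst sum_skip) auto
      also have "\<dots> = (bs ! i) ^ i' * poly h (bs ! i)"
        by (rule poly_monom_mult_sum[OF deg])
      finally show ?thesis using 1 by simp
    next
      case 2
      have "(\<Sum>r<?t. Q i r * C h c i' r) = Q i (Suc d) * C h c i' (Suc d)"
        using nN d 2 by (subst sum.remove[of _ "Suc d"]) (auto simp: Q_def intro!: sum.neutral)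
      with 2 show ?thesis by (simp add: Q_def C_def)
    next
      case 3
      have "(\<Sum>r<?t. Q i r * C h c i' r) = Q i i * C h c i' i"
        using i 3 by (subst sum.remove[of _ i]) (auto simp: Q_def intro!: sum.neutral)
      with 3 d show ?thesis by (simp add: Q_def C_def del_def delete_index_def)
    qed
  qed
  have QU: "(\<Sum>r<?t. Q i r * unit_col q r) = ?wcol q i" if "i < ?t" "q < Suc d" for i q
  proof -
    have "(\<Sum>r<?t. Q i r * unit_col q r) = Q i q * unit_col q q"
      using that nN d by (subst sum.remove[of _ q]) (auto simp: unit_col_def intro!: sum.neutral)
    then show ?thesis using that d by (auto simp: Q_def del_def delete_index_def unit_col_def)
  qed
  have "cdet (?us @ ?vs) = cdet (map (\<lambda>v i. \<Sum>k<length ?Cs. Q i k * v k) ?Cs)"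
  proof (rule cdet_cong)
    fix i j assume "i < length (map (\<lambda>v i. \<Sum>k<length ?Cs. Q i k * v k) ?Cs)"
      "j < length (map (\<lambda>v i. \<Sum>k<length ?Cs. Q i k * v k) ?Cs)"
    then have i: "i < ?t" and j: "j < ?t" using lenC by simp_all
    have base: "(map (\<lambda>v i. \<Sum>k<length ?Cs. Q i k * v k) ?Cs ! j) i = (\<Sum>k<?t. Q i k * (?Cs ! j) k)"
      using j lenC by (simp only: nth_map)
    consider "j < Suc d" | "Suc d \<le> j" "j < Suc n" | "Suc n \<le> j" by linarith
    then show "((?us @ ?vs) ! j) i = (map (\<lambda>v i. \<Sum>k<length ?Cs. Q i k * v k) ?Cs ! j) i"
    proof cases
      case 1
      have "(map (\<lambda>v i. \<Sum>k<length ?Cs. Q i k * v k) ?Cs ! j) i = (\<Sum>k<?t. Q i k * unit_col j k)"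
        using 1 unfolding base by (simp add: nth_append del: upt_Suc sum.lessThan_Suc)
      also have "\<dots> = ?wcol j i" by (rule QU[OF i 1])
      finally show ?thesis using 1 by (simp add: nth_append del: upt_Suc)
    next
      case 2
      then have jn: "j - Suc d < n - d" "\<not> j < Suc d" using d by simp_all
      have "(map (\<lambda>v i. \<Sum>k<length ?Cs. Q i k * v k) ?Cs ! j) i =
          (\<Sum>k<?t. Q i k * C f (\<xi> ^ (j - Suc d)) (j - Suc d) k)"
        using jn unfolding base by (simp add: nth_append CF_def del: upt_Suc sum.lessThan_Suc)
      also note QC[OF i, of f "j - Suc d"]
      finally show ?thesis using 2 d dm jn by (simp add: nth_append N_def m_def del: upt_Suc)
    next
      case 3
      have ix: "j - Suc d - (n - d) = j - Suc n" using d by simp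
      have jm: "j - Suc n < m - d" using j 3 by (simp add: N_def)
      have root: "poly g (bs ! i) = 0" if "i < n"
        using that by (auto simp: g_def n_def poly_root_poly intro: prod_list_zero_map)
      have "(map (\<lambda>v i. \<Sum>k<length ?Cs. Q i k * v k) ?Cs ! j) i =
          (\<Sum>k<?t. Q i k * C g 0 (j - Suc n) k)"
        using 3 d jm unfolding base by (simp add: nth_append CG_def ix del: upt_Suc sum.lessThan_Suc)
      also note QC[OF i, of g "j - Suc n"]
      finally show ?thesis using 3 d dm jm root ix
        by (auto simp: nth_append N_def dg simp del: upt_Suc)
    qed
  qed (use d dm in \<open>simp add: N_def\<close>)
  also have "\<dots> = (-1) ^ (n - d - 1) * vand bs * cofactor_det d f g \<xi>"
    unfolding cdet_row_operation unfolding lenC E C1 ..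
  finally have prod: "cdet (?us @ ?vs) = (-1) ^ (n - d - 1) * vand bs * cofactor_det d f g \<xi>" .
  have "cdet (?us @ ?vs) = cdet ?us * cdet (map (\<lambda>v i. v (i + length ?us)) ?vs)"
    by (rule cdet_block_last) (use d in \<open>auto simp del: upt_Suc\<close>)
  also have "cdet (map (\<lambda>v i. v (i + length ?us)) ?vs) = 1"
  proof -
    let ?U = "mat (m - d) (m - d) (\<lambda>(i, j). coeff (monom 1 j * g) (i + n))"
    have "cdet (map (\<lambda>v i. v (i + length ?us)) ?vs) = det ?U"
      unfolding cdet_def using d
      by (intro arg_cong[where f=det]) (rule eq_matI; simp del: upt_Suc)
    also have "\<dots> = prod_list (diag_mat ?U)"
      by (rule det_upper_triangular[of _ "m - d"])
        (auto simp: coeff_monom_mult_1 dg coeff_eq_0 intro!: upper_triangularI)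
    also have "diag_mat ?U = replicate (m - d) 1"
      using lead_coeff_root_poly[of bs]
      by (auto simp: diag_mat_def coeff_monom_mult_1 g_def n_def intro!: nth_equalityI)
    finally show ?thesis by simp
  qed
  also have "cdet ?us = cdet (map (\<lambda>j i. if j \<le> d then ?wcol j i else
      if i < n then (bs ! i) ^ (j - Suc d) * poly f (bs ! i) else \<xi> ^ (j - Suc d)) [0..<Suc n])"
    by (rule cdet_cong) (use d in \<open>auto simp: nth_append simp del: upt_Suc\<close>)
  also have "\<dots> = cdet (map (\<lambda>i j. if j \<le> d then ?wcol j i else
      if i < n then (bs ! i) ^ (j - Suc d) * poly f (bs ! i) else \<xi> ^ (j - Suc d)) [0..<Suc n])"
    by (rule cdet_transpose)
  also have "\<dots> = cdet (map (\<lambda>b i. if i \<le> d then b ^ i else poly f b * b ^ (i - d - 1)) bs @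
      [\<lambda>i. if i \<le> d then 0 else \<xi> ^ (i - d - 1)])"
    by (rule cdet_cong) (auto simp: nth_append n_def mult.commute less_Suc_eq simp del: upt_Suc)
  finally show ?thesis using prod by simp
qed

section \<open>Expansion of columns lying in several blocks\<close>

lemma cdet_absorb:
  assumes "w \<in> set us"
  shows "cdet (us @ (\<lambda>i. u i + w i) # vs) = cdet (us @ u # vs)"
proof -
  obtain j where "j < length us" "us ! j = w" using assms by (auto simp: in_set_conv_nth)
  then have "cdet (us @ w # vs) = 0"
    by (intro cdet_repeat[of j _ "length us"]) (auto simp: nth_append)
  then show ?thesis by (simp add: cdet_add)
qed

lemma cdet_absorb_map:
  assumes "\<And>x. x \<in> set xs \<Longrightarrow> q x \<in> set us"
  shows "cdet (us @ map (\<lambda>x i. p x i + q x i) xs @ vs) = cdet (us @ map p xs @ vs)"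
  using assms
proof (induction xs arbitrary: us)
  case (Cons x xs)
  have "cdet (us @ map (\<lambda>x i. p x i + q x i) (x # xs) @ vs) =
      cdet (us @ p x # map (\<lambda>x i. p x i + q x i) xs @ vs)"
    using Cons.prems by (simp add: cdet_absorb)
  also have "\<dots> = cdet (us @ p x # map p xs @ vs)"
    using Cons.IH[of "us @ [p x]"] Cons.prems by simp
  finally show ?case by simp
qed simp

lemma cdet_absorb_span:
  "cdet (us @ map (\<lambda>b i. p b i + (\<Sum>q<M. c b q * T q i)) bs @ ws @ map T [0..<M]) =
    cdet (us @ map p bs @ ws @ map T [0..<M])"
proof (induction bs arbitrary: us)
  case (Cons b bs)
  let ?r = "map (\<lambda>b i. p b i + (\<Sum>q<M. c b q * T q i)) bs @ ws @ map T [0..<M]"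
  have zero: "cdet (us @ T q # ?r) = 0" if "q < M" for q
  proof (rule cdet_repeat[of "length us" _ "length us + 1 + length bs + length ws + q"])
    show "(us @ T q # ?r) ! length us =
      (us @ T q # ?r) ! (length us + 1 + length bs + length ws + q)"
      using that by (simp add: nth_append)
  qed (use that in auto)
  have "cdet (us @ (\<lambda>i. p b i + (\<Sum>q<M. c b q * T q i)) # ?r) =
      cdet (us @ p b # ?r) + (\<Sum>q<M. c b q * cdet (us @ T q # ?r))"
    by (simp only: cdet_add cdet_sum)
  also have "(\<Sum>q<M. c b q * cdet (us @ T q # ?r)) = 0"
    by (intro sum.neutral) (simp add: zero)
  finally show ?case using Cons.IH[of "us @ [p b]"] by simp
qed simp

lemma sum_Pow_insert:
  assumes "finite Y" "y \<notin> Y"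
  shows "(\<Sum>I\<in>Pow (insert y Y). h I) = (\<Sum>I\<in>Pow Y. h (insert y I)) + (\<Sum>I\<in>Pow Y. h I :: 'a::comm_monoid_add)"
proof -
  have "Pow (insert y Y) = insert y ` Pow Y \<union> Pow Y" by (auto simp: Pow_insert)
  moreover have "insert y ` Pow Y \<inter> Pow Y = {}" using assms(2) by auto
  moreover have "inj_on (insert y) (Pow Y)" using assms(2) by (fastforce simp: inj_on_def)
  ultimately show ?thesis using assms(1)
    by (simp add: sum.union_disjoint sum.reindex)
qed

text \<open>Multilinearity in the columns indexed by \<open>Y\<close>. The other columns \<open>s x\<close>
are carried along since they change in the induction on \<open>Y\<close>, and since \<open>cdet_split3\<close>
expands the columns in two rounds.\<close>

lemma cdet_choice:
  assumes "distinct xs" "finite Y" "Y \<subseteq> set xs"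
  shows "cdet (us @ map (\<lambda>x. if x \<in> Y then (\<lambda>i. p x i + q x i) else s x) xs @ vs) =
    (\<Sum>I\<in>Pow Y. cdet (us @ map (\<lambda>x. if x \<in> Y then if x \<in> I then p x else q x else s x) xs @ vs))"
  using assms(2,3)
proof (induction Y arbitrary: s rule: finite_induct)
  case (insert y Y)
  obtain ps qs where xs: "xs = ps @ y # qs" using insert.prems by (auto dest: split_list)
  have y: "y \<notin> set ps" "y \<notin> set qs" using assms(1) by (auto simp: xs)
  let ?h = "\<lambda>s x. if x \<in> Y then (\<lambda>i. p x i + q x i) else s x"
  have upd: "map (?h (s(y := c))) xs = map (?h s) ps @ c # map (?h s) qs" for c
    using y insert.hyps(2) by (auto simp: xs)
  have "cdet (us @ map (\<lambda>x. if x \<in> insert y Y then (\<lambda>i. p x i + q x i) else s x) xs @ vs) =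
      cdet ((us @ map (?h s) ps) @ (\<lambda>i. p y i + q y i) # map (?h s) qs @ vs)"
    using y by (auto simp: xs intro!: arg_cong[where f=cdet])
  also have "\<dots> = cdet (us @ map (?h (s(y := p y))) xs @ vs) + cdet (us @ map (?h (s(y := q y))) xs @ vs)"
    unfolding cdet_add upd by simp
  also have "cdet (us @ map (?h (s(y := p y))) xs @ vs) = (\<Sum>I\<in>Pow Y.
      cdet (us @ map (\<lambda>x. if x \<in> insert y Y then if x \<in> insert y I then p x else q x else s x) xs @ vs))"
    using insert by (subst insert.IH) (auto intro!: sum.cong arg_cong[where f=cdet] map_cong)
  also have "cdet (us @ map (?h (s(y := q y))) xs @ vs) = (\<Sum>I\<in>Pow Y.
      cdet (us @ map (\<lambda>x. if x \<in> insert y Y then if x \<in> I then p x else q x else s x) xs @ vs))"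
    using insert by (subst insert.IH) (auto intro!: sum.cong arg_cong[where f=cdet] map_cong)
  finally show ?case
    unfolding sum_Pow_insert[OF insert.hyps(1,2)] .
qed simp

abbreviation sl :: "int set \<Rightarrow> int list" where
  "sl \<equiv> sorted_list_of_set"

lemma cdet_split2:
  "cdet (us @ map (\<lambda>x i. p x i + q x i) [1..k] @ vs) =
    (\<Sum>I\<in>Pow {1..k}. of_int (sg I ({1..k} - I) {}) *
      cdet (us @ map p (sl I) @ map q (sl ({1..k} - I)) @ vs))"
proof -
  have "cdet (us @ map (\<lambda>x i. p x i + q x i) [1..k] @ vs) =
      cdet (us @ map (\<lambda>x. if x \<in> {1..k} then (\<lambda>i. p x i + q x i) else p x) [1..k] @ vs)"
    by (intro arg_cong[where f=cdet]) simp
  also have "\<dots> = (\<Sum>I\<in>Pow {1..k}.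
      cdet (us @ map (\<lambda>x. if x \<in> {1..k} then if x \<in> I then p x else q x else p x) [1..k] @ vs))"
    by (rule cdet_choice) auto
  also have "\<dots> = (\<Sum>I\<in>Pow {1..k}. of_int (sg I ({1..k} - I) {}) *
      cdet (us @ map p (sl I) @ map q (sl ({1..k} - I)) @ vs))"
  proof (intro sum.cong refl)
    fix I assume "I \<in> Pow {1..k}"
    then have I: "I \<subseteq> {1..k}" by simp
    then have fin: "finite I" by (rule finite_subset) simp
    let ?h = "\<lambda>x. if x \<in> {1..k} then if x \<in> I then p x else q x else p x"
    have "cdet (us @ map ?h [1..k] @ vs) = of_int (sg I ({1..k} - I) {}) *
        cdet (us @ map ?h (sl I @ sl ({1..k} - I) @ sl {}) @ vs)"
      by (rule cdet_sort) (use I in auto)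
    also have "map ?h (sl I @ sl ({1..k} - I) @ sl {}) = map p (sl I) @ map q (sl ({1..k} - I))"
      using I fin by auto
    finally show "cdet (us @ map ?h [1..k] @ vs) = of_int (sg I ({1..k} - I) {}) *
        cdet (us @ map p (sl I) @ map q (sl ({1..k} - I)) @ vs)"
      by (simp only: append_assoc)
  qed
  finally show ?thesis .
qed

definition partitions3 :: "int \<Rightarrow> (int set \<times> int set \<times> int set) set" where
  "partitions3 k = {(R1, R2, R3). R1 \<union> R2 \<union> R3 = {1..k} \<and> R1 \<inter> R2 = {} \<and> R1 \<inter> R3 = {} \<and> R2 \<inter> R3 = {}}"

lemma partitions3D:
  assumes "(R1, R2, R3) \<in> partitions3 k"
  shows "R1 \<union> R2 \<union> R3 = {1..k}" "R1 \<inter> R2 = {}" "R1 \<inter> R3 = {}" "R2 \<inter> R3 = {}"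
    "finite R1" "finite R2" "finite R3"
proof -
  show R: "R1 \<union> R2 \<union> R3 = {1..k}" "R1 \<inter> R2 = {}" "R1 \<inter> R3 = {}" "R2 \<inter> R3 = {}"
    using assms by (auto simp: partitions3_def)
  show "finite R1" "finite R2" "finite R3"
    using R(1) by (metis finite_Un finite_atLeastAtMost_int)+
qed

lemma partitions3_card:
  assumes "(R1, R2, R3) \<in> partitions3 (int k)"
  shows "card R1 + card R2 + card R3 = k"
proof -
  note R = partitions3D[OF assms]
  have "card (R1 \<union> R2 \<union> R3) = card R1 + card R2 + card R3"
    using R(2-7) by (subst card_Un_disjoint, simp, simp, blast)+ simp
  then show ?thesis using R(1) by simp
qed

lemma cdet_split3:
  "cdet (us @ map (\<lambda>x i. p x i + (q x i + r x i)) [1..k] @ vs) =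
    (\<Sum>(R1, R2, R3)\<in>partitions3 k. of_int (sg R1 R2 R3) *
      cdet (us @ map p (sl R1) @ map q (sl R2) @ map r (sl R3) @ vs))"
proof -
  let ?h = "\<lambda>R1 R2 x. if x \<in> R1 then p x else if x \<in> R2 then q x else r x"
  let ?t = "\<lambda>R1 R2. cdet (us @ map (?h R1 R2) [1..k] @ vs)"
  have "cdet (us @ map (\<lambda>x i. p x i + (q x i + r x i)) [1..k] @ vs) =
      cdet (us @ map (\<lambda>x. if x \<in> {1..k} then (\<lambda>i. p x i + (q x i + r x i)) else p x) [1..k] @ vs)"
    by (intro arg_cong[where f=cdet]) simp
  also have "\<dots> = (\<Sum>R1\<in>Pow {1..k}.
      cdet (us @ map (\<lambda>x. if x \<in> {1..k} then if x \<in> R1 then p x else (\<lambda>i. q x i + r x i) else p x) [1..k] @ vs))"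
    by (rule cdet_choice) auto
  also have "\<dots> = (\<Sum>R1\<in>Pow {1..k}. \<Sum>R2\<in>Pow ({1..k} - R1). ?t R1 R2)"
  proof (intro sum.cong refl)
    fix R1 assume "R1 \<in> Pow {1..k}"
    have "cdet (us @ map (\<lambda>x. if x \<in> {1..k} then if x \<in> R1 then p x else (\<lambda>i. q x i + r x i) else p x) [1..k] @ vs) =
      cdet (us @ map (\<lambda>x. if x \<in> {1..k} - R1 then (\<lambda>i. q x i + r x i) else p x) [1..k] @ vs)"
      by (intro arg_cong[where f=cdet]) simp
    also have "\<dots> = (\<Sum>R2\<in>Pow ({1..k} - R1).
      cdet (us @ map (\<lambda>x. if x \<in> {1..k} - R1 then if x \<in> R2 then q x else r x else p x) [1..k] @ vs))"
      by (rule cdet_choice) auto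
    also have "\<dots> = (\<Sum>R2\<in>Pow ({1..k} - R1). ?t R1 R2)"
      by (intro sum.cong refl arg_cong[where f=cdet]) auto
    finally show "cdet (us @ map (\<lambda>x. if x \<in> {1..k} then if x \<in> R1 then p x else (\<lambda>i. q x i + r x i) else p x) [1..k] @ vs) =
      (\<Sum>R2\<in>Pow ({1..k} - R1). ?t R1 R2)" .
  qed
  also have "\<dots> = (\<Sum>(R1, R2)\<in>(SIGMA R1:Pow {1..k}. Pow ({1..k} - R1)). ?t R1 R2)"
    by (rule sum.Sigma) auto
  also have "\<dots> = (\<Sum>(R1, R2, R3)\<in>partitions3 k. ?t R1 R2)"
    by (rule sum.reindex_bij_witness[of _ "\<lambda>(R1, R2, R3). (R1, R2)" "\<lambda>(R1, R2). (R1, R2, {1..k} - R1 - R2)"])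
      (auto simp: partitions3_def)
  also have "\<dots> = (\<Sum>(R1, R2, R3)\<in>partitions3 k. of_int (sg R1 R2 R3) *
      cdet (us @ map p (sl R1) @ map q (sl R2) @ map r (sl R3) @ vs))"
  proof (intro sum.cong refl, clarify)
    fix R1 R2 R3 assume R: "(R1, R2, R3) \<in> partitions3 k"
    note R' = partitions3D[OF R]
    have "?t R1 R2 = of_int (sg R1 R2 R3) *
        cdet (us @ map (?h R1 R2) (sl R1 @ sl R2 @ sl R3) @ vs)"
      by (rule cdet_sort[OF R'(1-4)])
    also have "map (?h R1 R2) (sl R1 @ sl R2 @ sl R3) = map p (sl R1) @ map q (sl R2) @ map r (sl R3)"
      using R' by auto
    finally show "?t R1 R2 = of_int (sg R1 R2 R3) *
        cdet (us @ map p (sl R1) @ map q (sl R2) @ map r (sl R3) @ vs)"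
      by (simp only: append_assoc)
  qed
  finally show ?thesis .
qed

section \<open>Vandermonde determinants with unit columns\<close>

text \<open>Cancelling \<open>det V\<close> must happen among the integer polynomials, where it is
nonzero.\<close>

lemma schur_full:
  fixes X :: "'a::idom multiset"
  assumes "int (size X) = k"
  shows "schur k {} X = 1"
proof -
  let ?D = "det (vandermonde_minor k {} (size X))"
  have id: "comm_ring_hom (\<lambda>P::int_mpoly. P)" by unfold_locales auto
  have "?D = reversal_sign (size X) * vand (map indet [0..<size X])"
    using det_vandermonde_full[OF id, of "size X"] by (simp add: assms)
  moreover have "vand (map indet [0..<size X]) \<noteq> 0"
    by (rule vand_nonzero) (auto simp: distinct_map inj_on_def indet_inject)
  ultimately have "?D \<noteq> 0" using reversal_sign_nonzero by simp
  moreover have "schur_poly k {} (size X) * ?D = ?D"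
    using schur_poly_quotient[of k "{}" "size X"] assms by auto
  ultimately have "schur_poly k {} (size X) = 1" by simp
  then show ?thesis by (simp add: schur_def mpoly_value_1)
qed

text \<open>The sign of the expansion of a determinant with \<open>k\<close> rows along unit columns, see
\<open>cdet_unit_cols_minor\<close>.\<close>

definition units_sign :: "nat \<Rightarrow> nat list \<Rightarrow> 'a::comm_ring_1" where
  "units_sign k ps = (\<Prod>p\<leftarrow>ps. (-1) ^ (Suc k + p))"

text \<open>Expanding along the unit columns deletes exactly the rows in \<open>R\<close> from
\<open>V\<^sub>k\<close>.\<close>

lemma cdet_vandermonde_units:
  fixes xs :: "'a::idom list"
  assumes R: "R \<subseteq> {1..int k}" and len: "length xs + card R = k"
  shows "cdet (map pw xs @ map (\<lambda>l. unit_col (nat (int k - l))) (sl R)) =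
    units_sign k (map (\<lambda>l. nat (int k - l)) (sl R)) * (schur (int k) R (mset xs) * vand xs)"
proof -
  have fin: "finite R" using R by (rule finite_subset) simp
  let ?ps = "map (\<lambda>l. nat (int k - l)) (sl R)" and ?rs = "kept_rows (int k) R"
  have set_sl: "set (sl R) = R" using fin by simp
  have strict: "sorted_wrt (<) (sl S)" for S :: "int set"
    by (simp add: strict_sorted_iff)
  have ps: "sorted_wrt (>) ?ps"
    unfolding sorted_wrt_map
    by (rule sorted_wrt_mono_rel[OF _ strict]) (use R set_sl in auto)
  have rs: "sorted_wrt (<) ?rs"
    unfolding kept_rows_def sorted_wrt_map sorted_wrt_rev
    by (rule sorted_wrt_mono_rel[OF _ strict]) auto
  have setrs: "set ?rs = (\<lambda>l. nat (int k - l)) ` ({1..int k} - R)"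
    by (simp add: kept_rows_def)
  have setps: "set ?ps = (\<lambda>l. nat (int k - l)) ` R" by (simp add: set_sl)
  have un: "set ?rs \<union> set ?ps = {..<k}"
  proof -
    have "set ?rs \<union> set ?ps = (\<lambda>l. nat (int k - l)) ` {1..int k}"
      unfolding setrs setps using R by (auto simp flip: image_Un simp: Un_absorb2)
    also have "\<dots> = {..<k}"
    proof (intro equalityI subsetI)
      fix x assume "x \<in> {..<k}"
      then show "x \<in> (\<lambda>l. nat (int k - l)) ` {1..int k}"
        by (intro image_eqI[of _ _ "int k - int x"]) auto
    qed auto
    finally show ?thesis .
  qed
  have inter: "set ?rs \<inter> set ?ps = {}"
  proof -
    have "inj_on (\<lambda>l. nat (int k - l)) {1..int k}" by (auto simp: inj_on_def)
    then show ?thesis unfolding setrs setps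
      using R by (subst inj_on_image_Int[symmetric]) auto
  qed
  have "cdet (map pw xs @ map unit_col ?ps) =
      (\<Prod>p\<leftarrow>?ps. (-1) ^ (Suc k + p)) * cdet (map (\<lambda>u i. u (?rs ! i)) (map pw xs))"
    by (rule cdet_unit_cols_minor[OF ps rs un inter]) (use len in simp)
  also have "map (\<lambda>u i. u (?rs ! i)) (map pw xs) = map (\<lambda>x i. x ^ (?rs ! i)) xs"
    by (simp add: pw_def)
  also have "cdet \<dots> = schur (int k) R (mset xs) * vand xs"
    by (rule schur_times_vand[symmetric]) (use R fin len in \<open>simp add: card_Diff_subset\<close>)
  finally show ?thesis by (simp add: units_sign_def o_def)
qed

section \<open>The three-block determinant\<close>

text \<open>After transposition this is an exchange of two groups of columns.\<close>

lemma cdet_rotate_rows: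
  assumes "length vs = a + b"
  shows "cdet (map (\<lambda>v i. if i < a then v (i + b) else v (i - a)) vs) = (-1) ^ (a * b) * cdet vs"
proof -
  let ?\<rho> = "\<lambda>i. if i < a then i + b else i - a"
  let ?R = "\<lambda>p j. (vs ! j) p"
  have "cdet (map (\<lambda>v i. if i < a then v (i + b) else v (i - a)) vs) =
      cdet (map (\<lambda>j i. (vs ! j) (?\<rho> i)) [0..<a + b])"
    by (rule cdet_cong) (auto simp: assms)
  also have "\<dots> = cdet (map (\<lambda>i j. (vs ! j) (?\<rho> i)) [0..<a + b])"
    by (rule cdet_transpose)
  also have "\<dots> = cdet (map ?R [b..<b + a] @ map ?R [0..<b])"
    by (rule cdet_cong) (auto simp: nth_append add.commute)
  also have "\<dots> = (-1) ^ (a * b) * cdet (map ?R [0..<b] @ map ?R [b..<b + a])"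
    using cdet_exchange[of "[]" "map ?R [b..<b + a]" "map ?R [0..<b]" "[]"] by simp
  also have "map ?R [0..<b] @ map ?R [b..<b + a] = map (\<lambda>i j. (vs ! j) i) [0..<b + a]"
    using upt_add_eq_append[of 0 b a] by simp
  also have "cdet \<dots> = cdet (map (\<lambda>j i. (vs ! j) i) [0..<b + a])"
    by (rule cdet_transpose[symmetric])
  also have "\<dots> = cdet vs"
    by (rule cdet_cong) (auto simp: assms)
  finally show ?thesis .
qed

lemma cdet_cong_map:
  assumes "\<And>x i. x \<in> set xs \<Longrightarrow> i < length us + length xs + length vs \<Longrightarrow> p x i = q x i"
  shows "cdet (us @ map p xs @ vs) = cdet (us @ map q xs @ vs)"
  by (rule cdet_cong) (auto simp: nth_append assms)

text \<open>This sorts the columns by the block in which they lie. The exponent counts the crossings of groups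
of columns.\<close>

lemma cdet_rearrange:
  "cdet (A @ B @ [x] @ P @ Q @ S @ U @ R1 @ R2 @ R3) =
    (-1) ^ (length B + (length B + length P + length Q + length S) * length U +
      (length B + length P + length Q + length S + length R1) * length R2 +
      length B * length P + (length B + length Q) * (length S + length R1)) *
    cdet ((A @ [x] @ U @ R2) @ (P @ S @ R1) @ (B @ Q @ R3))"
  using cdet_exchange[of A B "[x]" "P @ Q @ S @ U @ R1 @ R2 @ R3"]
    cdet_exchange[of "A @ [x]" "B @ P @ Q @ S" U "R1 @ R2 @ R3"]
    cdet_exchange[of "A @ [x] @ U" "B @ P @ Q @ S @ R1" R2 R3]
    cdet_exchange[of "A @ [x] @ U @ R2" B P "Q @ S @ R1 @ R3"]
    cdet_exchange[of "A @ [x] @ U @ R2 @ P" "B @ Q" "S @ R1" R3]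
  by (simp add: power_add add_mult_distrib add_mult_distrib2 mult.assoc add.assoc)

lemma sl_shift: "finite S \<Longrightarrow> sl ((\<lambda>l. l - c) ` S) = map (\<lambda>l. l - c) (sl S)"
proof -
  assume fin: "finite S"
  have "sorted_wrt (<) (sl S)" by (simp add: strict_sorted_iff)
  then have "sorted_wrt (<) (map (\<lambda>l. l - c) (sl S))"
    unfolding sorted_wrt_map by (rule sorted_wrt_mono_rel[rotated]) auto
  then have "sorted (map (\<lambda>l. l - c) (sl S))" "distinct (map (\<lambda>l. l - c) (sl S))"
    by (simp_all only: strict_sorted_iff)
  then show ?thesis
    by (intro sorted_distinct_set_unique) (use fin in auto)
qed

text \<open>The nodes \<open>\<alpha> 1, \<dots>, \<alpha> m\<close> are the roots of \<open>f\<close>, the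
first \<open>mb\<close> of them form \<open>Abar\<close>; likewise \<open>\<beta>\<close>, \<open>n\<close>,
\<open>nb\<close> for \<open>g\<close> and \<open>Bbar\<close>. Subsets of \<open>Abar\<close> and
\<open>Bbar\<close> become sets of indices.\<close>

locale sylvester_blocks =
  fixes \<alpha> \<beta> :: "int \<Rightarrow> 'a::idom" and \<xi> :: 'a and m n mb nb d :: nat
  assumes d: "d < m" "d < n" and mb: "mb \<le> m" and nb: "nb \<le> n"
begin

definition N :: nat where "N = m + n - d"

text \<open>The number of unit columns that complete the columns of \<open>Abar\<close> and
\<open>Bbar\<close> to \<open>N\<close> columns. By truncated subtraction it is 0 if there are more than
\<open>N\<close> of them already; then the third block gets \<open>M > N\<close> rows.\<close>

definition k :: nat where "k = N - (mb + nb)"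
definition M :: nat where "M = mb + nb + k"

text \<open>The rows are ordered as block 2, block 1, block 3, so that after row operations with
\<open>f\<close> the columns of its roots occupy the top left corner.\<close>

definition in2 :: "(nat \<Rightarrow> 'a) \<Rightarrow> nat \<Rightarrow> 'a" where
  "in2 v = (\<lambda>i. if i < N then v i else 0)"
definition in1 :: "(nat \<Rightarrow> 'a) \<Rightarrow> nat \<Rightarrow> 'a" where
  "in1 v = (\<lambda>i. if N \<le> i \<and> i < N + Suc d then v (i - N) else 0)"
definition in3 :: "(nat \<Rightarrow> 'a) \<Rightarrow> nat \<Rightarrow> 'a" where
  "in3 v = (\<lambda>i. if N + Suc d \<le> i then v (i - (N + Suc d)) else 0)"
definition diag :: "(nat \<Rightarrow> 'a) \<Rightarrow> nat \<Rightarrow> 'a" where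
  "diag v = (\<lambda>i. in1 v i + (in2 v i + in3 v i))"

definition ecol :: "int \<Rightarrow> nat \<Rightarrow> 'a" where
  "ecol l = unit_col (nat (int N - l))"

abbreviation (input) "pa i \<equiv> pw (\<alpha> i)"
abbreviation (input) "pb j \<equiv> pw (\<beta> j)"

definition roots_f :: "'a list" where "roots_f = map \<alpha> [1..int m]"
definition roots_g :: "'a list" where "roots_g = map \<beta> [1..int n]"

definition W :: "(nat \<Rightarrow> 'a) list" where
  "W = map pa [1..int mb] @ map pb [1..int nb] @ map ecol [1..int k]"

definition block_det :: 'a where
  "block_det = cdet (map (\<lambda>i. in2 (pa i)) [1..int m] @ map (\<lambda>j. in3 (pb j)) [1..int n] @
     [in2 (pw \<xi>)] @ map diag W)"

text \<open>The sign of the expansion along the unit columns \<open>ecol l\<close> for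
\<open>l \<in> R\<close>.\<close>

definition E :: "int set \<Rightarrow> 'a" where
  "E R = (\<Prod>l\<in>R. (-1) ^ (Suc N + nat (int N - l)))"

lemma sizes: "N + d = m + n" "m < N" "n < N" "N \<le> M" "Suc d \<le> M" "length W = M"
  "k > 0 \<Longrightarrow> M = N" "k > 0 \<Longrightarrow> mb + nb + k = N"
  using d by (auto simp: N_def M_def k_def W_def)

lemma E_square: "E R * E R = 1"
  unfolding E_def prod.distrib[symmetric]
  by (simp flip: power_add)

lemma E_union: "finite R \<Longrightarrow> finite S \<Longrightarrow> R \<inter> S = {} \<Longrightarrow> E (R \<union> S) = E R * E S"
  unfolding E_def by (rule prod.union_disjoint)

lemma units_sign_E: "finite R \<Longrightarrow> units_sign N (map (\<lambda>l. nat (int N - l)) (sl R)) = E R"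
  unfolding units_sign_def E_def
  by (simp add: o_def prod.distinct_set_conv_list[symmetric])

lemma cdet_W: "cdet W = E {1..int k} * vand (map \<alpha> [1..int mb] @ map \<beta> [1..int nb])"
proof -
  let ?xs = "map \<alpha> [1..int mb] @ map \<beta> [1..int nb]" and ?ps = "map (\<lambda>l. nat (int N - l)) [1..int k]"
  have W: "W = map pw ?xs @ map unit_col ?ps"
    by (simp add: W_def ecol_def o_def)
  have set: "set [0..<mb + nb] \<union> set ?ps = {..<M} \<and> set [0..<mb + nb] \<inter> set ?ps = {}"
  proof (cases "k = 0")
    case True then show ?thesis by (auto simp: M_def)
  next
    case False
    then have s: "M = N" "mb + nb + k = N" using sizes by auto
    have "set ?ps = {mb + nb..<N}"
    proof (intro equalityI subsetI)
      fix x assume "x \<in> {mb + nb..<N}"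
      then show "x \<in> set ?ps" using s
        by (auto intro!: image_eqI[of _ _ "int N - int x"])
    qed (use s in auto)
    then show ?thesis using s by auto
  qed
  have "cdet W = (\<Prod>p\<leftarrow>?ps. (-1) ^ (Suc M + p)) *
      cdet (map (\<lambda>u i. u ([0..<mb + nb] ! i)) (map pw ?xs))"
    unfolding W
  proof (rule cdet_unit_cols_minor)
    show "sorted_wrt (>) ?ps"
    proof (cases "k = 0")
      case False
      then have kN: "k \<le> N" using sizes by linarith
      have strict: "sorted_wrt (<) [1..int k]" by (simp add: strict_sorted_iff)
      show ?thesis
        unfolding sorted_wrt_map
        by (rule sorted_wrt_mono_rel[OF _ strict]) (use kN in auto)
    qed simp
  qed (use set in \<open>auto simp: M_def\<close>)
  also have "cdet (map (\<lambda>u i. u ([0..<mb + nb] ! i)) (map pw ?xs)) = cdet (map pw ?xs)"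
  proof -
    have "cdet (map (\<lambda>u i. u ([0..<length xs] ! i)) (map pw xs)) = cdet (map pw xs)"
      for xs :: "'a list" by (rule cdet_cong) auto
    from this[of ?xs] show ?thesis by simp
  qed
  also have "(\<Prod>p\<leftarrow>?ps. (-1) ^ (Suc M + p)) = E {1..int k}"
  proof (cases "k = 0")
    case False
    then show ?thesis using sizes(7) units_sign_E[of "{1..int k}"]
      by (simp add: units_sign_def sorted_list_of_set_int)
  qed (simp add: E_def)
  finally show ?thesis by (simp only: vandermonde)
qed

lemma diag_combination:
  assumes "i < N + Suc d + M"
  shows "diag v i = (\<Sum>q<M. v q * diag (unit_col q) i)"
proof -
  have pick: "(\<Sum>q<M. v q * unit_col q j) = v j" if "j < M" for j
    using that by (subst sum.remove[of _ j]) (auto simp: unit_col_def intro!: sum.neutral)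
  consider "i < N" | "N \<le> i" "i < N + Suc d" | "N + Suc d \<le> i" by linarith
  then show ?thesis
  proof cases
    case 1
    then show ?thesis using pick[of i] sizes(4) by (simp add: diag_def in1_def in2_def in3_def)
  next
    case 2
    then show ?thesis using pick[of "i - N"] sizes(5) by (simp add: diag_def in1_def in2_def in3_def)
  next
    case 3
    then show ?thesis using pick[of "i - (N + Suc d)"] assms
      by (simp add: diag_def in1_def in2_def in3_def)
  qed
qed

text \<open>The last columns are the image of \<open>W\<close> under the map taking the \<open>q\<close>-th
unit vector to its diagonal copy, so \<open>det W\<close> splits off. The remaining copies of unit vectors
form an identity matrix in block 3 and clear the columns of the roots of \<open>g\<close> there: modulo them
\<open>in3 w\<close> is \<open>- (in1 w + in2 w)\<close>.\<close>

lemma block_det_factor: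
  "block_det = (-1) ^ n * cdet W *
    cdet (map (\<lambda>a. in2 (pw a)) roots_f @ map (\<lambda>b i. in1 (pw b) i + in2 (pw b) i) roots_g @ [in2 (pw \<xi>)])"
proof -
  let ?T = "\<lambda>q. diag (unit_col q)"
  let ?A = "map (\<lambda>a. in2 (pw a)) roots_f" and ?B = "map (\<lambda>b. in3 (pw b)) roots_g"
    and ?x = "[in2 (pw \<xi>)]" and ?B' = "map (\<lambda>b i. in1 (pw b) i + in2 (pw b) i) roots_g"
  have lenA: "length ?A = m" "length ?B = n" by (simp_all add: roots_f_def roots_g_def)
  have len: "m + n + 1 = N + Suc d" using sizes(1) by simp
  have "block_det = cdet ((?A @ ?B @ ?x) @ map diag W)"
    by (simp add: block_det_def roots_f_def roots_g_def o_def)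
  also have "\<dots> = cdet ((?A @ ?B @ ?x) @ map (\<lambda>w i. \<Sum>q<M. w q * ?T q i) W)"
    using cdet_cong_map[of W "?A @ ?B @ ?x" "[]" diag "\<lambda>w i. \<Sum>q<M. w q * ?T q i"]
      diag_combination len lenA sizes(6) by simp
  also have "\<dots> = cdet ((?A @ ?B @ ?x) @ map ?T [0..<M]) * cdet W"
    by (rule cdet_factor_block) (rule sizes(6))
  also have "cdet ((?A @ ?B @ ?x) @ map ?T [0..<M]) =
      cdet (?A @ map (\<lambda>b i. (- 1) * (in1 (pw b) i + in2 (pw b) i) + (\<Sum>q<M. pw b q * ?T q i)) roots_g @
        ?x @ map ?T [0..<M])"
  proof -
    have "in3 v i = (- 1) * (in1 v i + in2 v i) + (\<Sum>q<M. v q * ?T q i)" if "i < N + Suc d + M" for v i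
      unfolding diag_combination[symmetric, OF that] by (simp add: diag_def)
    then show ?thesis
      unfolding append_assoc using len lenA
      by (intro cdet_cong_map) (simp_all add: roots_g_def)
  qed
  also have "\<dots> = cdet (?A @ map (\<lambda>b i. (- 1) * (in1 (pw b) i + in2 (pw b) i)) roots_g @ ?x @ map ?T [0..<M])"
    by (rule cdet_absorb_span)
  also have "\<dots> = (-1) ^ n * cdet ((?A @ ?B' @ ?x) @ map ?T [0..<M])"
    unfolding cdet_scale_map by (simp add: roots_g_def map_replicate_const)
  also have "cdet ((?A @ ?B' @ ?x) @ map ?T [0..<M]) = cdet (?A @ ?B' @ ?x) *
      cdet (map (\<lambda>v i. v (i + length (?A @ ?B' @ ?x))) (map ?T [0..<M]))"
    by (rule cdet_block_first) (use lenA len in \<open>auto simp: in1_def in2_def\<close>)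
  also have "map (\<lambda>v i. v (i + length (?A @ ?B' @ ?x))) (map ?T [0..<M]) = map unit_col [0..<M]"
    using lenA len by (simp add: diag_def in1_def in2_def in3_def)
  finally show ?thesis by (simp add: mult_ac)
qed

text \<open>Row operations with \<open>f\<close> confine the columns of its roots to the first
\<open>m\<close> rows, where they form a Vandermonde matrix; \<open>eval_cofactor_det\<close> evaluates the
complementary block.\<close>

lemma two_block_eval:
  "cdet (map (\<lambda>a. in2 (pw a)) roots_f @ map (\<lambda>b i. in1 (pw b) i + in2 (pw b) i) roots_g @ [in2 (pw \<xi>)])
    = vand roots_f * poly (root_poly roots_f) \<xi> * (-1) ^ (Suc d * (n - d) + (n - d - 1)) * vand roots_g *
      cofactor_det d (root_poly roots_f) (root_poly roots_g) \<xi>"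
proof -
  let ?f = "root_poly roots_f"
  let ?A = "map (\<lambda>a. in2 (pw a)) roots_f"
    and ?x = "[in2 (pw \<xi>)]" and ?B' = "map (\<lambda>b i. in1 (pw b) i + in2 (pw b) i) roots_g"
  have len: "length roots_f = m" "length roots_g = n" by (simp_all add: roots_f_def roots_g_def)
  have df: "degree ?f = m" by (simp add: len)
  have lf: "lead_coeff ?f = 1" using lead_coeff_root_poly[of roots_f] by (simp add: len)
  let ?t = "\<lambda>v i. if m \<le> i \<and> i < N then \<Sum>j\<le>m. coeff ?f j * v (i - m + j) else v i"
  have t2: "?t (in2 (pw u)) i = (if i < m then u ^ i else if i < N then u ^ (i - m) * poly ?f u else 0)" for u i
  proof (cases "m \<le> i \<and> i < N")
    case True
    have "in2 (pw u) (i - m + j) = u ^ (i - m) * u ^ j" if "j \<le> m" for j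
    proof -
      have "i - m + j < N" using True that by linarith
      then show ?thesis unfolding in2_def pw_def power_add[symmetric] by (rule if_P)
    qed
    then have "(\<Sum>j\<le>m. coeff ?f j * in2 (pw u) (i - m + j)) = (\<Sum>j\<le>m. u ^ (i - m) * (coeff ?f j * u ^ j))"
      by (intro sum.cong) (auto simp: mult_ac)
    also have "\<dots> = u ^ (i - m) * poly ?f u"
      by (simp only: poly_altdef df sum_distrib_left)
    finally show ?thesis using True by simp
  qed (use sizes(2) in \<open>auto simp: in2_def pw_def\<close>)
  have t12: "?t (\<lambda>i. in1 (pw u) i + in2 (pw u) i) i =
      (if i < N then ?t (in2 (pw u)) i else in1 (pw u) i)" for u i
    by (auto simp: in1_def in2_def intro!: sum.cong)
  have "cdet (?A @ ?B' @ ?x) = cdet (map ?t (?A @ ?B' @ ?x))"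
    by (rule cdet_multiply_rows_by_monic[OF lf df, symmetric]) (use sizes(1) in \<open>simp add: len\<close>)
  also have "\<dots> = cdet (map ?t ?A @ map ?t (?B' @ ?x))" by simp
  also have "\<dots> = cdet (map ?t ?A) * cdet (map (\<lambda>v i. v (i + length (map ?t ?A))) (map ?t (?B' @ ?x)))"
  proof (rule cdet_block_first)
    fix u i assume "u \<in> set (map ?t ?A)" and i: "length (map ?t ?A) \<le> i"
    then obtain a where a: "a \<in> set roots_f" "u = ?t (in2 (pw a))" by auto
    moreover have "poly ?f a = 0"
      using a(1) by (auto simp: poly_root_poly intro: prod_list_zero_map)
    ultimately show "u i = 0" unfolding a(2) t2 using i by (simp add: len)
  qed
  also have "cdet (map ?t ?A) = cdet (map pw roots_f)"
    by (rule cdet_cong) (auto simp: in2_def len sizes(2) less_trans[OF _ sizes(2)])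
  also have "\<dots> = vand roots_f" by (rule vandermonde)
  also have "cdet (map (\<lambda>v i. v (i + length (map ?t ?A))) (map ?t (?B' @ ?x))) =
      cdet (map (\<lambda>b i. if i < n - d then b ^ i * poly ?f b else b ^ (i - (n - d))) roots_g @
        [\<lambda>i. poly ?f \<xi> * (if i < n - d then \<xi> ^ i else 0)])"
  proof (rule cdet_cong)
    let ?L = "map (\<lambda>b i. if i < n - d then b ^ i * poly ?f b else b ^ (i - (n - d))) roots_g @
        [\<lambda>i. poly ?f \<xi> * (if i < n - d then \<xi> ^ i else 0)]"
    fix i j assume i: "i < length ?L" and j: "j < length ?L"
    have iN: "i + m < N \<longleftrightarrow> i < n - d" using sizes(1) d by linarith
    have i1: "in1 (pw u) (i + m) = u ^ (i - (n - d))" if "\<not> i < n - d" for u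
    proof -
      have "i + m - N = i - (n - d)" "i + m < N + Suc d" "N \<le> i + m"
        using that sizes(1) d i by (simp_all add: len)
      then show ?thesis by (simp add: in1_def pw_def)
    qed
    show "(map (\<lambda>v i. v (i + length (map ?t ?A))) (map ?t (?B' @ ?x)) ! j) i = (?L ! j) i"
    proof (cases "j < n")
      case True
      then have "(map (\<lambda>v i. v (i + length (map ?t ?A))) (map ?t (?B' @ ?x)) ! j) i =
          ?t (\<lambda>i. in1 (pw (roots_g ! j)) i + in2 (pw (roots_g ! j)) i) (i + m)"
        by (simp add: nth_append len)
      also have "\<dots> = (if i < n - d then (roots_g ! j) ^ i * poly ?f (roots_g ! j)
          else (roots_g ! j) ^ (i - (n - d)))"
        unfolding t12 t2 using iN i1 by simp
      finally show ?thesis using True by (simp add: nth_append len)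
    next
      case False
      then have "j = n" using j by (simp add: len)
      then have "(map (\<lambda>v i. v (i + length (map ?t ?A))) (map ?t (?B' @ ?x)) ! j) i =
          ?t (in2 (pw \<xi>)) (i + m)"
        by (simp add: nth_append len)
      also have "\<dots> = poly ?f \<xi> * (if i < n - d then \<xi> ^ i else 0)"
        unfolding t2 using iN by simp
      finally show ?thesis using \<open>j = n\<close> by (simp add: nth_append len)
    qed
  qed simp
  also have "\<dots> = poly ?f \<xi> * cdet (map (\<lambda>b i. if i < n - d then b ^ i * poly ?f b else b ^ (i - (n - d))) roots_g @
        [\<lambda>i. if i < n - d then \<xi> ^ i else 0])"
    by (rule cdet_scale)
  also have "cdet (map (\<lambda>b i. if i < n - d then b ^ i * poly ?f b else b ^ (i - (n - d))) roots_g @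
        [\<lambda>i. if i < n - d then \<xi> ^ i else 0]) =
      cdet (map (\<lambda>v i. if i < n - d then v (i + Suc d) else v (i - (n - d)))
        (map (\<lambda>b i. if i \<le> d then b ^ i else poly ?f b * b ^ (i - d - 1)) roots_g @
        [\<lambda>i. if i \<le> d then 0 else \<xi> ^ (i - d - 1)]))"
    by (rule cdet_cong) (use d in \<open>auto simp: nth_append len mult.commute less_Suc_eq\<close>)
  also have "\<dots> = (-1) ^ ((n - d) * Suc d) *
      cdet (map (\<lambda>b i. if i \<le> d then b ^ i else poly ?f b * b ^ (i - d - 1)) roots_g @
        [\<lambda>i. if i \<le> d then 0 else \<xi> ^ (i - d - 1)])"
    by (rule cdet_rotate_rows) (use d in \<open>simp add: len\<close>)
  also have "cdet (map (\<lambda>b i. if i \<le> d then b ^ i else poly ?f b * b ^ (i - d - 1)) roots_g @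
        [\<lambda>i. if i \<le> d then 0 else \<xi> ^ (i - d - 1)]) =
      (-1) ^ (n - d - 1) * vand roots_g * cofactor_det d ?f (root_poly roots_g) \<xi>"
    using eval_cofactor_det[of d ?f roots_g \<xi>] d by (simp add: df len)
  finally show ?thesis by (simp only: power_add mult_ac)
qed

text \<open>If the blocks are not square, then one of them has more columns than rows.\<close>

lemma three_blocks:
  assumes "length c2 + length c1 + length c3 = N + Suc d + M"
  shows "cdet (map in2 c2 @ map in1 c1 @ map in3 c3) =
    (if length c2 = N \<and> length c1 = Suc d then cdet c2 * cdet c1 * cdet c3 else 0)"
proof (cases "length c2 = N \<and> length c1 = Suc d")
  case True
  then have l3: "length c3 = M" using assms by simp
  have "cdet (map in2 c2 @ map in1 c1 @ map in3 c3) =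
      cdet (map in2 c2) * cdet (map (\<lambda>v i. v (i + length (map in2 c2))) (map in1 c1 @ map in3 c3))"
    by (rule cdet_block_first) (use True in \<open>auto simp: in2_def\<close>)
  also have "cdet (map in2 c2) = cdet c2"
    by (rule cdet_cong) (use True in \<open>auto simp: in2_def\<close>)
  also have "map (\<lambda>v i. v (i + length (map in2 c2))) (map in1 c1 @ map in3 c3) =
      map (\<lambda>v i. in1 v (i + N)) c1 @ map (\<lambda>v i. in3 v (i + N)) c3"
    using True by simp
  also have "cdet \<dots> = cdet (map (\<lambda>v i. in1 v (i + N)) c1) *
      cdet (map (\<lambda>v i. v (i + length (map (\<lambda>v i. in1 v (i + N)) c1))) (map (\<lambda>v i. in3 v (i + N)) c3))"
    by (rule cdet_block_first) (use True in \<open>auto simp: in1_def\<close>)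
  also have "cdet (map (\<lambda>v i. in1 v (i + N)) c1) = cdet c1"
    by (rule cdet_cong) (use True in \<open>auto simp: in1_def\<close>)
  also have "map (\<lambda>v i. v (i + length (map (\<lambda>v i. in1 v (i + N)) c1))) (map (\<lambda>v i. in3 v (i + N)) c3) = c3"
    using True by (intro nth_equalityI) (auto simp: in3_def fun_eq_iff)
  finally show ?thesis using True by simp
next
  case False
  then consider "length c2 > N" | "length c1 > Suc d" | "length c3 > M"
    using assms by linarith
  then have "cdet (map in2 c2 @ map in1 c1 @ map in3 c3) = 0"
  proof cases
    case 1
    have "cdet ([] @ map in2 c2 @ (map in1 c1 @ map in3 c3)) = 0"
      by (rule cdet_too_many_columns[of "{..<N}"]) (use 1 in \<open>auto simp: in2_def\<close>)
    then show ?thesis by simp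
  next
    case 2
    show ?thesis
      by (rule cdet_too_many_columns[of "{N..<N + Suc d}"]) (use 2 in \<open>auto simp: in1_def\<close>)
  next
    case 3
    have "cdet ((map in2 c2 @ map in1 c1) @ map in3 c3 @ []) = 0"
      by (rule cdet_too_many_columns[of "{N + Suc d..<N + Suc d + M}"])
        (use 3 assms in \<open>auto simp: in3_def\<close>)
    then show ?thesis by simp
  qed
  then show ?thesis unfolding if_not_P[OF False] .
qed

end

section \<open>Expansion of the block determinant\<close>

lemma minus_one_power_cong: "even a = even b \<Longrightarrow> (-1 :: 'a::comm_ring_1) ^ a = (-1) ^ b"
  by (cases "even a") (auto elim!: evenE oddE)

lemma mset_sl: "finite S \<Longrightarrow> mset (sl S) = mset_set S"
  using mset_set_set[of "sl S"] by simp

text \<open>The differences are oriented as in a Vandermonde product in which the nodes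
\<open>\<alpha>\<close> come before the nodes \<open>\<beta>\<close>.\<close>

definition Xprod :: "(int \<Rightarrow> 'a::comm_ring_1) \<Rightarrow> (int \<Rightarrow> 'a) \<Rightarrow> int set \<Rightarrow> int set \<Rightarrow> 'a" where
  "Xprod \<alpha> \<beta> I J = (\<Prod>i\<in>I. \<Prod>j\<in>J. \<beta> j - \<alpha> i)"

lemma prod_list_sl: "finite S \<Longrightarrow> (\<Prod>x\<leftarrow>sl S. h x) = (\<Prod>x\<in>S. h x)"
  by (simp add: prod.distinct_set_conv_list[symmetric])

lemma mset_upto: "mset [a..b] = mset_set {a..b}"
  using mset_sl[of "{a..b}"] by (simp only: sorted_list_of_set_int finite_atLeastAtMost_int)

lemma prod_list_upto: "(\<Prod>x\<leftarrow>[a..b]. h x) = (\<Prod>x\<in>{a..b}. h x)"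
  using prod_list_sl[of "{a..b}" h] by (simp only: sorted_list_of_set_int finite_atLeastAtMost_int)

lemma vand_join:
  assumes "finite I" "finite J"
  shows "vand (map \<alpha> (sl I) @ map \<beta> (sl J)) = vand (map \<alpha> (sl I)) * vand (map \<beta> (sl J)) * Xprod \<alpha> \<beta> I J"
  by (simp add: vand_append Xprod_def o_def prod_list_sl assms)

lemma Xprod_swap: "finite I \<Longrightarrow> finite J \<Longrightarrow> Xprod \<beta> \<alpha> J I = (-1) ^ (card J * card I) * Xprod \<alpha> \<beta> I J"
proof -
  assume fin: "finite I" "finite J"
  have "Xprod \<beta> \<alpha> J I = (\<Prod>i\<in>I. \<Prod>j\<in>J. (-1) * (\<beta> j - \<alpha> i))"
    unfolding Xprod_def by (subst prod.swap) simp
  also have "\<dots> = (-1) ^ (card J * card I) * Xprod \<alpha> \<beta> I J"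
    unfolding prod.distrib Xprod_def by (simp add: power_mult)
  finally show ?thesis .
qed

lemma Xprod_Un_left:
  "finite I \<Longrightarrow> finite I' \<Longrightarrow> I \<inter> I' = {} \<Longrightarrow> Xprod \<alpha> \<beta> (I \<union> I') J = Xprod \<alpha> \<beta> I J * Xprod \<alpha> \<beta> I' J"
  unfolding Xprod_def by (rule prod.union_disjoint)

lemma Xprod_Un_right:
  "finite J \<Longrightarrow> finite J' \<Longrightarrow> J \<inter> J' = {} \<Longrightarrow> Xprod \<alpha> \<beta> I (J \<union> J') = Xprod \<alpha> \<beta> I J * Xprod \<alpha> \<beta> I J'"
  unfolding Xprod_def by (simp add: prod.union_disjoint prod.distrib)

text \<open>What remains of the Vandermonde determinants of the three blocks when the factor common to all
summands is removed.\<close>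

definition node_weight ::
    "(int \<Rightarrow> 'a::comm_ring_1) \<Rightarrow> (int \<Rightarrow> 'a) \<Rightarrow> 'a \<Rightarrow> nat \<Rightarrow> nat \<Rightarrow> nat \<Rightarrow> nat \<Rightarrow> int set \<Rightarrow> int set \<Rightarrow> 'a" where
  "node_weight \<alpha> \<beta> \<xi> m n mb nb I J =
    (let I' = {1..int mb} - I; J' = {1..int nb} - J in
     vand (map \<alpha> (sl I)) * vand (map \<alpha> (sl I')) * vand (map \<beta> (sl J)) * vand (map \<beta> (sl J')) *
     Xprod \<alpha> \<beta> ({1..int m} - I) J' * Xprod \<alpha> \<beta> I' ({1..int n} - {1..int nb}) * (\<Prod>j\<in>J'. \<xi> - \<beta> j))"

text \<open>The Schur factors of the blocks 1, 2 and 3. The rows of block 1 are the last \<open>d + 1\<close>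
of \<open>N\<close> rows, which explains the shift of \<open>R1\<close>.\<close>

definition schur_weight ::
    "(int \<Rightarrow> 'a::comm_ring_1) \<Rightarrow> (int \<Rightarrow> 'a) \<Rightarrow> 'a \<Rightarrow> nat \<Rightarrow> nat \<Rightarrow> nat \<Rightarrow> nat \<Rightarrow> nat \<Rightarrow> nat \<Rightarrow> nat \<Rightarrow>
      int set \<Rightarrow> int set \<Rightarrow> int set \<Rightarrow> int set \<Rightarrow> int set \<Rightarrow> 'a" where
  "schur_weight \<alpha> \<beta> \<xi> m n mb nb d N M I J R1 R2 R3 =
     schur (int (Suc d)) ((\<lambda>l. l - (int N - int (Suc d))) ` R1)
       (image_mset \<alpha> (mset_set I) + image_mset \<beta> (mset_set J)) *
     schur (int N) R2
       (image_mset \<alpha> (mset_set {1..int m}) + {#\<xi>#} + image_mset \<beta> (mset_set ({1..int nb} - J))) *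
     schur (int M) R3
       (image_mset \<beta> (mset_set {1..int n}) + image_mset \<alpha> (mset_set ({1..int mb} - I)))"

text \<open>The sign exponent of the summand with \<open>a = card I\<close> and \<open>b = card J\<close>:
first the crossings of \<open>cdet_rearrange\<close>, then one contribution each for the unit columns in block
1, the factors \<open>\<alpha> - \<beta>\<close> in block 3 and the factors \<open>\<beta> - \<xi>\<close> in
block 2.\<close>

definition term_sign :: "nat \<Rightarrow> nat \<Rightarrow> nat \<Rightarrow> nat \<Rightarrow> nat \<Rightarrow> nat \<Rightarrow> nat \<Rightarrow> nat \<Rightarrow> nat \<Rightarrow> nat" where
  "term_sign n mb nb d N a b r1 r2 =
     n + (n + mb + b) * (nb - b) + (n + mb + b + r1) * r2 + n * a + (n + (mb - a)) * (b + r1) +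
     r1 * (N + Suc d) + n * (mb - a) + (nb - b)"

context sylvester_blocks
begin

lemma partitions3_bounds:
  assumes "(R1, R2, R3) \<in> partitions3 (int k)"
  shows "R2 \<subseteq> {1..int N}" "R1 \<subseteq> {1..int N}" "R3 \<subseteq> {1..int M}"
proof -
  have "R1 \<union> R2 \<union> R3 \<subseteq> {1..int N}" "R1 \<union> R2 \<union> R3 \<subseteq> {1..int M}"
    unfolding partitions3D(1)[OF assms] by (auto simp: k_def M_def)
  then show "R2 \<subseteq> {1..int N}" "R1 \<subseteq> {1..int N}" "R3 \<subseteq> {1..int M}" by auto
qed

definition raw_term :: "int set \<Rightarrow> int set \<Rightarrow> int set \<Rightarrow> int set \<Rightarrow> int set \<Rightarrow> 'a" where
  "raw_term I J R1 R2 R3 =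
     cdet (map in2 (map pa [1..int m]) @ map in3 (map pb [1..int n]) @ [in2 (pw \<xi>)] @
       map in1 (map pa (sl I)) @ map in3 (map pa (sl ({1..int mb} - I))) @
       map in1 (map pb (sl J)) @ map in2 (map pb (sl ({1..int nb} - J))) @
       map in1 (map ecol (sl R1)) @ map in2 (map ecol (sl R2)) @ map in3 (map ecol (sl R3)))"

text \<open>A node of \<open>Abar\<close> also has its own column in block 2, and one of \<open>Bbar\<close>
in block 3. Subtracting these columns leaves only two blocks for each such node, whereas a unit vector has
three.\<close>

lemma block_det_expand:
  "block_det = (\<Sum>I\<in>Pow {1..int mb}. of_int (sg I ({1..int mb} - I) {}) *
    (\<Sum>J\<in>Pow {1..int nb}. of_int (sg J ({1..int nb} - J) {}) *
    (\<Sum>(R1, R2, R3)\<in>partitions3 (int k). of_int (sg R1 R2 R3) * raw_term I J R1 R2 R3)))"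
proof -
  let ?us = "map in2 (map pa [1..int m]) @ map in3 (map pb [1..int n]) @ [in2 (pw \<xi>)]"
  let ?a = "map (\<lambda>i x. in1 (pa i) x + in3 (pa i) x) [1..int mb]"
    and ?b = "map (\<lambda>j x. in1 (pb j) x + in2 (pb j) x) [1..int nb]"
    and ?e = "map (\<lambda>l. diag (ecol l)) [1..int k]"
  let ?a' = "\<lambda>I. map (\<lambda>i. in1 (pa i)) (sl I) @ map (\<lambda>i. in3 (pa i)) (sl ({1..int mb} - I))"
    and ?b' = "\<lambda>J. map (\<lambda>j. in1 (pb j)) (sl J) @ map (\<lambda>j. in2 (pb j)) (sl ({1..int nb} - J))"
  have 1: "cdet (?us @ ?a' I @ ?b' J @ ?e) =
      (\<Sum>(R1, R2, R3)\<in>partitions3 (int k). of_int (sg R1 R2 R3) * raw_term I J R1 R2 R3)" for I J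
    using cdet_split3[of "?us @ ?a' I @ ?b' J" "\<lambda>l. in1 (ecol l)" "\<lambda>l. in2 (ecol l)"
        "\<lambda>l. in3 (ecol l)" "int k" "[]"]
    unfolding raw_term_def diag_def map_map o_def append_assoc append_Nil2 .
  have 2: "cdet (?us @ ?a' I @ ?b @ ?e) =
      (\<Sum>J\<in>Pow {1..int nb}. of_int (sg J ({1..int nb} - J) {}) * cdet (?us @ ?a' I @ ?b' J @ ?e))" for I
    using cdet_split2[of "?us @ ?a' I" "\<lambda>j. in1 (pb j)" "\<lambda>j. in2 (pb j)" "int nb" ?e]
    by (simp only: append_assoc)
  have 3: "cdet (?us @ ?a @ ?b @ ?e) =
      (\<Sum>I\<in>Pow {1..int mb}. of_int (sg I ({1..int mb} - I) {}) * cdet (?us @ ?a' I @ ?b @ ?e))"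
    using cdet_split2[of ?us "\<lambda>i. in1 (pa i)" "\<lambda>i. in3 (pa i)" "int mb" "?b @ ?e"]
    by (simp only: append_assoc)
  have "block_det = cdet (?us @ map (\<lambda>i x. (in1 (pa i) x + in3 (pa i) x) + in2 (pa i) x) [1..int mb] @
      (map (\<lambda>j. diag (pb j)) [1..int nb] @ ?e))"
    unfolding block_det_def W_def
    by (intro arg_cong[where f=cdet]) (simp add: diag_def fun_eq_iff add_ac)
  also have "\<dots> = cdet (?us @ ?a @ (map (\<lambda>j. diag (pb j)) [1..int nb] @ ?e))"
    by (rule cdet_absorb_map) (use mb in auto)
  also have "\<dots> = cdet ((?us @ ?a) @
      map (\<lambda>j x. (in1 (pb j) x + in2 (pb j) x) + in3 (pb j) x) [1..int nb] @ ?e)"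
    by (intro arg_cong[where f=cdet]) (simp add: diag_def fun_eq_iff add_ac)
  also have "\<dots> = cdet ((?us @ ?a) @ ?b @ ?e)"
    by (rule cdet_absorb_map) (use nb in auto)
  also have "\<dots> = cdet (?us @ ?a @ ?b @ ?e)"
    by (simp only: append_assoc)
  finally show ?thesis unfolding 3 2 1 .
qed

text \<open>The conditions for a nonzero term: blocks 1 and 2 (and with them block 3) are square, and the unit
vectors assigned to block 1 are not truncated to 0.\<close>

definition fits :: "int set \<Rightarrow> int set \<Rightarrow> int set \<Rightarrow> int set \<Rightarrow> bool" where
  "fits I J R1 R2 \<longleftrightarrow> Suc m + card ({1..int nb} - J) + card R2 = N \<and> card I + card J + card R1 = Suc d \<and>
     (\<forall>l\<in>R1. int N - l \<le> int d)"

text \<open>Sorted by blocks, a term is a product of three Vandermonde minors. For every pair of a node in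
\<open>Abar\<close> and a node in \<open>Bbar\<close> one of the blocks contains both of them; moreover all
roots of \<open>f\<close> lie in block 2 and all roots of \<open>g\<close> in block 3. Hence the corresponding
products of differences are common factors of all terms.\<close>

lemma raw_term_eval:
  assumes I: "I \<subseteq> {1..int mb}" and J: "J \<subseteq> {1..int nb}" and R: "(R1, R2, R3) \<in> partitions3 (int k)"
  shows "raw_term I J R1 R2 R3 =
    (if fits I J R1 R2 then
      (-1) ^ term_sign n mb nb d N (card I) (card J) (card R1) (card R2) * E {1..int k} *
      schur_weight \<alpha> \<beta> \<xi> m n mb nb d N M I J R1 R2 R3 *
      (vand roots_f * vand roots_g * poly (root_poly roots_f) \<xi> * Xprod \<alpha> \<beta> {1..int mb} {1..int nb}) *
      node_weight \<alpha> \<beta> \<xi> m n mb nb I J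
     else 0)"
proof -
  note R' = partitions3D[OF R] and cardR = partitions3_card[OF R]
  note finR = R'(5-7)
  have fin: "finite I" "finite J" using I J finite_subset by blast+
  let ?I' = "{1..int mb} - I" and ?J' = "{1..int nb} - J"
  have cI: "card ?I' = mb - card I" and cJ: "card ?J' = nb - card J"
    using I J fin by (simp_all add: card_Diff_subset)
  have leI: "card I \<le> mb" and leJ: "card J \<le> nb"
    using card_mono[OF _ I] card_mono[OF _ J] by simp_all
  define c2 where "c2 = map pw (roots_f @ [\<xi>] @ map \<beta> (sl ?J')) @ map ecol (sl R2)"
  define c1 where "c1 = map pw (map \<alpha> (sl I) @ map \<beta> (sl J)) @ map ecol (sl R1)"
  define c3 where "c3 = map pw (roots_g @ map \<alpha> (sl ?I')) @ map ecol (sl R3)"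
  let ?cross = "n + (n + mb + card J) * (nb - card J) + (n + mb + card J + card R1) * card R2 +
      n * card I + (n + (mb - card I)) * (card J + card R1)"
  have len2: "length c2 = Suc m + card ?J' + card R2" and len1: "length c1 = card I + card J + card R1"
    and len3: "length c3 = n + card ?I' + card R3"
    by (simp_all add: c1_def c2_def c3_def roots_f_def roots_g_def)
  have tot: "length c2 + length c1 + length c3 = N + Suc d + M"
    unfolding len1 len2 len3 cI cJ using cardR leI leJ sizes(1) by (simp add: M_def)
  have "raw_term I J R1 R2 R3 = (-1) ^ ?cross * cdet (map in2 c2 @ map in1 c1 @ map in3 c3)"
    unfolding raw_term_def
    by (subst cdet_rearrange)
       (use leI in \<open>simp add: c1_def c2_def c3_def roots_f_def roots_g_def o_def cI cJ\<close>)
  also have "cdet (map in2 c2 @ map in1 c1 @ map in3 c3) =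
      (if length c2 = N \<and> length c1 = Suc d then cdet c2 * cdet c1 * cdet c3 else 0)"
    by (rule three_blocks[OF tot])
  finally have raw: "raw_term I J R1 R2 R3 = (-1) ^ ?cross *
      (if length c2 = N \<and> length c1 = Suc d then cdet c2 * cdet c1 * cdet c3 else 0)" .
  show ?thesis
  proof (cases "length c2 = N \<and> length c1 = Suc d")
    case False
    then show ?thesis unfolding raw by (auto simp: fits_def len1 len2)
  next
    case True
    show ?thesis
    proof (cases "\<forall>l\<in>R1. int N - l \<le> int d")
      case low: False
      then obtain l where l: "l \<in> R1" "int N - l > int d" by auto
      then obtain ps qs where split: "sl R1 = ps @ l # qs"
        using finR by (metis set_sorted_list_of_set split_list)
      have "cdet c1 = cdet ((map pw (map \<alpha> (sl I) @ map \<beta> (sl J)) @ map ecol ps) @ (\<lambda>i. 0) # map ecol qs)"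
        using True l by (intro cdet_cong)
          (auto simp: c1_def split nth_append nth_Cons ecol_def unit_col_def split: nat.splits)
      then have "cdet c1 = 0" by (simp only: cdet_zero_column)
      moreover have "\<not> fits I J R1 R2" using low by (simp add: fits_def)
      ultimately show ?thesis unfolding raw by simp
    next
      case low: True
      have fits: "fits I J R1 R2" using True low by (simp add: fits_def len1 len2)
      note RN = partitions3_bounds[OF R]
      \<comment> \<open>Block 2 has the nodes \<open>\<alpha> 1, \<dots>, \<alpha> m\<close>, \<open>\<xi>\<close> and the \<open>\<beta> j\<close> with \<open>j \<notin> J\<close>; the factors \<open>\<beta> j - \<xi>\<close> are turned around.\<close>
      have m2: "mset (roots_f @ [\<xi>] @ map \<beta> (sl ?J')) =
          image_mset \<alpha> (mset_set {1..int m}) + {#\<xi>#} + image_mset \<beta> (mset_set ?J')"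
        by (simp add: roots_f_def mset_sl mset_upto)
      have v2: "vand (roots_f @ [\<xi>] @ map \<beta> (sl ?J')) =
          vand roots_f * vand (map \<beta> (sl ?J')) * poly (root_poly roots_f) \<xi> * Xprod \<alpha> \<beta> {1..int m} ?J' *
          ((-1) ^ card ?J' * (\<Prod>j\<in>?J'. \<xi> - \<beta> j))"
      proof -
        have "(\<Prod>y\<leftarrow>map \<beta> (sl ?J'). y - \<xi>) = (\<Prod>j\<in>?J'. (-1) * (\<xi> - \<beta> j))"
          by (simp add: o_def prod_list_sl)
        also have "\<dots> = (-1) ^ card ?J' * (\<Prod>j\<in>?J'. \<xi> - \<beta> j)"
          unfolding prod.distrib by simp
        finally have p: "(\<Prod>y\<leftarrow>map \<beta> (sl ?J'). y - \<xi>) = (-1) ^ card ?J' * (\<Prod>j\<in>?J'. \<xi> - \<beta> j)" .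
        have X: "(\<Prod>x\<leftarrow>roots_f. \<Prod>y\<leftarrow>map \<beta> (sl ?J'). y - x) = Xprod \<alpha> \<beta> {1..int m} ?J'"
          by (simp add: roots_f_def Xprod_def o_def prod_list_sl prod_list_upto)
        have f: "(\<Prod>x\<leftarrow>roots_f. \<xi> - x) = poly (root_poly roots_f) \<xi>"
          by (simp add: poly_root_poly)
        show ?thesis
          unfolding vand_append[of roots_f] vand_append[of "[\<xi>]"]
          by (simp add: p[simplified] prod_list_map_mult_const[symmetric] X[simplified] f mult_ac)
      qed
      have d2: "cdet c2 = E R2 * (schur (int N) R2 (mset (roots_f @ [\<xi>] @ map \<beta> (sl ?J'))) *
          vand (roots_f @ [\<xi>] @ map \<beta> (sl ?J')))"
        unfolding c2_def ecol_def units_sign_E[OF finR(2), symmetric]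
        by (rule cdet_vandermonde_units) (use RN True in \<open>auto simp: len2 roots_f_def\<close>)
      \<comment> \<open>Block 1 has \<open>d + 1\<close> rows, so row \<open>l\<close> in the numbering for \<open>N\<close> rows becomes row \<open>l - ?c\<close>.\<close>
      let ?c = "int N - int (Suc d)"
      let ?R1 = "(\<lambda>l. l - ?c) ` R1"
      have m1: "mset (map \<alpha> (sl I) @ map \<beta> (sl J)) = image_mset \<alpha> (mset_set I) + image_mset \<beta> (mset_set J)"
        using fin by (simp add: mset_sl)
      have e1: "map ecol (sl R1) = map (\<lambda>l. unit_col (nat (int (Suc d) - l))) (sl ?R1)"
        unfolding sl_shift[OF finR(1)] by (simp add: ecol_def)
      have u1: "units_sign (Suc d) (map (\<lambda>l. nat (int (Suc d) - l)) (sl ?R1)) =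
          (-1) ^ (card R1 * (N + Suc d)) * E R1"
      proof -
        have "units_sign (Suc d) (map (\<lambda>l. nat (int (Suc d) - l)) (sl ?R1)) =
            (\<Prod>l\<in>R1. (-1) ^ (Suc (Suc d) + nat (int N - l)))"
          unfolding sl_shift[OF finR(1)] units_sign_def
          by (simp add: o_def prod_list_sl[OF finR(1)])
        also have "\<dots> = (\<Prod>l\<in>R1. (-1) ^ (N + Suc d) * (-1) ^ (Suc N + nat (int N - l)))"
          unfolding power_add[symmetric] by (intro prod.cong refl minus_one_power_cong) auto
        also have "\<dots> = (-1) ^ (card R1 * (N + Suc d)) * E R1"
          unfolding prod.distrib E_def prod_constant
          by (simp only: power_mult[symmetric] mult.commute[of "card R1"])
        finally show ?thesis .
      qed
      have "cdet c1 = units_sign (Suc d) (map (\<lambda>l. nat (int (Suc d) - l)) (sl ?R1)) *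
          (schur (int (Suc d)) ?R1 (mset (map \<alpha> (sl I) @ map \<beta> (sl J))) * vand (map \<alpha> (sl I) @ map \<beta> (sl J)))"
        unfolding c1_def e1
      proof (rule cdet_vandermonde_units)
        have "card ?R1 = card R1" by (rule card_image) (simp add: inj_on_def)
        then show "length (map \<alpha> (sl I) @ map \<beta> (sl J)) + card ?R1 = Suc d"
          using True by (simp add: len1)
        show "?R1 \<subseteq> {1..int (Suc d)}"
        proof
          fix y assume "y \<in> ?R1"
          then obtain l where l: "l \<in> R1" "y = l - ?c" by auto
          moreover have "l \<in> {1..int N}" "int N - l \<le> int d" using l(1) RN(2) low by auto
          ultimately show "y \<in> {1..int (Suc d)}" by auto
        qed
      qed
      then have d1: "cdet c1 = (-1) ^ (card R1 * (N + Suc d)) * E R1 *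
          (schur (int (Suc d)) ?R1 (mset (map \<alpha> (sl I) @ map \<beta> (sl J))) * vand (map \<alpha> (sl I) @ map \<beta> (sl J)))"
        unfolding u1 .
      \<comment> \<open>Block 3 has \<open>M\<close> rows; if there are any unit columns, then \<open>M = N\<close>, so their sign is again given by \<open>E\<close>.\<close>
      have m3: "mset (roots_g @ map \<alpha> (sl ?I')) =
          image_mset \<beta> (mset_set {1..int n}) + image_mset \<alpha> (mset_set ?I')"
        by (simp add: roots_g_def mset_sl mset_upto)
      have v3: "vand (roots_g @ map \<alpha> (sl ?I')) =
          vand roots_g * vand (map \<alpha> (sl ?I')) * ((-1) ^ (n * card ?I') * Xprod \<alpha> \<beta> ?I' {1..int n})"
        using vand_join[of "{1..int n}" ?I' \<beta> \<alpha>] Xprod_swap[of ?I' "{1..int n}" \<beta> \<alpha>]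
        by (simp add: roots_g_def sorted_list_of_set_int)
      have d3: "cdet c3 = E R3 * (schur (int M) R3 (mset (roots_g @ map \<alpha> (sl ?I'))) *
          vand (roots_g @ map \<alpha> (sl ?I')))"
      proof -
        have l3: "length (roots_g @ map \<alpha> (sl ?I')) + card R3 = M"
          using tot True by (simp add: len3 roots_g_def)
        have M: "map ecol (sl R3) = map (\<lambda>l. unit_col (nat (int M - l))) (sl R3) \<and>
          E R3 = units_sign M (map (\<lambda>l. nat (int M - l)) (sl R3))"
        proof (cases "k = 0")
          case True
          then have "R3 = {}" using R'(1) by auto
          then show ?thesis by (simp add: E_def units_sign_def)
        next
          case False
          then have "M = N" using sizes(7) by simp
          then show ?thesis using units_sign_E[OF finR(3)] by (simp add: ecol_def)
        qed
        then have "cdet c3 = cdet (map pw (roots_g @ map \<alpha> (sl ?I')) @ map (\<lambda>l. unit_col (nat (int M - l))) (sl R3))"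
          by (simp only: c3_def)
        also have "\<dots> = E R3 * (schur (int M) R3 (mset (roots_g @ map \<alpha> (sl ?I'))) *
          vand (roots_g @ map \<alpha> (sl ?I')))"
          unfolding conjunct2[OF M] by (rule cdet_vandermonde_units[OF RN(3) l3])
        finally show ?thesis .
      qed
      have EE: "E R1 * E R2 * E R3 = E {1..int k}"
        using R'(1-4) finR by (simp flip: E_union add: Int_Un_distrib2)
      have X: "Xprod \<alpha> \<beta> I J * Xprod \<alpha> \<beta> {1..int m} ?J' * Xprod \<alpha> \<beta> ?I' {1..int n} =
          Xprod \<alpha> \<beta> {1..int mb} {1..int nb} * Xprod \<alpha> \<beta> ({1..int m} - I) ?J' *
          Xprod \<alpha> \<beta> ?I' ({1..int n} - {1..int nb})"
      proof -
        have "I \<subseteq> {1..int m}" using I mb by auto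
        then have 1: "Xprod \<alpha> \<beta> {1..int m} ?J' = Xprod \<alpha> \<beta> I ?J' * Xprod \<alpha> \<beta> ({1..int m} - I) ?J'"
          using Xprod_Un_left[of I "{1..int m} - I" \<alpha> \<beta> ?J'] fin by (simp add: Un_absorb1)
        have "{1..int n} = {1..int nb} \<union> ({1..int n} - {1..int nb})" using nb by auto
        then have 2: "Xprod \<alpha> \<beta> ?I' {1..int n} = Xprod \<alpha> \<beta> ?I' {1..int nb} * Xprod \<alpha> \<beta> ?I' ({1..int n} - {1..int nb})"
          using Xprod_Un_right[of "{1..int nb}" "{1..int n} - {1..int nb}" \<alpha> \<beta> ?I'] by auto
        have 3: "Xprod \<alpha> \<beta> K {1..int nb} = Xprod \<alpha> \<beta> K J * Xprod \<alpha> \<beta> K ?J'" for K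
          using Xprod_Un_right[of J ?J' \<alpha> \<beta> K] J fin by (simp add: Un_absorb1)
        have 4: "Xprod \<alpha> \<beta> {1..int mb} {1..int nb} = Xprod \<alpha> \<beta> I {1..int nb} * Xprod \<alpha> \<beta> ?I' {1..int nb}"
          using Xprod_Un_left[of I ?I' \<alpha> \<beta> "{1..int nb}"] I fin by (simp add: Un_absorb1)
        show ?thesis unfolding 1 2 4 3[of I] by (simp only: mult_ac)
      qed
      have "raw_term I J R1 R2 R3 = (-1) ^ ?cross * (cdet c2 * cdet c1 * cdet c3)"
        unfolding raw using True by simp
      also have "\<dots> = ((-1) ^ ?cross * (-1) ^ card ?J' * (-1) ^ (card R1 * (N + Suc d)) * (-1) ^ (n * card ?I')) *
          (E R1 * E R2 * E R3) * schur_weight \<alpha> \<beta> \<xi> m n mb nb d N M I J R1 R2 R3 *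
          (vand roots_f * vand roots_g * poly (root_poly roots_f) \<xi>) *
          (Xprod \<alpha> \<beta> I J * Xprod \<alpha> \<beta> {1..int m} ?J' * Xprod \<alpha> \<beta> ?I' {1..int n}) *
          (vand (map \<alpha> (sl I)) * vand (map \<alpha> (sl ?I')) * vand (map \<beta> (sl J)) * vand (map \<beta> (sl ?J')) *
           (\<Prod>j\<in>?J'. \<xi> - \<beta> j))"
        unfolding d1 d2 d3 m1 m2 m3 v2 v3 vand_join[OF fin] schur_weight_def
        by (simp only: mult_ac)
      also have "(-1) ^ ?cross * (-1) ^ card ?J' * (-1) ^ (card R1 * (N + Suc d)) * (-1) ^ (n * card ?I') =
          (-1 :: 'a) ^ term_sign n mb nb d N (card I) (card J) (card R1) (card R2)"
        unfolding term_sign_def cI cJ by (simp only: power_add mult_ac)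
      finally show ?thesis
        unfolding EE X node_weight_def Let_def using fits by (simp only: if_True mult_ac)
    qed
  qed
qed

definition double_sum :: 'a where
  "double_sum = (\<Sum>I\<in>Pow {1..int mb}. of_int (sg I ({1..int mb} - I) {}) *
    (\<Sum>J\<in>Pow {1..int nb}. of_int (sg J ({1..int nb} - J) {}) *
    (\<Sum>(R1, R2, R3)\<in>partitions3 (int k). of_int (sg R1 R2 R3) *
      (if fits I J R1 R2 then
        (-1) ^ term_sign n mb nb d N (card I) (card J) (card R1) (card R2) *
        schur_weight \<alpha> \<beta> \<xi> m n mb nb d N M I J R1 R2 R3 * node_weight \<alpha> \<beta> \<xi> m n mb nb I J
       else 0))))"

lemma block_det_eq_double_sum:
  "block_det = (E {1..int k} * vand roots_f * vand roots_g * poly (root_poly roots_f) \<xi> *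
     Xprod \<alpha> \<beta> {1..int mb} {1..int nb}) * double_sum" (is "_ = ?K * _")
proof -
  have "block_det = (\<Sum>I\<in>Pow {1..int mb}. of_int (sg I ({1..int mb} - I) {}) *
    (\<Sum>J\<in>Pow {1..int nb}. of_int (sg J ({1..int nb} - J) {}) *
    (\<Sum>R\<in>partitions3 (int k). (case R of (R1, R2, R3) \<Rightarrow> of_int (sg R1 R2 R3) *
      (?K * (if fits I J R1 R2 then
        (-1) ^ term_sign n mb nb d N (card I) (card J) (card R1) (card R2) *
        schur_weight \<alpha> \<beta> \<xi> m n mb nb d N M I J R1 R2 R3 * node_weight \<alpha> \<beta> \<xi> m n mb nb I J
       else 0))))))"
    unfolding block_det_expand
    by (intro sum.cong refl arg_cong2[where f="(*)"]) (auto simp: raw_term_eval mult_ac)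
  also have "\<dots> = ?K * double_sum"
    unfolding double_sum_def by (simp only: sum_distrib_left mult_ac case_prod_unfold)
  finally show ?thesis .
qed

text \<open>Both evaluations of the block determinant contain the same factor, which is nonzero for distinct
nodes.\<close>

lemma double_sum_if_distinct:
  assumes "distinct roots_f" "distinct roots_g" "\<xi> \<notin> set roots_f"
    and "\<And>i j. i \<in> {1..int mb} \<Longrightarrow> j \<in> {1..int nb} \<Longrightarrow> \<alpha> i \<noteq> \<beta> j"
  shows "double_sum = (-1) ^ (n + Suc d * (n - d) + (n - d - 1)) *
    (vand (map \<alpha> [1..int mb]) * vand (map \<beta> [1..int nb])) *
    cofactor_det d (root_poly roots_f) (root_poly roots_g) \<xi>"
proof -
  let ?K = "E {1..int k} * vand roots_f * vand roots_g * poly (root_poly roots_f) \<xi> *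
     Xprod \<alpha> \<beta> {1..int mb} {1..int nb}"
  have "E {1..int k} \<noteq> 0" using E_square[of "{1..int k}"] by (metis mult_zero_left zero_neq_one)
  moreover have "poly (root_poly roots_f) \<xi> \<noteq> 0"
    using assms(3) by (auto simp: poly_root_poly prod_list_zero_iff)
  moreover have "Xprod \<alpha> \<beta> {1..int mb} {1..int nb} \<noteq> 0"
    using assms(4)[THEN not_sym] by (auto simp: Xprod_def)
  ultimately have K: "?K \<noteq> 0" using vand_nonzero[OF assms(1)] vand_nonzero[OF assms(2)] by simp
  have "vand (map \<alpha> [1..int mb] @ map \<beta> [1..int nb]) = vand (map \<alpha> [1..int mb]) * vand (map \<beta> [1..int nb]) *
      Xprod \<alpha> \<beta> {1..int mb} {1..int nb}"
    using vand_join[of "{1..int mb}" "{1..int nb}" \<alpha> \<beta>] by (simp add: sorted_list_of_set_int)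
  then have "?K * double_sum = ?K * ((-1) ^ (n + Suc d * (n - d) + (n - d - 1)) *
    (vand (map \<alpha> [1..int mb]) * vand (map \<beta> [1..int nb])) *
    cofactor_det d (root_poly roots_f) (root_poly roots_g) \<xi>)"
    unfolding block_det_eq_double_sum[symmetric] block_det_factor two_block_eval cdet_W
    by (simp only: power_add mult_ac)
  with K show ?thesis by (rule mult_left_cancel[THEN iffD1])
qed

end

lemma hom_vand:
  fixes \<phi> :: "'a::comm_ring_1 \<Rightarrow> 'b::comm_ring_1"
  assumes "comm_ring_hom \<phi>"
  shows "\<phi> (vand xs) = vand (map \<phi> xs)"
proof -
  interpret comm_ring_hom \<phi> by fact
  have "\<phi> (\<Prod>y\<leftarrow>ys. h y) = (\<Prod>y\<leftarrow>ys. \<phi> (h y))" for h and ys :: "'a list"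
    by (induction ys) (simp_all add: hom_distribs)
  then show ?thesis by (induction xs) (simp_all add: hom_distribs o_def)
qed

lemma root_poly_Cons: "root_poly (x # xs) = smult (- x) (root_poly xs) + pCons 0 (root_poly xs)"
  by (simp add: root_poly_def)

lemma coeff_root_poly_hom:
  assumes "comm_ring_hom \<phi>"
  shows "coeff (root_poly (map \<phi> xs)) i = \<phi> (coeff (root_poly xs) i)"
proof -
  interpret comm_ring_hom \<phi> by fact
  show ?thesis
  proof (induction xs arbitrary: i)
    case Nil
    then show ?case by (simp add: root_poly_def)
  next
    case (Cons x xs)
    then show ?case by (cases i) (simp_all add: root_poly_Cons hom_distribs)
  qed
qed

lemma cofactor_det_hom:
  assumes "comm_ring_hom \<phi>"
  shows "\<phi> (cofactor_det d (root_poly xs) (root_poly ys) \<xi>) =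
    cofactor_det d (root_poly (map \<phi> xs)) (root_poly (map \<phi> ys)) (\<phi> \<xi>)"
proof -
  interpret comm_ring_hom \<phi> by fact
  have eq: "(\<lambda>k. \<phi> (sylvester_col d (root_poly zs) c i k)) = sylvester_col d (root_poly (map \<phi> zs)) (\<phi> c) i"
    for c zs i
    by (auto simp: sylvester_col_def coeff_monom_mult_1 coeff_root_poly_hom[OF assms])
  show ?thesis
    unfolding cofactor_det_def hom_cdet[OF assms] by (simp add: o_def eq hom_distribs)
qed

context sylvester_blocks
begin

text \<open>These are the sizes for which \<open>schur\<close> is defined by a quotient, so that it commutes
with ring homomorphisms.\<close>

lemma fits_cards:
  assumes I: "I \<subseteq> {1..int mb}" and J: "J \<subseteq> {1..int nb}" and R: "(R1, R2, R3) \<in> partitions3 (int k)"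
    and fits: "fits I J R1 R2"
  shows "card ({1..int (Suc d)} - (\<lambda>l. l - (int N - int (Suc d))) ` R1) = card I + card J"
    and "card ({1..int N} - R2) = Suc m + card ({1..int nb} - J)"
    and "card ({1..int M} - R3) = n + card ({1..int mb} - I)"
proof -
  note R' = partitions3D[OF R] and cardR = partitions3_card[OF R]
  note finR = R'(5-7)
  note RN = partitions3_bounds[OF R]
  have fin: "finite I" "finite J" using I J finite_subset by blast+
  have cI: "card ({1..int mb} - I) = mb - card I" and cJ: "card ({1..int nb} - J) = nb - card J"
    using I J fin by (simp_all add: card_Diff_subset)
  have le: "card I \<le> mb" "card J \<le> nb"
    using card_mono[OF _ I] card_mono[OF _ J] by simp_all
  have c: "card ((\<lambda>l. l - (int N - int (Suc d))) ` R1) = card R1"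
    by (rule card_image) (simp add: inj_on_def)
  have sub: "(\<lambda>l. l - (int N - int (Suc d))) ` R1 \<subseteq> {1..int (Suc d)}"
  proof
    fix y assume "y \<in> (\<lambda>l. l - (int N - int (Suc d))) ` R1"
    then obtain l where l: "l \<in> R1" "y = l - (int N - int (Suc d))" by auto
    moreover have "l \<in> {1..int N}" "int N - l \<le> int d"
      using l(1) RN(2) fits by (auto simp: fits_def)
    ultimately show "y \<in> {1..int (Suc d)}" by auto
  qed
  show "card ({1..int (Suc d)} - (\<lambda>l. l - (int N - int (Suc d))) ` R1) = card I + card J"
  proof -
    have "card I + card J + card R1 = Suc d" using fits by (simp add: fits_def)
    then show ?thesis
      unfolding card_Diff_subset[OF finite_imageI[OF finR(1)] sub] c by simp
  qed
  show "card ({1..int N} - R2) = Suc m + card ({1..int nb} - J)"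
    using fits finR RN by (subst card_Diff_subset) (auto simp: fits_def)
  show "card ({1..int M} - R3) = n + card ({1..int mb} - I)"
    using fits finR RN cardR le sizes(1) by (subst card_Diff_subset) (auto simp: fits_def cI cJ M_def)
qed

lemma hom_schur_weight:
  fixes \<phi> :: "'a \<Rightarrow> 'b::idom"
  assumes \<phi>: "comm_ring_hom \<phi>" and I: "I \<subseteq> {1..int mb}" and J: "J \<subseteq> {1..int nb}"
    and R: "(R1, R2, R3) \<in> partitions3 (int k)" and fits: "fits I J R1 R2"
  shows "\<phi> (schur_weight \<alpha> \<beta> \<xi> m n mb nb d N M I J R1 R2 R3) =
    schur_weight (\<lambda>i. \<phi> (\<alpha> i)) (\<lambda>j. \<phi> (\<beta> j)) (\<phi> \<xi>) m n mb nb d N M I J R1 R2 R3"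
proof -
  interpret comm_ring_hom \<phi> by fact
  note c = fits_cards[OF I J R fits]
  have fin: "finite I" "finite J" using I J finite_subset by blast+
  show ?thesis
    unfolding schur_weight_def hom_mult
    by (subst (1 2 3) hom_schur[OF \<phi>, symmetric])
      (use c in \<open>simp_all add: multiset.map_comp o_def\<close>)
qed

lemma hom_node_weight:
  fixes \<phi> :: "'a \<Rightarrow> 'b::idom"
  assumes \<phi>: "comm_ring_hom \<phi>"
  shows "\<phi> (node_weight \<alpha> \<beta> \<xi> m n mb nb I J) =
    node_weight (\<lambda>i. \<phi> (\<alpha> i)) (\<lambda>j. \<phi> (\<beta> j)) (\<phi> \<xi>) m n mb nb I J"
proof -
  interpret comm_ring_hom \<phi> by fact
  show ?thesis
    unfolding node_weight_def Let_def Xprod_def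
    by (simp add: hom_mult hom_vand[OF \<phi>] hom_prod hom_minus o_def)
qed

lemma hom_double_sum:
  fixes \<phi> :: "'a \<Rightarrow> 'b::idom"
  assumes \<phi>: "comm_ring_hom \<phi>"
  shows "\<phi> double_sum = sylvester_blocks.double_sum (\<lambda>i. \<phi> (\<alpha> i)) (\<lambda>j. \<phi> (\<beta> j)) (\<phi> \<xi>) m n mb nb d"
proof -
  interpret comm_ring_hom \<phi> by fact
  interpret h: sylvester_blocks "\<lambda>i. \<phi> (\<alpha> i)" "\<lambda>j. \<phi> (\<beta> j)" "\<phi> \<xi>" m n mb nb d
    by unfold_locales (rule d mb nb)+
  have "\<phi> double_sum = (\<Sum>I\<in>Pow {1..int mb}. of_int (sg I ({1..int mb} - I) {}) *
    (\<Sum>J\<in>Pow {1..int nb}. of_int (sg J ({1..int nb} - J) {}) *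
    (\<Sum>R\<in>partitions3 (int k). \<phi> (case R of (R1, R2, R3) \<Rightarrow> of_int (sg R1 R2 R3) *
      (if fits I J R1 R2 then
        (-1) ^ term_sign n mb nb d N (card I) (card J) (card R1) (card R2) *
        schur_weight \<alpha> \<beta> \<xi> m n mb nb d N M I J R1 R2 R3 * node_weight \<alpha> \<beta> \<xi> m n mb nb I J
       else 0)))))"
    unfolding double_sum_def by (simp only: hom_sum hom_mult hom_of_int)
  also have "\<dots> = h.double_sum"
    unfolding h.double_sum_def
  proof (intro sum.cong refl arg_cong2[where f="(*)"], goal_cases)
    case (1 I J R)
    then show ?case
      by (cases R) (auto simp: hom_distribs hom_schur_weight[OF \<phi>] hom_node_weight[OF \<phi>])
  qed
  finally show ?thesis .
qed

text \<open>Both sides commute with ring homomorphisms. So the identity for perturbed nodes over the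
polynomial ring, where \<open>double_sum_if_distinct\<close> applies, specialises at 0 to the one for
arbitrary nodes.\<close>

lemma double_sum_eq:
  "double_sum = (-1) ^ (n + Suc d * (n - d) + (n - d - 1)) *
    (vand (map \<alpha> [1..int mb]) * vand (map \<beta> [1..int nb])) *
    cofactor_det d (root_poly roots_f) (root_poly roots_g) \<xi>"
proof -
  \<comment> \<open>All exponents are different, and \<open>\<xi>\<close> stays constant.\<close>
  define A where "A = (\<lambda>i. perturb (nat i) (\<alpha> i))"
  define B where "B = (\<lambda>j. perturb (m + nat j) (\<beta> j))"
  let ?\<phi> = "\<lambda>p :: 'a poly. poly p 0"
  note hom = poly_0_hom[where ?'a = 'a]
  interpret \<phi>: comm_ring_hom ?\<phi> by (rule hom)
  interpret t: sylvester_blocks A B "[:\<xi>:]" m n mb nb d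
    by unfold_locales (rule d mb nb)+
  have inj: "inj_on A {1..int m}" "inj_on B {1..int n}"
  proof -
    show "inj_on A {1..int m}"
    proof (intro inj_onI, rule ccontr)
      fix x y assume "x \<in> {1..int m}" "y \<in> {1..int m}" "A x = A y" "x \<noteq> y"
      moreover from this have "nat x \<noteq> nat y" by auto
      ultimately show False using perturb_neq[of "nat x" "nat y" "\<alpha> x" "\<alpha> y"] by (simp add: A_def)
    qed
    show "inj_on B {1..int n}"
    proof (intro inj_onI, rule ccontr)
      fix x y assume "x \<in> {1..int n}" "y \<in> {1..int n}" "B x = B y" "x \<noteq> y"
      moreover from this have "m + nat x \<noteq> m + nat y" by auto
      ultimately show False using perturb_neq[of "m + nat x" "m + nat y" "\<beta> x" "\<beta> y"] by (simp add: B_def)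
    qed
  qed
  have AB: "A i \<noteq> B j" if "i \<in> {1..int m}" "j \<in> {1..int n}" for i j
    unfolding A_def B_def by (rule perturb_neq) (use that in auto)
  have "t.double_sum = (-1) ^ (n + Suc d * (n - d) + (n - d - 1)) *
    (vand (map A [1..int mb]) * vand (map B [1..int nb])) *
    cofactor_det d (root_poly t.roots_f) (root_poly t.roots_g) [:\<xi>:]"
  proof (rule t.double_sum_if_distinct)
    show "distinct t.roots_f" "distinct t.roots_g"
      using inj by (simp_all add: t.roots_f_def t.roots_g_def distinct_map)
    show "[:\<xi>:] \<notin> set t.roots_f"
    proof
      assume "[:\<xi>:] \<in> set t.roots_f"
      then obtain i where "[:\<xi>:] = perturb (nat i) (\<alpha> i)"
        unfolding t.roots_f_def by (auto simp: A_def)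
      then show False using perturb_neq_const[of "nat i" "\<alpha> i" \<xi>] by simp
    qed
    show "A i \<noteq> B j" if "i \<in> {1..int mb}" "j \<in> {1..int nb}" for i j
      by (rule AB) (use that mb nb in auto)
  qed
  then have "?\<phi> t.double_sum = (-1) ^ (n + Suc d * (n - d) + (n - d - 1)) *
    (?\<phi> (vand (map A [1..int mb])) * ?\<phi> (vand (map B [1..int nb]))) *
    ?\<phi> (cofactor_det d (root_poly t.roots_f) (root_poly t.roots_g) [:\<xi>:])"
    by simp
  moreover have "(\<lambda>i. ?\<phi> (A i)) = \<alpha>" "(\<lambda>j. ?\<phi> (B j)) = \<beta>" by (simp_all add: A_def B_def)
  ultimately show ?thesis
    unfolding t.hom_double_sum[OF hom] hom_vand[OF hom] cofactor_det_hom[OF hom]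
    by (simp add: o_def t.roots_f_def t.roots_g_def roots_f_def roots_g_def)
qed

end

section \<open>Subresultant matrices\<close>

text \<open>The reversal permutation acts twice, on rows and on columns, and its signs cancel.\<close>

lemma cdet_reverse_both:
  "cdet (map (\<lambda>i j. H (s - 1 - i) (s - 1 - j)) [0..<s]) = cdet (map (\<lambda>i j. H i j) [0..<s])"
proof -
  have rev1: "cdet (map (\<lambda>i j. K i (s - 1 - j)) [0..<s]) = reversal_sign s * cdet (map (\<lambda>i j. K i j) [0..<s])"
    for K :: "nat \<Rightarrow> nat \<Rightarrow> 'a"
    using cdet_reverse_rows[of "map (\<lambda>i j. K i j) [0..<s]"] by (simp add: o_def)
  have "cdet (map (\<lambda>i j. H (s - 1 - i) (s - 1 - j)) [0..<s]) =
      reversal_sign s * cdet (map (\<lambda>i j. H (s - 1 - i) j) [0..<s])"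
    by (rule rev1)
  also have "cdet (map (\<lambda>i j. H (s - 1 - i) j) [0..<s]) = cdet (map (\<lambda>j i. H (s - 1 - i) j) [0..<s])"
    by (rule cdet_transpose[symmetric])
  also have "\<dots> = reversal_sign s * cdet (map (\<lambda>j i. H i j) [0..<s])"
    by (rule rev1)
  also have "cdet (map (\<lambda>j i. H i j) [0..<s]) = cdet (map (\<lambda>i j. H i j) [0..<s])"
    by (rule cdet_transpose)
  finally show ?thesis using reversal_sign_square[of s, where ?'a = 'a] by (simp flip: mult.assoc)
qed

definition sylvester_row :: "nat \<Rightarrow> 'a::comm_ring_1 poly \<Rightarrow> (nat \<Rightarrow> 'a poly) \<Rightarrow> nat \<Rightarrow> nat \<Rightarrow> 'a poly" where
  "sylvester_row s h e i = (\<lambda>j. if Suc j = s then e i else [:coeff_int h (int (degree h) + int i - int j):])"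

lemma det_subres_matrix:
  fixes f g :: "'a::comm_ring_1 poly"
  defines "m \<equiv> degree f" and "n \<equiv> degree g"
  assumes d: "d < m" "d < n"
  shows "det (subres_matrix (int d) f g last_col) =
    cdet (map (sylvester_row (m + n - 2 * d) f (\<lambda>i. last_col (int i + 1))) [0..<n - d] @
      map (sylvester_row (m + n - 2 * d) g (\<lambda>i. last_col (int (n - d) + int i + 1))) [0..<m - d])"
proof -
  let ?s = "m + n - 2 * d"
  let ?L = "map (sylvester_row ?s f (\<lambda>i. last_col (int i + 1))) [0..<n - d] @
      map (sylvester_row ?s g (\<lambda>i. last_col (int (n - d) + int i + 1))) [0..<m - d]"
  let ?M = "subres_matrix (int d) f g last_col"
  have s: "int m + int n - 2 * int d = int ?s" "nat (int m + int n - 2 * int d) = ?s"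
    using d by linarith+
  have len: "length ?L = ?s" using d by simp
  have M: "?M \<in> carrier_mat ?s ?s"
    unfolding subres_matrix_def Let_def m_def[symmetric] n_def[symmetric] s(2) by simp
  have "det ?M = det (transpose_mat ?M)" by (rule det_transpose[OF M, symmetric])
  also have "transpose_mat ?M = mat (length ?L) (length ?L) (\<lambda>(i, j). (?L ! j) i)"
  proof (rule eq_matI)
    fix i j assume "i < dim_row (mat (length ?L) (length ?L) (\<lambda>(i, j). (?L ! j) i))"
      "j < dim_col (mat (length ?L) (length ?L) (\<lambda>(i, j). (?L ! j) i))"
    then have i: "i < ?s" and j: "j < ?s" unfolding len by simp_all
    have e: "transpose_mat ?M $$ (i, j) = (if int i + 1 = int ?s then last_col (int j + 1)
        else if int j + 1 \<le> int n - int d then [:coeff_int f (int m + (int j + 1) - (int i + 1)):]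
        else [:coeff_int g (int n + (int j + 1 - (int n - int d)) - (int i + 1)):])"
      using i j M unfolding subres_matrix_def Let_def m_def[symmetric] n_def[symmetric] s by simp
    have c: "int i + 1 = int ?s \<longleftrightarrow> Suc i = ?s" by linarith
    have R: "mat (length ?L) (length ?L) (\<lambda>(i, j). (?L ! j) i) $$ (i, j) = (?L ! j) i"
      unfolding len using i j by simp
    show "transpose_mat ?M $$ (i, j) = mat (length ?L) (length ?L) (\<lambda>(i, j). (?L ! j) i) $$ (i, j)"
    proof (cases "j < n - d")
      case True
      then have jn: "int j + 1 \<le> int n - int d" by linarith
      have "(?L ! j) i = sylvester_row ?s f (\<lambda>i. last_col (int i + 1)) j i"
        using True by (simp add: nth_append)
      moreover have "int m + (int j + 1) - (int i + 1) = int m + int j - int i" by simp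
      ultimately show ?thesis
        unfolding e c R sylvester_row_def m_def[symmetric] by (simp only: jn if_True)
    next
      case False
      then have jn: "\<not> int j + 1 \<le> int n - int d"
        and jd: "int (n - d) + int (j - (n - d)) + 1 = int j + 1"
          "int n + (int j + 1 - (int n - int d)) - (int i + 1) = int n + int (j - (n - d)) - int i"
        using d by linarith+
      have "j - (n - d) < m - d" using False j d by linarith
      then have "(?L ! j) i =
          sylvester_row ?s g (\<lambda>i. last_col (int (n - d) + int i + 1)) (j - (n - d)) i"
        using False by (simp add: nth_append)
      then show ?thesis
        unfolding e c R sylvester_row_def n_def[symmetric] jd by (simp only: jn if_False)
    qed
  qed (use M len in auto)
  finally show ?thesis by (simp only: cdet_def)
qed

text \<open>Exchanging \<open>f\<close> and \<open>g\<close> exchanges the two groups of rows of the matrix,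
including the entries of the last column.\<close>

lemma subres_G_eq_swapped_F:
  fixes f g :: "'a::comm_ring_1 poly"
  assumes d: "d < degree f" "d < degree g"
  shows "subres_G (int d) f g = (-1) ^ ((degree f - d) * (degree g - d)) * subres_F (int d) g f"
proof -
  let ?m = "degree f" and ?n = "degree g"
  let ?s = "?m + ?n - 2 * d"
  have i: "int (degree h - d) = int (degree h) - int d" if "d < degree h" for h :: "'a poly"
    using that by linarith
  have G: "subres_G (int d) f g = cdet (map (sylvester_row ?s f (\<lambda>_. 0)) [0..<?n - d] @
      map (sylvester_row ?s g (\<lambda>i. monom 1 (?m - d - Suc i))) [0..<?m - d])"
    unfolding subres_G_def Let_def det_subres_matrix[OF d]
    by (intro arg_cong[where f=cdet] arg_cong2[where f="(@)"] map_cong refl)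
      (use d in \<open>auto simp: sylvester_row_def fun_eq_iff i intro!: arg_cong[where f="monom 1"]\<close>)
  have F: "subres_F (int d) g f = cdet (map (sylvester_row ?s g (\<lambda>i. monom 1 (?m - d - Suc i))) [0..<?m - d] @
      map (sylvester_row ?s f (\<lambda>_. 0)) [0..<?n - d])"
    unfolding subres_F_def Let_def det_subres_matrix[OF d(2,1)] add.commute[of ?n]
    by (intro arg_cong[where f=cdet] arg_cong2[where f="(@)"] map_cong refl)
      (use d in \<open>auto simp: sylvester_row_def fun_eq_iff i intro!: arg_cong[where f="monom 1"]\<close>)
  show ?thesis
    unfolding G F
    using cdet_exchange[of "[]" "map (sylvester_row ?s f (\<lambda>_. 0)) [0..<?n - d]"
      "map (sylvester_row ?s g (\<lambda>i. monom 1 (?m - d - Suc i))) [0..<?m - d]" "[]"]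
    by (simp add: mult.commute)
qed

lemma const_poly_hom: "comm_ring_hom (\<lambda>a :: 'a::comm_ring_1. [:a:])"
  by unfold_locales (auto simp: one_pCons)

text \<open>Reversing the rows and the columns brings the last column to the first place and the degrees into
ascending order.\<close>

lemma subres_F_eq_cofactor_det:
  fixes as bs :: "'a::comm_ring_1 list"
  defines "m \<equiv> length as" and "n \<equiv> length bs"
  assumes d: "d < m" "d < n"
  shows "subres_F (int d) (root_poly as) (root_poly bs) = (-1) ^ ((m - d) * (n - d)) *
    cofactor_det d (root_poly (map (\<lambda>a. [:a:]) as)) (root_poly (map (\<lambda>b. [:b:]) bs)) [:0, 1:]"
proof -
  let ?f = "root_poly as" and ?g = "root_poly bs" and ?s = "m + n - 2 * d"
  let ?F = "root_poly (map (\<lambda>a. [:a:]) as)" and ?G = "root_poly (map (\<lambda>b. [:b:]) bs)"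
  let ?cF = "map (\<lambda>i. sylvester_col d ?F ([:0, 1:] ^ i) i) [0..<n - d]"
    and ?cG = "map (\<lambda>i. sylvester_col d ?G 0 i) [0..<m - d]"
  have deg: "degree ?f = m" "degree ?g = n" by (simp_all add: m_def n_def)
  let ?L = "map (sylvester_row ?s ?f (\<lambda>i. monom 1 (n - d - Suc i))) [0..<n - d] @
      map (sylvester_row ?s ?g (\<lambda>_. 0)) [0..<m - d]"
  define s P Q where "s = ?s" and P_def: "P = n - d" and Q_def: "Q = m - d"
  have s: "s = P + Q" and nP: "n = d + P" and mQ: "m = d + Q"
    using d by (simp_all add: \<open>s = ?s\<close> P_def Q_def)
  define L where "L = map (sylvester_row s ?f (\<lambda>i. monom 1 (P - Suc i))) [0..<P] @
      map (sylvester_row s ?g (\<lambda>_. 0)) [0..<Q]"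
  have len: "length L = s" by (simp add: L_def s)
  have "subres_F (int d) ?f ?g = cdet ?L"
    unfolding subres_F_def Let_def det_subres_matrix[of d ?f ?g, unfolded deg, OF d] deg
    by (intro arg_cong[where f=cdet] arg_cong2[where f="(@)"] map_cong refl)
      (use d in \<open>auto simp: sylvester_row_def fun_eq_iff intro!: arg_cong[where f="monom 1"]\<close>)
  also have "\<dots> = cdet (map (\<lambda>i j. (L ! i) j) [0..<s])"
    unfolding P_def[symmetric] Q_def[symmetric] \<open>s = ?s\<close>[symmetric] L_def[symmetric]
    by (rule cdet_cong) (simp_all add: len)
  also have "\<dots> = cdet (map (\<lambda>i j. (L ! (s - 1 - i)) (s - 1 - j)) [0..<s])"
    by (rule cdet_reverse_both[symmetric])
  also have "\<dots> = cdet (?cG @ ?cF)"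
  proof (rule cdet_cong)
    fix i j assume "i < length (?cG @ ?cF)" "j < length (?cG @ ?cF)"
    then have i: "i < s" and j: "j < s" by (simp_all add: s P_def Q_def)
    have ci: "coeff_int h (int d + int i - int t) = coeff (monom 1 t * h) (d + i)" for h :: "'a poly" and t
    proof (cases "t \<le> d + i")
      case True
      then have eq: "int d + int i - int t = int (d + i - t)" by linarith
      show ?thesis
        unfolding eq coeff_int_def coeff_monom_mult_1
        by (simp only: of_nat_less_0_iff nat_int if_False if_P[OF True])
    qed (simp add: coeff_int_def coeff_monom_mult_1)
    have cF: "coeff (monom 1 t * root_poly (map (\<lambda>a. [:a:]) zs)) p = [:coeff (monom 1 t * root_poly zs) p:]"
      for t p and zs :: "'a list"
      by (simp add: coeff_monom_mult_1 coeff_root_poly_hom[OF const_poly_hom])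
    have ext: "Suc (s - 1 - i) = s \<longleftrightarrow> i = 0" using i by linarith
    have base: "(map (\<lambda>i j. (L ! (s - 1 - i)) (s - 1 - j)) [0..<s] ! j) i = (L ! (s - 1 - j)) (s - 1 - i)"
      using j by simp
    show "(map (\<lambda>i j. (L ! (s - 1 - i)) (s - 1 - j)) [0..<s] ! j) i = ((?cG @ ?cF) ! j) i"
    proof (cases "j < Q")
      case True
      define q where "q = Q - 1 - j"
      have q: "q < Q" "q + j + 1 = Q" using True by (simp_all add: q_def)
      then have e: "s - 1 - j = P + q" using s by linarith
      have "(L ! (s - 1 - j)) (s - 1 - i) = sylvester_row s ?g (\<lambda>_. 0) q (s - 1 - i)"
        unfolding e using q by (simp add: L_def nth_append)
      also have "int n + int q - int (s - 1 - i) = int d + int i - int j"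
        using q i nP s by linarith
      then have "sylvester_row s ?g (\<lambda>_. 0) q (s - 1 - i) = sylvester_col d ?G 0 j i"
        unfolding sylvester_row_def sylvester_col_def ext deg cF by (simp only: ci)
      finally show ?thesis unfolding base using True by (simp add: nth_append Q_def)
    next
      case False
      define t where "t = j - Q"
      have t: "t < P" "s - 1 - j = P - 1 - t" "P - Suc (P - 1 - t) = t"
        using False j by (simp_all add: t_def s)
      have "(L ! (s - 1 - j)) (s - 1 - i) =
          sylvester_row s ?f (\<lambda>i. monom 1 (P - Suc i)) (P - 1 - t) (s - 1 - i)"
        unfolding t(2) using t(1) by (simp add: L_def nth_append)
      also have "int m + int (P - 1 - t) - int (s - 1 - i) = int d + int i - int t"
        using t(1) i mQ s by linarith
      then have "sylvester_row s ?f (\<lambda>i. monom 1 (P - Suc i)) (P - 1 - t) (s - 1 - i) =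
          sylvester_col d ?F ([:0, 1:] ^ t) t i"
        unfolding sylvester_row_def sylvester_col_def ext deg cF t(3) by (simp only: ci) (simp add: monom_altdef)
      finally show ?thesis unfolding base using False t(1) by (simp add: nth_append t_def P_def Q_def)
    qed
  qed (simp add: s P_def Q_def)
  also have "\<dots> = (-1) ^ ((m - d) * (n - d)) * cdet (?cF @ ?cG)"
    using cdet_exchange[of "[]" ?cG ?cF "[]"] by simp
  also have "cdet (?cF @ ?cG) = cofactor_det d ?F ?G [:0, 1:]"
    unfolding cofactor_det_def by (simp add: m_def n_def)
  finally show ?thesis .
qed

section \<open>Enumerated multisets and signs\<close>

text \<open>This turns the multiset of roots into a family of nodes in which the chosen distinct roots come
first.\<close>

lemma enumerate_with_prefix:
  fixes A :: "'a multiset"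
  assumes "finite S" "mset_set S \<subseteq># A"
  obtains \<alpha> :: "int \<Rightarrow> 'a" where "A = image_mset \<alpha> (mset_set {1..int (size A)})"
    "inj_on \<alpha> {1..int (card S)}" "\<alpha> ` {1..int (card S)} = S"
proof -
  obtain xs where xs: "set xs = S" "distinct xs" using assms(1) finite_distinct_list by blast
  obtain ys where ys: "mset ys = A - mset_set S" using ex_mset by blast
  define zs where "zs = xs @ ys"
  have "mset xs = mset_set S" using xs mset_set_set by metis
  then have zs: "mset zs = A" using ys assms(2) by (simp add: zs_def)
  then have len: "length zs = size A" by (metis size_mset)
  have lx: "length xs = card S" using xs distinct_card by metis
  define \<alpha> where "\<alpha> = (\<lambda>i. zs ! nat (i - 1))"
  have "map \<alpha> [1..int (length zs)] = zs"
    by (rule nth_equalityI) (auto simp: \<alpha>_def)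
  then have "A = mset (map \<alpha> [1..int (size A)])" using zs len by simp
  then have 1: "A = image_mset \<alpha> (mset_set {1..int (size A)})" by (simp add: mset_upto)
  have "map \<alpha> [1..int (card S)] = xs"
    by (rule nth_equalityI) (auto simp: \<alpha>_def zs_def nth_append lx)
  then have "distinct (map \<alpha> [1..int (card S)])" "set (map \<alpha> [1..int (card S)]) = S"
    using xs by simp_all
  then have "inj_on \<alpha> {1..int (card S)}" "\<alpha> ` {1..int (card S)} = S"
    by (simp_all add: distinct_map)
  with 1 show ?thesis by (rule that)
qed

lemma Rprod_images:
  "Rprod (image_mset \<beta> (mset_set J)) (image_mset \<alpha> (mset_set I)) = Xprod \<alpha> \<beta> I J"
proof -
  have "Rprod (image_mset \<beta> (mset_set J)) (image_mset \<alpha> (mset_set I)) = (\<Prod>j\<in>J. \<Prod>i\<in>I. \<beta> j - \<alpha> i)"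
    unfolding Rprod_def by (simp add: multiset.map_comp o_def prod_unfold_prod_mset)
  then show ?thesis unfolding Xprod_def by (subst prod.swap)
qed

lemma sum_subsets_image:
  assumes "inj_on \<alpha> S" "finite S"
  shows "(\<Sum>A' | A' \<subseteq> \<alpha> ` S \<and> int (card A') = c. h A') =
    (\<Sum>I | I \<subseteq> S \<and> int (card I) = c. h (\<alpha> ` I))"
proof (rule sum.reindex_cong[of "image \<alpha>"])
  show "inj_on (image \<alpha>) {I. I \<subseteq> S \<and> int (card I) = c}"
    using assms(1) by (auto simp: inj_on_def inj_on_image_eq_iff)
  show "{A'. A' \<subseteq> \<alpha> ` S \<and> int (card A') = c} = image \<alpha> ` {I. I \<subseteq> S \<and> int (card I) = c}"
  proof (intro equalityI subsetI)
    fix A' assume A': "A' \<in> {A'. A' \<subseteq> \<alpha> ` S \<and> int (card A') = c}"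
    then obtain I where "I \<subseteq> S" "A' = \<alpha> ` I" by (auto simp: subset_image_iff)
    with A' show "A' \<in> image \<alpha> ` {I. I \<subseteq> S \<and> int (card I) = c}"
      using card_image[OF inj_on_subset[OF assms(1)]] by force
  next
    fix A' assume "A' \<in> image \<alpha> ` {I. I \<subseteq> S \<and> int (card I) = c}"
    then show "A' \<in> {A'. A' \<subseteq> \<alpha> ` S \<and> int (card A') = c}"
      using card_image[OF inj_on_subset[OF assms(1)]] by auto
  qed
qed simp

lemma minus_one_powi: "(-1 :: 'a::field) powi z = (if even z then 1 else -1)"
  by (auto simp: power_int_def minus_one_power_iff even_nat_iff)

lemma minus_one_power: "(-1 :: 'a::comm_ring_1) ^ a = (if even a then 1 else -1)"
  by (simp add: minus_one_power_iff)

text \<open>Both sides are Vandermonde determinants of the same nodes in different orders.\<close>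

lemma vand_split:
  fixes \<alpha> :: "int \<Rightarrow> 'a::idom"
  assumes "I \<subseteq> {1..k}"
  shows "vand (map \<alpha> (sl I)) * vand (map \<alpha> (sl ({1..k} - I))) * Xprod \<alpha> \<alpha> I ({1..k} - I) =
    of_int (sg I ({1..k} - I) {}) * vand (map \<alpha> [1..k])"
proof -
  have fin: "finite I" using assms by (rule finite_subset) simp
  have "cdet (map (\<lambda>i. pw (\<alpha> i)) (sl I @ sl ({1..k} - I) @ sl {})) =
      of_int (sg I ({1..k} - I) {}) * cdet (map (\<lambda>i. pw (\<alpha> i)) [1..k])"
    using cdet_sg[of I "{1..k} - I" "{}" k "[]" "\<lambda>i. pw (\<alpha> i)" "[]"] assms by auto
  moreover have v: "cdet (map (\<lambda>i. pw (\<alpha> i)) l) = vand (map \<alpha> l)" for l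
    using vandermonde[of "map \<alpha> l"] by (simp add: o_def)
  ultimately have "vand (map \<alpha> (sl I @ sl ({1..k} - I) @ sl {})) =
      of_int (sg I ({1..k} - I) {}) * vand (map \<alpha> [1..k])" by (simp only: v)
  then show ?thesis using vand_join[of I "{1..k} - I" \<alpha> \<alpha>] fin by simp
qed

section \<open>Index sets and parities\<close>

lemma triples_F_iff:
  assumes "{1..(m - mb) + (n - nb) - d} = {1..k}"
  shows "(R1, R2, R3) \<in> triples_F m n mb nb d \<longleftrightarrow> (R1, R2, R3) \<in> partitions3 k \<and>
     R1 \<subseteq> {m + n - 2 * d..(m - mb) + (n - nb) - d} \<and> int (card R1) \<le> max 0 (d + 2 - (mb + nb)) \<and>
     (n - nb) - d - 1 \<le> int (card R2) \<and> int (card R2) \<le> n - d - 1 \<and>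
     (m - mb) - d \<le> int (card R3) \<and> int (card R3) \<le> m - d"
  using assms by (auto simp: triples_F_def index_triples_def partitions3_def Let_def)

context sylvester_blocks
begin

lemma int_k: "int k = max 0 ((int m - int mb) + (int n - int nb) - int d)"
  using sizes(1) mb nb by (auto simp: k_def N_def max_def)

text \<open>For the sizes this is linear arithmetic with the cases \<open>k = 0\<close> and
\<open>k > 0\<close>. The ranges of \<open>card R2\<close> and \<open>card R3\<close> follow from
\<open>0 \<le> card J \<le> nb\<close> and \<open>0 \<le> card I \<le> mb\<close>, and the bound on
\<open>card R1\<close> comes from the length of the interval that contains \<open>R1\<close>.\<close>

lemma fits_iff:
  assumes I: "I \<subseteq> {1..int mb}" and J: "J \<subseteq> {1..int nb}" and R: "(R1, R2, R3) \<in> partitions3 (int k)"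
  defines "m' \<equiv> int m - int mb" and "n' \<equiv> int n - int nb"
  shows "fits I J R1 R2 \<longleftrightarrow> (R1, R2, R3) \<in> triples_F (int m) (int n) (int mb) (int nb) (int d) \<and>
     int (card I) = int (card R3) + min n' (int d - m') \<and> int (card J) = int (card R2) - (n' - int d - 1)"
proof -
  have int: "{1..m' + n' - int d} = {1..int k}"
    using int_k by (auto simp: m'_def n'_def)
  note rs = partitions3_card[OF R]
  have fin: "finite I" "finite J" using I J finite_subset by blast+
  have cJ: "int (card ({1..int nb} - J)) = int nb - int (card J)"
    using card_mono[OF _ J] J fin by (simp add: card_Diff_subset)
  have le: "card I \<le> mb" "card J \<le> nb"
    using card_mono[OF _ I] card_mono[OF _ J] by simp_all
  have R1k: "R1 \<subseteq> {1..int k}" using R by (auto simp: partitions3_def)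
  have N: "int N = int m + int n - int d" using sizes(1) by linarith
  have low: "(\<forall>l\<in>R1. int N - l \<le> int d) \<longleftrightarrow> R1 \<subseteq> {int m + int n - 2 * int d..m' + n' - int d}"
  proof -
    have "l \<in> {int m + int n - 2 * int d..m' + n' - int d} \<longleftrightarrow> int N - l \<le> int d" if "l \<in> R1" for l
    proof -
      have "1 \<le> l" "l \<le> int k" using that R1k by auto
      then have "l \<le> m' + n' - int d" using int_k by (simp add: m'_def n'_def)
      then show ?thesis using N by auto
    qed
    then show ?thesis by blast
  qed
  have cR1: "int (card R1) \<le> max 0 (int d + 2 - (int mb + int nb))"
    if "R1 \<subseteq> {int m + int n - 2 * int d..m' + n' - int d}"
  proof -
    have "card R1 \<le> card {int m + int n - 2 * int d..m' + n' - int d}"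
      by (rule card_mono) (use that in auto)
    then show ?thesis by (simp add: m'_def n'_def)
  qed
  let ?r1 = "int (card R1)" and ?r2 = "int (card R2)" and ?r3 = "int (card R3)"
  let ?a = "int (card I)" and ?b = "int (card J)"
  have rsi: "?r1 + ?r2 + ?r3 = int k" using rs by linarith
  have sz: "Suc m + card ({1..int nb} - J) + card R2 = N \<and> card I + card J + card R1 = Suc d \<longleftrightarrow>
      ?b = ?r2 - (n' - int d - 1) \<and> ?a + ?b + ?r1 = int d + 1"
    using cJ N unfolding n'_def by linarith
  have eq: "?b = ?r2 - (n' - int d - 1) \<and> ?a + ?b + ?r1 = int d + 1 \<longleftrightarrow>
      ?a = ?r3 + min n' (int d - m') \<and> ?b = ?r2 - (n' - int d - 1)"
  proof (cases "m' + n' - int d \<le> 0")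
    case True
    then have "int k = 0" "min n' (int d - m') = n'" using int_k by (simp_all add: m'_def n'_def)
    then show ?thesis using rsi by linarith
  next
    case False
    then have "int k = m' + n' - int d" "min n' (int d - m') = int d - m'"
      using int_k by (simp_all add: m'_def n'_def)
    then show ?thesis using rsi by linarith
  qed
  have range: "n' - int d - 1 \<le> ?r2 \<and> ?r2 \<le> int n - int d - 1 \<and> m' - int d \<le> ?r3 \<and> ?r3 \<le> int m - int d"
    if "?a = ?r3 + min n' (int d - m')" "?b = ?r2 - (n' - int d - 1)"
  proof (cases "m' + n' - int d \<le> 0")
    case True
    then have "int k = 0" using int_k by (simp_all add: m'_def n'_def)
    then have "?r3 = 0" using rsi by linarith
    moreover have "m' - int d \<le> 0" using True nb by (simp add: n'_def)
    ultimately show ?thesis using that(2) le d by (simp add: n'_def)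
  next
    case False
    then have "min n' (int d - m') = int d - m'" by simp
    then show ?thesis using that le unfolding n'_def m'_def by linarith
  qed
  show ?thesis
    unfolding triples_F_iff[OF int[unfolded m'_def n'_def]] m'_def[symmetric] n'_def[symmetric]
    using sz eq range low cR1 R unfolding fits_def by blast
qed

lemma triples_F_subset: "triples_F (int m) (int n) (int mb) (int nb) (int d) \<subseteq> partitions3 (int k)"
proof
  fix R assume R: "R \<in> triples_F (int m) (int n) (int mb) (int nb) (int d)"
  obtain R1 R2 R3 where "R = (R1, R2, R3)" by (cases R)
  moreover have "{1..(int m - int mb) + (int n - int nb) - int d} = {1..int k}"
    using int_k by auto
  ultimately show "R \<in> partitions3 (int k)" using R triples_F_iff by blast
qed

text \<open>The two exponents agree only modulo 2. With \<open>m = d + q + 1\<close> and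
\<open>n = d + p + 1\<close> the conditions in \<open>fits\<close> determine all parities by those of
\<open>q\<close> and of the sizes of the index sets and their complements (by the latter alone if
\<open>k > 0\<close>), and a Boolean identity remains.\<close>

lemma sign_parity:
  assumes I: "I \<subseteq> {1..int mb}" and J: "J \<subseteq> {1..int nb}" and R: "(R1, R2, R3) \<in> partitions3 (int k)"
    and fits: "fits I J R1 R2"
  shows "even ((m - d) * (n - d) + (n + Suc d * (n - d) + (n - d - 1)) +
      term_sign n mb nb d N (card I) (card J) (card R1) (card R2) +
      card I * card ({1..int mb} - I) + card J * card ({1..int nb} - J)) \<longleftrightarrow>
    even ((int m - int d + (int n - int d - 1) * (int m - (int n - int nb))) +
      (int (card R1) * (int m - int d + int (card R2) + int (card R3)) + int (card R2) * int nb +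
       int (card R3) * ((int m - int mb) + (int n - int nb) - int d - 1) + int (card R2) * int (card R3)))"
proof -
  have fin: "finite I" "finite J" using I J finite_subset by blast+
  define a a' b b' where "a = card I" and "a' = card ({1..int mb} - I)"
    and "b = card J" and "b' = card ({1..int nb} - J)"
  have mb': "mb = a + a'" and nb': "nb = b + b'"
    using card_mono[OF _ I] card_mono[OF _ J] I J fin
    by (simp_all add: a_def a'_def b_def b'_def card_Diff_subset)
  define r1 r2 r3 where "r1 = card R1" and "r2 = card R2" and "r3 = card R3"
  have rs: "r1 + r2 + r3 = k" using partitions3_card[OF R] by (simp add: r1_def r2_def r3_def)
  have f1: "Suc m + b' + r2 = N" and f2: "a + b + r1 = Suc d"
    using fits by (simp_all add: fits_def a_def b_def b'_def r1_def r2_def)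
  obtain p where p: "n = Suc (d + p)" using d(2) less_imp_Suc_add by blast
  obtain q where q: "m = Suc (d + q)" using d(1) less_imp_Suc_add by blast
  have Np: "N = Suc (Suc (d + p + q))" using sizes(1) p q by linarith
  then have pb: "p = b' + r2" using f1 q by linarith
  have subs: "m - d = Suc q" "n - d = Suc p" "n - d - 1 = p" "nb - b = b'" "mb - a = a'"
    using p q mb' nb' by simp_all
  have ed: "even d \<longleftrightarrow> odd (a + b + r1)" using f2 by (metis even_Suc)
  have eN: "even N \<longleftrightarrow> even (d + p + q)" by (simp add: Np)
  have eq: "even q \<longleftrightarrow> odd (a' + r3)" if "k > 0"
  proof -
    have "Suc q = a' + r3" using sizes(8)[OF that] mb' nb' rs Np f2 pb by linarith
    then show ?thesis by (metis even_Suc)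
  qed
  have z: "r1 = 0" "r2 = 0" "r3 = 0" if "k = 0" using that rs by simp_all
  have L: "even ((m - d) * (n - d) + (n + Suc d * (n - d) + (n - d - 1)) +
      term_sign n mb nb d N (card I) (card J) (card R1) (card R2) +
      card I * card ({1..int mb} - I) + card J * card ({1..int nb} - J)) \<longleftrightarrow>
    even (Suc q * Suc p + (Suc (d + p) + Suc d * Suc p + p) +
      (Suc (d + p) + (Suc (d + p) + (a + a') + b) * b' + (Suc (d + p) + (a + a') + b + r1) * r2 +
       Suc (d + p) * a + (Suc (d + p) + a') * (b + r1) + r1 * (N + Suc d) + Suc (d + p) * a' + b') +
      a * a' + b * b')"
    unfolding term_sign_def a_def[symmetric] b_def[symmetric] a'_def[symmetric] b'_def[symmetric]
      r1_def[symmetric] r2_def[symmetric] subs unfolding mb' p by (simp only: diff_Suc_1)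
  have R: "even ((int m - int d + (int n - int d - 1) * (int m - (int n - int nb))) +
      (int (card R1) * (int m - int d + int (card R2) + int (card R3)) + int (card R2) * int nb +
       int (card R3) * ((int m - int mb) + (int n - int nb) - int d - 1) + int (card R2) * int (card R3))) \<longleftrightarrow>
    even (Suc q + p * (m + n + nb) + (r1 * (Suc q + r2 + r3) + r2 * nb + r3 * (m + mb + n + nb + d + 1) + r2 * r3))"
  proof -
    have "int m - int d = int (Suc q)" "int n - int d - 1 = int p" using p q by simp_all
    then show ?thesis
      unfolding r1_def[symmetric] r2_def[symmetric] r3_def[symmetric]
      by simp
        (cases "even r1"; cases "even r2"; cases "even r3"; cases "even q"; cases "even p";
         cases "even d"; cases "even m"; cases "even mb"; cases "even n"; simp)
  qed
  show ?thesis
  proof (cases "k = 0")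
    case True
    show ?thesis unfolding L R using ed eN z[OF True]
      by (simp add: pb mb' nb' p q)
         (cases "even a"; cases "even b"; cases "even a'"; cases "even b'"; cases "even q"; simp)
  next
    case False
    then have "k > 0" by simp
    show ?thesis unfolding L R using ed eN eq[OF \<open>k > 0\<close>]
      by (simp add: pb mb' nb' p q)
         (cases "even a"; cases "even b"; cases "even a'"; cases "even b'"; cases "even r1";
          cases "even r2"; cases "even r3"; simp)
  qed
qed

end

section \<open>The formulas\<close>

text \<open>The summand in the formula for \<open>F\<^sub>d\<close>. Exchanging the roles of \<open>f\<close>
and \<open>g\<close> gives the one for \<open>G\<^sub>d\<close>.\<close>

definition sylvester_summand ::
    "'a::field multiset \<Rightarrow> 'a multiset \<Rightarrow> 'a set \<Rightarrow> 'a set \<Rightarrow> int \<Rightarrow> int \<Rightarrow> int \<Rightarrow> int \<Rightarrow> int \<Rightarrow>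
      int set \<Rightarrow> int set \<Rightarrow> int set \<Rightarrow> 'a set \<Rightarrow> 'a set \<Rightarrow> 'a poly" where
  "sylvester_summand A B Abar Bbar m n m' n' d R1 R2 R3 A' B' =
     smult
       (Rprod (B - mset_set Bbar) (mset_set (Abar - A')) *
        Rprod (mset_set (Bbar - B')) (A - mset_set A') /
        (Rprod (mset_set A') (mset_set (Abar - A')) *
         Rprod (mset_set B') (mset_set (Bbar - B'))))
       (Rprod {#polyX#} (const_mset (mset_set (Bbar - B')))) *
     (if m' + n' \<le> d then 1
      else
       [: schur (d + 1) (shifted m n d R1) (mset_set A' + mset_set B') :] *
       schur (m + n - d) R2 (const_mset (A + mset_set (Bbar - B')) + {#polyX#}) *
       [: schur (m + n - d) R3 (mset_set (Abar - A') + B) :])"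

lemma smult_left_cancel:
  fixes c :: "'a::idom"
  shows "c \<noteq> 0 \<Longrightarrow> smult c p = smult c q \<Longrightarrow> p = q"
  using smult_eq_0_iff[of c "p - q"] by (simp add: smult_diff_right)

lemma const_vand: "vand (map (\<lambda>i. [:\<alpha> i:]) l) = [:vand (map \<alpha> l):]"
  using hom_vand[OF const_poly_hom, of "map \<alpha> l"] by (simp add: o_def)

lemma const_Xprod: "Xprod (\<lambda>i. [:\<alpha> i:]) (\<lambda>j. [:\<beta> j:]) I J = [:Xprod \<alpha> \<beta> I J:]"
proof -
  interpret comm_ring_hom "\<lambda>a :: 'a. [:a:]" by (rule const_poly_hom)
  show ?thesis unfolding Xprod_def by (simp only: hom_prod hom_minus)
qed

text \<open>The block determinant is formed over the polynomial ring, with constants as roots and the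
indeterminate as the node \<open>\<xi>\<close>.\<close>

locale subresultant_nodes =
  fixes \<alpha> \<beta> :: "int \<Rightarrow> 'a::field" and m n mb nb d :: nat
  assumes d: "d < m" "d < n" and mb: "mb \<le> m" and nb: "nb \<le> n"
    and inj: "inj_on \<alpha> {1..int mb}" "inj_on \<beta> {1..int nb}"
begin

sublocale P: sylvester_blocks "\<lambda>i. [:\<alpha> i:]" "\<lambda>j. [:\<beta> j:]" "[:0, 1:]" m n mb nb d
  by unfold_locales (rule d mb nb)+

abbreviation "A \<equiv> image_mset \<alpha> (mset_set {1..int m})"
abbreviation "B \<equiv> image_mset \<beta> (mset_set {1..int n})"
abbreviation "Abar \<equiv> \<alpha> ` {1..int mb}"
abbreviation "Bbar \<equiv> \<beta> ` {1..int nb}"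
abbreviation "m' \<equiv> int m - int mb"
abbreviation "n' \<equiv> int n - int nb"
abbreviation "summand \<equiv> sylvester_summand A B Abar Bbar (int m) (int n) m' n' (int d)"
abbreviation "vv \<equiv> vand (map \<alpha> [1..int mb]) * vand (map \<beta> [1..int nb])"

lemma mset_images:
  "I \<subseteq> {1..int mb} \<Longrightarrow> mset_set (\<alpha> ` I) = image_mset \<alpha> (mset_set I)"
  "J \<subseteq> {1..int nb} \<Longrightarrow> mset_set (\<beta> ` J) = image_mset \<beta> (mset_set J)"
  using inj by (simp_all add: image_mset_mset_set inj_on_subset)

lemma complements:
  "I \<subseteq> {1..int mb} \<Longrightarrow> Abar - \<alpha> ` I = \<alpha> ` ({1..int mb} - I)"
  "J \<subseteq> {1..int nb} \<Longrightarrow> Bbar - \<beta> ` J = \<beta> ` ({1..int nb} - J)"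
  using inj by (simp_all add: inj_on_image_set_diff[symmetric] Diff_subset)

lemma image_mset_Diff_set:
  assumes "finite T" "S \<subseteq> T"
  shows "image_mset h (mset_set T) - image_mset h (mset_set S) = image_mset h (mset_set (T - S))"
proof -
  have "mset_set T = mset_set S + mset_set (T - S)"
    using assms mset_set_Union[of S "T - S"] by (auto simp: Un_absorb1 dest: finite_subset)
  then show ?thesis by simp
qed

lemma vv_nonzero: "vv \<noteq> 0"
  using inj by (simp add: vand_nonzero distinct_map)

text \<open>This is where the denominators of the formula come from: the signed products of Vandermonde
determinants in \<open>node_weight\<close> are a fixed Vandermonde determinant divided by the differences
between the two parts.\<close>

lemma signed_vand_split:
  fixes \<gamma> :: "int \<Rightarrow> 'a" and c :: nat
  assumes "S \<subseteq> {1..int c}" "inj_on \<gamma> {1..int c}"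
  shows "of_int (sg S ({1..int c} - S) {}) *
      (vand (map \<gamma> (sl S)) * vand (map \<gamma> (sl ({1..int c} - S)))) =
    vand (map \<gamma> [1..int c]) * (-1) ^ (card S * card ({1..int c} - S)) /
      Rprod (image_mset \<gamma> (mset_set S)) (image_mset \<gamma> (mset_set ({1..int c} - S)))"
proof -
  let ?S' = "{1..int c} - S"
  have fin: "finite S" using assms(1) by (rule finite_subset) simp
  let ?s = "of_int (sg S ?S' {}) :: 'a" and ?e = "(-1 :: 'a) ^ (card S * card ?S')"
  let ?V = "vand (map \<gamma> (sl S)) * vand (map \<gamma> (sl ?S'))" and ?Y = "Xprod \<gamma> \<gamma> S ?S'"
  have s2: "?s * ?s = 1" by (rule sg_square)
  have e2: "?e * ?e = 1" by (simp flip: power_add)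
  have Y: "?Y \<noteq> 0"
    using assms by (auto simp: Xprod_def fin inj_on_def)
  have R: "Rprod (image_mset \<gamma> (mset_set S)) (image_mset \<gamma> (mset_set ?S')) = ?e * ?Y"
    unfolding Rprod_images using Xprod_swap[of S ?S' \<gamma> \<gamma>] fin by (simp add: mult.commute)
  have eq: "?s * ?V * ?Y = vand (map \<gamma> [1..int c])"
    using vand_split[OF assms(1), of \<gamma>] s2 by (simp add: mult.assoc)
  have "?s * ?V * (?e * ?Y) = (?s * ?V * ?Y) * ?e"
    by (simp only: mult_ac)
  then have eq': "?s * ?V * (?e * ?Y) = vand (map \<gamma> [1..int c]) * ?e"
    by (simp only: eq)
  have nz: "?e * ?Y \<noteq> 0" using Y by simp
  show ?thesis unfolding R by (rule nonzero_eq_divide_eq[OF nz, THEN iffD2, OF eq'])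
qed

lemma schur_weight_const:
  assumes I: "I \<subseteq> {1..int mb}" and J: "J \<subseteq> {1..int nb}"
    and R: "(R1, R2, R3) \<in> partitions3 (int P.k)" and fits: "P.fits I J R1 R2"
  shows "schur_weight (\<lambda>i. [:\<alpha> i:]) (\<lambda>j. [:\<beta> j:]) [:0, 1:] m n mb nb d P.N P.M I J R1 R2 R3 =
    (if m' + n' \<le> int d then 1
     else
       [: schur (int d + 1) (shifted (int m) (int n) (int d) R1) (mset_set (\<alpha> ` I) + mset_set (\<beta> ` J)) :] *
       schur (int m + int n - int d) R2 (const_mset (A + mset_set (Bbar - \<beta> ` J)) + {#polyX#}) *
       [: schur (int m + int n - int d) R3 (mset_set (Abar - \<alpha> ` I) + B) :])"
proof -
  let ?I' = "{1..int mb} - I" and ?J' = "{1..int nb} - J"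
  note c = P.fits_cards[OF I J R fits]
  have fin: "finite I" "finite J" using I J finite_subset by blast+
  have N: "int m + int n - int d = int P.N" using P.sizes(1) by linarith
  show ?thesis
  proof (cases "m' + n' \<le> int d")
    case True
    then have "P.k = 0" using P.int_k by simp
    then have "R1 = {}" "R2 = {}" "R3 = {}" using R by (auto simp: partitions3_def)
    then show ?thesis
      using True c unfolding schur_weight_def by (simp add: schur_full)
  next
    case False
    then have M: "P.M = P.N" using P.int_k P.sizes(7) by simp
    have sh: "(\<lambda>l. l - (int P.N - int (Suc d))) ` R1 = shifted (int m) (int n) (int d) R1"
      unfolding shifted_def N[symmetric] by (intro image_cong) auto
    have 1: "schur (int (Suc d)) ((\<lambda>l. l - (int P.N - int (Suc d))) ` R1)
        (image_mset (\<lambda>i. [:\<alpha> i:]) (mset_set I) + image_mset (\<lambda>j. [:\<beta> j:]) (mset_set J)) =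
      [:schur (int (Suc d)) ((\<lambda>l. l - (int P.N - int (Suc d))) ` R1)
        (image_mset \<alpha> (mset_set I) + image_mset \<beta> (mset_set J)):]"
      using hom_schur[OF const_poly_hom, of "int (Suc d)" "(\<lambda>l. l - (int P.N - int (Suc d))) ` R1"
        "image_mset \<alpha> (mset_set I) + image_mset \<beta> (mset_set J)"] c(1)
      by (simp add: multiset.map_comp o_def)
    have 3: "schur (int P.M) R3
        (image_mset (\<lambda>j. [:\<beta> j:]) (mset_set {1..int n}) + image_mset (\<lambda>i. [:\<alpha> i:]) (mset_set ?I')) =
      [:schur (int P.M) R3 (B + image_mset \<alpha> (mset_set ?I')):]"
      using hom_schur[OF const_poly_hom, of "int P.M" R3 "B + image_mset \<alpha> (mset_set ?I')"] c(3)
      by (simp add: multiset.map_comp o_def)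
    have Sd: "int (Suc d) = int d + 1" by simp
    show ?thesis
      using False
      unfolding schur_weight_def unfolding 1 3 unfolding sh unfolding M N Sd complements(1)[OF I] complements(2)[OF J]
        mset_images(1)[OF I] mset_images(2)[OF J] mset_images(1)[OF Diff_subset] mset_images(2)[OF Diff_subset]
      by (simp add: multiset.map_comp o_def add_ac)
  qed
qed

lemma node_weight_const:
  assumes I: "I \<subseteq> {1..int mb}" and J: "J \<subseteq> {1..int nb}"
  shows "of_int (sg I ({1..int mb} - I) {}) * (of_int (sg J ({1..int nb} - J) {}) *
      node_weight (\<lambda>i. [:\<alpha> i:]) (\<lambda>j. [:\<beta> j:]) [:0, 1:] m n mb nb I J) =
    smult (vv * (-1) ^ (card I * card ({1..int mb} - I) + card J * card ({1..int nb} - J)))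
     (smult
       (Rprod (B - mset_set Bbar) (mset_set (Abar - \<alpha> ` I)) *
        Rprod (mset_set (Bbar - \<beta> ` J)) (A - mset_set (\<alpha> ` I)) /
        (Rprod (mset_set (\<alpha> ` I)) (mset_set (Abar - \<alpha> ` I)) *
         Rprod (mset_set (\<beta> ` J)) (mset_set (Bbar - \<beta> ` J))))
       (Rprod {#polyX#} (const_mset (mset_set (Bbar - \<beta> ` J)))))"
proof -
  let ?I' = "{1..int mb} - I" and ?J' = "{1..int nb} - J"
  let ?sI = "of_int (sg I ?I' {}) :: 'a" and ?sJ = "of_int (sg J ?J' {}) :: 'a"
  let ?VI = "vand (map \<alpha> (sl I)) * vand (map \<alpha> (sl ?I'))"
    and ?VJ = "vand (map \<beta> (sl J)) * vand (map \<beta> (sl ?J'))"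
  let ?X1 = "Xprod \<alpha> \<beta> ({1..int m} - I) ?J'" and ?X2 = "Xprod \<alpha> \<beta> ?I' ({1..int n} - {1..int nb})"
  let ?\<Pi> = "\<Prod>j\<in>?J'. [:0, 1:] - [:\<beta> j:]"
  have Im: "I \<subseteq> {1..int m}" using I mb by auto
  have Pi: "Rprod {#polyX#} (const_mset (mset_set (Bbar - \<beta> ` J))) = ?\<Pi>"
    unfolding complements(2)[OF J] mset_images(2)[OF Diff_subset]
    by (simp add: Rprod_def multiset.map_comp o_def prod_unfold_prod_mset)
  have X1: "Rprod (mset_set (Bbar - \<beta> ` J)) (A - mset_set (\<alpha> ` I)) = ?X1"
    unfolding complements(2)[OF J] mset_images(2)[OF Diff_subset] mset_images(1)[OF I]
    by (subst image_mset_Diff_set) (use Im in \<open>auto simp: Rprod_images\<close>)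
  have X2: "Rprod (B - mset_set Bbar) (mset_set (Abar - \<alpha> ` I)) = ?X2"
    unfolding complements(1)[OF I] mset_images(1)[OF Diff_subset] mset_images(2)[OF subset_refl]
    by (subst image_mset_Diff_set) (use nb in \<open>auto simp: Rprod_images\<close>)
  have "of_int (sg I ?I' {}) * (of_int (sg J ?J' {}) *
      node_weight (\<lambda>i. [:\<alpha> i:]) (\<lambda>j. [:\<beta> j:]) [:0, 1:] m n mb nb I J) =
    [:?sI:] * ([:?sJ:] * node_weight (\<lambda>i. [:\<alpha> i:]) (\<lambda>j. [:\<beta> j:]) [:0, 1:] m n mb nb I J)"
    by (simp only: of_int_poly)
  also have "\<dots> = smult ((?sI * ?VI) * (?sJ * ?VJ) * (?X1 * ?X2)) ?\<Pi>"
    unfolding node_weight_def Let_def const_vand const_Xprod by (simp add: mult_ac)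
  also have "(?sI * ?VI) * (?sJ * ?VJ) * (?X1 * ?X2) =
      (vv * (-1) ^ (card I * card ?I' + card J * card ?J')) *
      (?X2 * ?X1 / (Rprod (image_mset \<alpha> (mset_set I)) (image_mset \<alpha> (mset_set ?I')) *
        Rprod (image_mset \<beta> (mset_set J)) (image_mset \<beta> (mset_set ?J'))))"
    unfolding signed_vand_split[OF I inj(1)] signed_vand_split[OF J inj(2)]
    by (simp add: power_add)
  finally show ?thesis
    unfolding Pi X1 X2 unfolding complements(1)[OF I] complements(2)[OF J] mset_images(1)[OF I] mset_images(2)[OF J]
      mset_images(1)[OF Diff_subset] mset_images(2)[OF Diff_subset]
    by simp
qed

definition outer_sign :: "int set \<Rightarrow> int set \<Rightarrow> int set \<Rightarrow> 'a" where
  "outer_sign R1 R2 R3 = (-1) powi (int m - int d + (int n - int d - 1) * (int m - n')) *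
     sign_F (int m) (int n) (int mb) (int nb) (int d) R1 R2 R3"

text \<open>The summands of \<open>double_sum\<close> are those of the formula, up to the constant factor
\<open>vv\<close> and signs.\<close>

lemma term_conversion:
  assumes I: "I \<subseteq> {1..int mb}" and J: "J \<subseteq> {1..int nb}"
    and R: "(R1, R2, R3) \<in> partitions3 (int P.k)"
  shows "of_int (sg I ({1..int mb} - I) {}) * (of_int (sg J ({1..int nb} - J) {}) *
    (of_int (sg R1 R2 R3) * (if P.fits I J R1 R2 then
        (-1) ^ term_sign n mb nb d P.N (card I) (card J) (card R1) (card R2) *
        schur_weight (\<lambda>i. [:\<alpha> i:]) (\<lambda>j. [:\<beta> j:]) [:0, 1:] m n mb nb d P.N P.M I J R1 R2 R3 *
        node_weight (\<lambda>i. [:\<alpha> i:]) (\<lambda>j. [:\<beta> j:]) [:0, 1:] m n mb nb I J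
       else 0))) =
    smult (vv * (-1) ^ ((m - d) * (n - d) + (n + Suc d * (n - d) + (n - d - 1))))
      (if P.fits I J R1 R2 then
        smult (outer_sign R1 R2 R3) (summand R1 R2 R3 (\<alpha> ` I) (\<beta> ` J)) else 0)"
proof (cases "P.fits I J R1 R2")
  case fits: True
  let ?e0 = "(m - d) * (n - d) + (n + Suc d * (n - d) + (n - d - 1))"
    and ?e1 = "term_sign n mb nb d P.N (card I) (card J) (card R1) (card R2)"
    and ?e2 = "card I * card ({1..int mb} - I) + card J * card ({1..int nb} - J)"
  let ?sw = "schur_weight (\<lambda>i. [:\<alpha> i:]) (\<lambda>j. [:\<beta> j:]) [:0, 1:] m n mb nb d P.N P.M I J R1 R2 R3"
    and ?nw = "node_weight (\<lambda>i. [:\<alpha> i:]) (\<lambda>j. [:\<beta> j:]) [:0, 1:] m n mb nb I J"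
  have sgn: "(-1) ^ ?e0 * outer_sign R1 R2 R3 = of_int (sg R1 R2 R3) * (-1) ^ ?e1 * (-1 :: 'a) ^ ?e2"
  proof -
    have "(-1) ^ (?e0 + ?e1 + ?e2) = (-1 :: 'a) powi (int m - int d + (int n - int d - 1) * (int m - n')) *
      (-1) powi (int (card R1) * (int m - int d + int (card R2) + int (card R3)) + int (card R2) * int nb +
       int (card R3) * (m' + n' - int d - 1) + int (card R2) * int (card R3))"
      (is "_ = (-1) powi ?u * (-1) powi ?v")
    proof -
      have "(-1 :: 'a) powi ?u * (-1) powi ?v = (if even (?u + ?v) then 1 else -1)"
        unfolding minus_one_powi by auto
      then show ?thesis
        unfolding minus_one_power using P.sign_parity[OF I J R fits] by (simp only: add.assoc)
    qed
    then have "outer_sign R1 R2 R3 = (-1) ^ (?e0 + ?e1 + ?e2) * of_int (sg R1 R2 R3)"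
      unfolding outer_sign_def sign_F_def Let_def by (simp only: mult_ac)
    moreover have "(-1 :: 'a) ^ ?e0 * (-1) ^ ?e0 = 1" by (simp flip: power_add)
    ultimately show ?thesis by (simp only: power_add mult_ac) (simp only: mult.assoc[symmetric], simp)
  qed
  have sm: "summand R1 R2 R3 (\<alpha> ` I) (\<beta> ` J) = (smult
       (Rprod (B - mset_set Bbar) (mset_set (Abar - \<alpha> ` I)) *
        Rprod (mset_set (Bbar - \<beta> ` J)) (A - mset_set (\<alpha> ` I)) /
        (Rprod (mset_set (\<alpha> ` I)) (mset_set (Abar - \<alpha> ` I)) *
         Rprod (mset_set (\<beta> ` J)) (mset_set (Bbar - \<beta> ` J))))
       (Rprod {#polyX#} (const_mset (mset_set (Bbar - \<beta> ` J))))) * ?sw"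
    unfolding sylvester_summand_def schur_weight_const[OF I J R fits] ..
  have "of_int (sg I ({1..int mb} - I) {}) * (of_int (sg J ({1..int nb} - J) {}) *
    (of_int (sg R1 R2 R3) * ((-1) ^ ?e1 * ?sw * ?nw))) =
    (of_int (sg R1 R2 R3) * (-1) ^ ?e1) * ?sw * (of_int (sg I ({1..int mb} - I) {}) * (of_int (sg J ({1..int nb} - J) {}) * ?nw))"
    by (simp only: mult_ac)
  also have "of_int (sg R1 R2 R3) * (-1) ^ ?e1 = [:of_int (sg R1 R2 R3) * (-1 :: 'a) ^ ?e1:]"
    by (simp add: minus_one_power of_int_poly)
  finally have "of_int (sg I ({1..int mb} - I) {}) * (of_int (sg J ({1..int nb} - J) {}) *
    (of_int (sg R1 R2 R3) * ((-1) ^ ?e1 * ?sw * ?nw))) =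
    smult (vv * (of_int (sg R1 R2 R3) * (-1) ^ ?e1 * (-1) ^ ?e2)) (summand R1 R2 R3 (\<alpha> ` I) (\<beta> ` J))"
    unfolding node_weight_const[OF I J] sm by (simp add: mult_ac)
  also have "\<dots> = smult (vv * (-1) ^ ?e0) (smult (outer_sign R1 R2 R3) (summand R1 R2 R3 (\<alpha> ` I) (\<beta> ` J)))"
    unfolding sgn[symmetric] by (simp add: mult_ac)
  finally show ?thesis using fits by simp
qed simp

text \<open>Comparing \<open>term_conversion\<close> with \<open>double_sum_eq\<close>, the nonzero constant
\<open>vv\<close> cancels.\<close>

lemma subres_F_nodes:
  "subres_F (int d) (root_poly (map \<alpha> [1..int m])) (root_poly (map \<beta> [1..int n])) =
    (\<Sum>(R1, R2, R3)\<in>partitions3 (int P.k). \<Sum>I\<in>Pow {1..int mb}. \<Sum>J\<in>Pow {1..int nb}.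
      if P.fits I J R1 R2 then
        smult (outer_sign R1 R2 R3) (summand R1 R2 R3 (\<alpha> ` I) (\<beta> ` J)) else 0)" (is "?F = ?S")
proof -
  let ?e0 = "(m - d) * (n - d)" and ?e1 = "n + Suc d * (n - d) + (n - d - 1)"
  let ?c = "cofactor_det d (root_poly P.roots_f) (root_poly P.roots_g) [:0, 1:]"
  let ?t = "\<lambda>R1 R2 R3 I J. if P.fits I J R1 R2 then
        smult (outer_sign R1 R2 R3) (summand R1 R2 R3 (\<alpha> ` I) (\<beta> ` J)) else 0"
  have F: "?F = (-1) ^ ?e0 * ?c"
    using subres_F_eq_cofactor_det[of d "map \<alpha> [1..int m]" "map \<beta> [1..int n]"] d
    by (simp add: P.roots_f_def P.roots_g_def o_def)
  have "P.double_sum = (\<Sum>I\<in>Pow {1..int mb}. \<Sum>J\<in>Pow {1..int nb}. \<Sum>(R1, R2, R3)\<in>partitions3 (int P.k).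
      smult (vv * (-1) ^ (?e0 + ?e1)) (?t R1 R2 R3 I J))"
    unfolding P.double_sum_def sum_distrib_left
  proof (intro sum.cong refl, goal_cases)
    case (1 I J R)
    obtain R1 R2 R3 where R: "R = (R1, R2, R3)" by (cases R)
    show ?case
      unfolding R prod.case
      by (rule term_conversion) (use 1 R in auto)
  qed
  also have "\<dots> = smult (vv * (-1) ^ (?e0 + ?e1)) (\<Sum>I\<in>Pow {1..int mb}. \<Sum>J\<in>Pow {1..int nb}.
      \<Sum>(R1, R2, R3)\<in>partitions3 (int P.k). ?t R1 R2 R3 I J)"
    by (simp only: smult_sum2 case_prod_unfold)
  also have "(\<Sum>I\<in>Pow {1..int mb}. \<Sum>J\<in>Pow {1..int nb}.
      \<Sum>(R1, R2, R3)\<in>partitions3 (int P.k). ?t R1 R2 R3 I J) =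
    (\<Sum>I\<in>Pow {1..int mb}. \<Sum>(R1, R2, R3)\<in>partitions3 (int P.k). \<Sum>J\<in>Pow {1..int nb}. ?t R1 R2 R3 I J)"
    unfolding case_prod_unfold by (intro sum.cong refl) (rule sum.swap)
  also have "\<dots> = ?S"
    unfolding case_prod_unfold by (rule sum.swap)
  finally have T1: "P.double_sum = smult (vv * (-1) ^ (?e0 + ?e1)) ?S" .
  have "P.double_sum = (-1) ^ ?e1 * ([:vand (map \<alpha> [1..int mb]):] * [:vand (map \<beta> [1..int nb]):]) * ?c"
    using P.double_sum_eq unfolding const_vand .
  also have "\<dots> = smult vv ((-1) ^ ?e1 * ?c)"
    by (simp add: mult_ac)
  finally have "smult vv ((-1) ^ ?e1 * ?c) = smult vv (smult ((-1) ^ (?e0 + ?e1)) ?S)"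
    using T1 by simp
  then have "(-1) ^ ?e1 * ?c = smult ((-1) ^ (?e0 + ?e1)) ?S"
    by (rule smult_left_cancel[OF vv_nonzero])
  then have "?c = smult ((-1) ^ ?e0) ?S"
    by (auto simp: minus_one_power split: if_splits)
  then show ?thesis unfolding F by (auto simp: minus_one_power)
qed

lemma subres_F_formula_nodes:
  "subres_F (int d) (root_poly (map \<alpha> [1..int m])) (root_poly (map \<beta> [1..int n])) =
    smult ((-1) powi (int m - int d + (int n - int d - 1) * (int m - n')))
     (\<Sum>(R1, R2, R3)\<in>triples_F (int m) (int n) (int mb) (int nb) (int d).
       smult (sign_F (int m) (int n) (int mb) (int nb) (int d) R1 R2 R3)
        (\<Sum>A' | A' \<subseteq> Abar \<and> int (card A') = int (card R3) + min n' (int d - m').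
         \<Sum>B' | B' \<subseteq> Bbar \<and> int (card B') = int (card R2) - (n' - int d - 1).
          summand R1 R2 R3 A' B'))"
proof -
  let ?T = "triples_F (int m) (int n) (int mb) (int nb) (int d)"
  let ?ca = "\<lambda>R3. int (card R3) + min n' (int d - m')" and ?cb = "\<lambda>R2. int (card R2) - (n' - int d - 1)"
  let ?t = "\<lambda>R1 R2 R3 I J. smult (outer_sign R1 R2 R3) (summand R1 R2 R3 (\<alpha> ` I) (\<beta> ` J))"
  have finP: "finite (partitions3 (int P.k))"
  proof (rule finite_subset)
    show "partitions3 (int P.k) \<subseteq> Pow {1..int P.k} \<times> Pow {1..int P.k} \<times> Pow {1..int P.k}"
      by (auto simp: partitions3_def)
  qed simp
  have inner: "(\<Sum>I\<in>Pow {1..int mb}. \<Sum>J\<in>Pow {1..int nb}. if P.fits I J R1 R2 then ?t R1 R2 R3 I J else 0) =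
      (if (R1, R2, R3) \<in> ?T then
        smult (outer_sign R1 R2 R3) (\<Sum>A' | A' \<subseteq> Abar \<and> int (card A') = ?ca R3.
          \<Sum>B' | B' \<subseteq> Bbar \<and> int (card B') = ?cb R2. summand R1 R2 R3 A' B') else 0)"
    if R: "(R1, R2, R3) \<in> partitions3 (int P.k)" for R1 R2 R3
  proof (cases "(R1, R2, R3) \<in> ?T")
    case True
    have "(\<Sum>I\<in>Pow {1..int mb}. \<Sum>J\<in>Pow {1..int nb}. if P.fits I J R1 R2 then ?t R1 R2 R3 I J else 0) =
      (\<Sum>I\<in>Pow {1..int mb}. if int (card I) = ?ca R3 then
        (\<Sum>J\<in>Pow {1..int nb}. if int (card J) = ?cb R2 then ?t R1 R2 R3 I J else 0) else 0)"
      using True by (intro sum.cong refl) (auto simp: P.fits_iff[OF _ _ R] intro!: sum.cong sum.neutral)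
    also have "\<dots> = (\<Sum>I | I \<subseteq> {1..int mb} \<and> int (card I) = ?ca R3.
        \<Sum>J | J \<subseteq> {1..int nb} \<and> int (card J) = ?cb R2. ?t R1 R2 R3 I J)"
      by (simp add: sum.inter_filter[symmetric] Pow_def Collect_conj_eq[symmetric] conj_commute)
    also have "\<dots> = smult (outer_sign R1 R2 R3) (\<Sum>A' | A' \<subseteq> Abar \<and> int (card A') = ?ca R3.
          \<Sum>B' | B' \<subseteq> Bbar \<and> int (card B') = ?cb R2. summand R1 R2 R3 A' B')"
      unfolding sum_subsets_image[OF inj(1) finite_atLeastAtMost_int]
        sum_subsets_image[OF inj(2) finite_atLeastAtMost_int] smult_sum2 ..
    finally show ?thesis using True by simp
  next
    case False
    then show ?thesis by (auto simp: P.fits_iff[OF _ _ R] intro!: sum.neutral)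
  qed
  have "subres_F (int d) (root_poly (map \<alpha> [1..int m])) (root_poly (map \<beta> [1..int n])) =
    (\<Sum>R\<in>partitions3 (int P.k). if R \<in> ?T then (case R of (R1, R2, R3) \<Rightarrow>
        smult (outer_sign R1 R2 R3) (\<Sum>A' | A' \<subseteq> Abar \<and> int (card A') = ?ca R3.
          \<Sum>B' | B' \<subseteq> Bbar \<and> int (card B') = ?cb R2. summand R1 R2 R3 A' B')) else 0)"
    unfolding subres_F_nodes
    by (intro sum.cong refl) (auto simp: inner split: prod.split)
  also have "\<dots> = (\<Sum>(R1, R2, R3)\<in>?T.
        smult (outer_sign R1 R2 R3) (\<Sum>A' | A' \<subseteq> Abar \<and> int (card A') = ?ca R3.
          \<Sum>B' | B' \<subseteq> Bbar \<and> int (card B') = ?cb R2. summand R1 R2 R3 A' B'))"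
    using P.triples_F_subset finP
    by (simp add: sum.inter_restrict[symmetric] Int_absorb1)
  finally show ?thesis
    unfolding outer_sign_def by (simp add: smult_sum2 case_prod_unfold)
qed

end

text \<open>The right-hand side of the formula for \<open>F\<^sub>d\<close> as a function of the two multisets
of roots, so that it can be used for \<open>(f, g)\<close> and for \<open>(g, f)\<close>.\<close>

definition sylvester_formula ::
    "'a::field multiset \<Rightarrow> 'a multiset \<Rightarrow> 'a set \<Rightarrow> 'a set \<Rightarrow> int \<Rightarrow> 'a poly" where
  "sylvester_formula A B Abar Bbar d =
    (let m = int (size A); n = int (size B); mbar = int (card Abar); nbar = int (card Bbar);
       m' = m - mbar; n' = n - nbar
     in smult ((-1) powi (m - d + (n - d - 1) * (m - n')))
       (\<Sum>(R1, R2, R3)\<in>triples_F m n mbar nbar d.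
         smult (sign_F m n mbar nbar d R1 R2 R3)
          (\<Sum>A' | A' \<subseteq> Abar \<and> int (card A') = int (card R3) + min n' (d - m').
           \<Sum>B' | B' \<subseteq> Bbar \<and> int (card B') = int (card R2) - (n' - d - 1).
            sylvester_summand A B Abar Bbar m n m' n' d R1 R2 R3 A' B')))"

lemma subres_F_formula:
  fixes A B :: "'a::field multiset"
  assumes Abar: "mset_set Abar \<subseteq># A" "finite Abar" and Bbar: "mset_set Bbar \<subseteq># B" "finite Bbar"
    and d: "0 \<le> d" "d < int (size A)" "d < int (size B)"
  shows "subres_F d (\<Prod>a\<in>#A. [:- a, 1:]) (\<Prod>b\<in>#B. [:- b, 1:]) = sylvester_formula A B Abar Bbar d"
proof -
  obtain \<alpha> where \<alpha>: "A = image_mset \<alpha> (mset_set {1..int (size A)})"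
    "inj_on \<alpha> {1..int (card Abar)}" "\<alpha> ` {1..int (card Abar)} = Abar"
    using enumerate_with_prefix[OF Abar(2,1)] by blast
  obtain \<beta> where \<beta>: "B = image_mset \<beta> (mset_set {1..int (size B)})"
    "inj_on \<beta> {1..int (card Bbar)}" "\<beta> ` {1..int (card Bbar)} = Bbar"
    using enumerate_with_prefix[OF Bbar(2,1)] by blast
  obtain d' where d': "d = int d'" using d(1) nonneg_int_cases by blast
  interpret subresultant_nodes \<alpha> \<beta> "size A" "size B" "card Abar" "card Bbar" d'
  proof
    show "card Abar \<le> size A" "card Bbar \<le> size B"
      using size_mset_mono[OF Abar(1)] size_mset_mono[OF Bbar(1)] by simp_all
  qed (use d d' \<alpha> \<beta> in simp_all)
  have prod: "(\<Prod>x\<in>#image_mset \<gamma> (mset_set {1..k}). [:- x, 1:]) = root_poly (map \<gamma> [1..k])"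
    for \<gamma> :: "int \<Rightarrow> 'a" and k
    by (simp add: root_poly_def prod_mset_prod_list[symmetric] mset_upto[symmetric] multiset.map_comp flip: mset_map)
  show ?thesis
    using subres_F_formula_nodes
    unfolding prod[symmetric] \<alpha>(1)[symmetric] \<beta>(1)[symmetric] \<alpha>(3) \<beta>(3) sylvester_formula_def Let_def d' .
qed

theorem theorem4p2:

  fixes f g :: "'a::field poly"
    and A B :: "'a multiset"
    and Abar Bbar :: "'a set"
    and m n mbar nbar m' n' d :: int
  assumes "lead_coeff f = 1" and "lead_coeff g = 1"
    and "int (degree f) = m" and "int (degree g) = n"
    and "f = (\<Prod>a\<in>#A. [:- a, 1:])" and "g = (\<Prod>b\<in>#B. [:- b, 1:])"
    and "Abar \<subseteq> {a. poly f a = 0}" and "Bbar \<subseteq> {b. poly g b = 0}"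
    and "mbar = int (card Abar)" and "nbar = int (card Bbar)"
    and "m' = m - mbar" and "n' = n - nbar"
    and "0 \<le> d" and "d < min m n"
  shows
    "subres_F d f g =
      smult ((-1) powi (m - d + (n - d - 1) * (m - n')))
       (\<Sum>(R1, R2, R3)\<in>triples_F m n mbar nbar d.
         smult (sign_F m n mbar nbar d R1 R2 R3)
          (\<Sum>A' | A' \<subseteq> Abar \<and> int (card A') = int (card R3) + min n' (d - m').
           \<Sum>B' | B' \<subseteq> Bbar \<and> int (card B') = int (card R2) - (n' - d - 1).
            smult
             (Rprod (B - mset_set Bbar) (mset_set (Abar - A')) *
              Rprod (mset_set (Bbar - B')) (A - mset_set A') /
              (Rprod (mset_set A') (mset_set (Abar - A')) *
               Rprod (mset_set B') (mset_set (Bbar - B'))))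
             (Rprod {#polyX#} (const_mset (mset_set (Bbar - B')))) *
            (if m' + n' \<le> d then 1
             else
               [: schur (d + 1) (shifted m n d R1) (mset_set A' + mset_set B') :] *
               schur (m + n - d) R2
                 (const_mset (A + mset_set (Bbar - B')) + {#polyX#}) *
               [: schur (m + n - d) R3 (mset_set (Abar - A') + B) :])))
     \<and>
     subres_G d f g =
      smult ((-1) powi ((m - d - 1) * (d - m')))
       (\<Sum>(R1, R2, R3)\<in>triples_G m n mbar nbar d.
         smult (sign_G m n mbar nbar d R1 R2 R3)
          (\<Sum>A' | A' \<subseteq> Abar \<and> int (card A') = int (card R2) - (m' - d - 1).
           \<Sum>B' | B' \<subseteq> Bbar \<and> int (card B') = int (card R3) + min m' (d - n').
            smult
             (Rprod (A - mset_set Abar) (mset_set (Bbar - B')) *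
              Rprod (mset_set (Abar - A')) (B - mset_set B') /
              (Rprod (mset_set A') (mset_set (Abar - A')) *
               Rprod (mset_set B') (mset_set (Bbar - B'))))
             (Rprod {#polyX#} (const_mset (mset_set (Abar - A')))) *
            (if m' + n' \<le> d then 1
             else
               [: schur (d + 1) (shifted m n d R1) (mset_set A' + mset_set B') :] *
               schur (m + n - d) R2
                 (const_mset (mset_set (Abar - A') + B) + {#polyX#}) *
               [: schur (m + n - d) R3 (A + mset_set (Bbar - B')) :])))"
proof -
  have sizeA: "m = int (size A)" and sizeB: "n = int (size B)"
  proof -
    have "degree (\<Prod>x\<in>#X. [:- x, 1:]) = size X" for X :: "'a multiset"
    proof -
      obtain xs where "X = mset xs" by (metis ex_mset)
      then show ?thesis using degree_root_poly[of xs]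
        by (simp add: root_poly_def prod_mset_prod_list[symmetric] flip: mset_map)
    qed
    then show "m = int (size A)" "n = int (size B)" using assms(3-6) by auto
  qed
  have sub: "mset_set S \<subseteq># X \<and> finite S" if "S \<subseteq> {a. poly (\<Prod>x\<in>#X. [:- x, 1:]) a = 0}" for S :: "'a set" and X
  proof -
    have "S \<subseteq> set_mset X"
      using that by (auto simp: poly_prod_mset prod_mset_zero_iff)
    then have "finite S" using finite_subset by blast
    moreover have "mset_set S \<subseteq># X"
      using \<open>S \<subseteq> set_mset X\<close> by (intro mset_subset_eqI) (auto simp: count_mset_set' Suc_le_eq)
    ultimately show ?thesis by blast
  qed
  have Abar: "mset_set Abar \<subseteq># A" "finite Abar" and Bbar: "mset_set Bbar \<subseteq># B" "finite Bbar"
    using sub[of Abar A] sub[of Bbar B] assms(5-8) by simp_all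
  have d: "0 \<le> d" "d < int (size A)" "d < int (size B)"
    using assms(13,14) sizeA sizeB by simp_all
  have F: "subres_F d f g = sylvester_formula A B Abar Bbar d"
    "subres_F d g f = sylvester_formula B A Bbar Abar d"
    using subres_F_formula[OF Abar Bbar d] subres_F_formula[OF Bbar Abar d(1,3,2)] assms(5,6) by simp_all
  let ?SA = "\<lambda>R2. {A'. A' \<subseteq> Abar \<and> int (card A') = int (card R2) - (m' - d - 1)}"
    and ?SB = "\<lambda>R3. {B'. B' \<subseteq> Bbar \<and> int (card B') = int (card R3) + min m' (d - n')}"
    and ?s = "\<lambda>R1 R2 R3 A' B'. sylvester_summand B A Bbar Abar n m n' m' d R1 R2 R3 B' A'"
  have swap: "(\<Sum>B'\<in>?SB R3. \<Sum>A'\<in>?SA R2. ?s R1 R2 R3 A' B') =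
      (\<Sum>A'\<in>?SA R2. \<Sum>B'\<in>?SB R3. ?s R1 R2 R3 A' B')" for R1 R2 R3
    by (rule sum.swap)
  have "triples_F n m nbar mbar d = triples_G m n mbar nbar d"
    by (simp add: triples_F_def triples_G_def index_triples_def Let_def add.commute)
  moreover have "sign_F n m nbar mbar d = (sign_G m n mbar nbar d :: int set \<Rightarrow> int set \<Rightarrow> int set \<Rightarrow> 'a)"
    by (simp add: sign_F_def sign_G_def Let_def fun_eq_iff algebra_simps)
  moreover have "sylvester_formula B A Bbar Abar d = smult ((-1) powi (n - d + (m - d - 1) * (n - m')))
     (\<Sum>(R1, R2, R3)\<in>triples_F n m nbar mbar d. smult (sign_F n m nbar mbar d R1 R2 R3)
        (\<Sum>B'\<in>?SB R3. \<Sum>A'\<in>?SA R2. ?s R1 R2 R3 A' B'))"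
    unfolding sylvester_formula_def Let_def assms(9-12) sizeA sizeB ..
  ultimately have Fgf: "subres_F d g f = smult ((-1) powi (n - d + (m - d - 1) * (n - m')))
     (\<Sum>(R1, R2, R3)\<in>triples_G m n mbar nbar d. smult (sign_G m n mbar nbar d R1 R2 R3)
        (\<Sum>A'\<in>?SA R2. \<Sum>B'\<in>?SB R3. ?s R1 R2 R3 A' B'))"
    unfolding F(2) by (simp only: swap)
  \<comment> \<open>Modulo 2, the sum of \<open>(m - d) * (n - d)\<close> and \<open>n - d\<close> is \<open>(m - d - 1) * (n - d)\<close>.\<close>
  have sign: "(-1) ^ ((degree f - nat d) * (degree g - nat d)) * (smult ((-1) powi (n - d + (m - d - 1) * (n - m'))) p) =
      smult ((-1) powi ((m - d - 1) * (d - m'))) p" for p :: "'a poly"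
  proof -
    have "int (degree f - nat d) = m - d" "int (degree g - nat d) = n - d"
      using assms(3,4,13,14) by linarith+
    then have "even ((degree f - nat d) * (degree g - nat d)) \<longleftrightarrow> even ((m - d) * (n - d))"
      by (metis even_of_nat of_nat_mult)
    then show ?thesis
      by (auto simp: minus_one_powi minus_one_power)
  qed
  have nd: "int (nat d) = d" using assms(13) by simp
  have "subres_G (int (nat d)) f g = (-1) ^ ((degree f - nat d) * (degree g - nat d)) * subres_F (int (nat d)) g f"
    by (rule subres_G_eq_swapped_F) (use assms(3,4,13,14) in linarith)+
  then have G: "subres_G d f g = smult ((-1) powi ((m - d - 1) * (d - m')))
     (\<Sum>(R1, R2, R3)\<in>triples_G m n mbar nbar d. smult (sign_G m n mbar nbar d R1 R2 R3)
        (\<Sum>A'\<in>?SA R2. \<Sum>B'\<in>?SB R3. ?s R1 R2 R3 A' B'))"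
    unfolding nd unfolding Fgf unfolding sign .
  have Gsummand: "?s R1 R2 R3 A' B' =
      smult
       (Rprod (A - mset_set Abar) (mset_set (Bbar - B')) *
        Rprod (mset_set (Abar - A')) (B - mset_set B') /
        (Rprod (mset_set A') (mset_set (Abar - A')) *
         Rprod (mset_set B') (mset_set (Bbar - B'))))
       (Rprod {#polyX#} (const_mset (mset_set (Abar - A')))) *
      (if m' + n' \<le> d then 1
       else
         [: schur (d + 1) (shifted m n d R1) (mset_set A' + mset_set B') :] *
         schur (m + n - d) R2
           (const_mset (mset_set (Abar - A') + B) + {#polyX#}) *
         [: schur (m + n - d) R3 (A + mset_set (Bbar - B')) :])" for R1 R2 R3 A' B'
    unfolding sylvester_summand_def shifted_def add.commute[of n m] add.commute[of n' m']
      add.commute[of "mset_set B'"] add.commute[of B] add.commute[of "mset_set (Bbar - B')"]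
      mult.commute[of "Rprod (mset_set B') (mset_set (Bbar - B'))"] ..
  show ?thesis
    using F(1) G
    unfolding Gsummand unfolding sylvester_formula_def Let_def sylvester_summand_def assms(9-12) sizeA sizeB
    by (rule conjI)
qed

end
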